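(* Let $\sigma\in\{0,1\}$. For any fixed $\mathcal{M}^*,\mathcal{P}^*>0$, the constrained minimization problem $$\min\ \mathcal{E}_\sigma(\Phi)\quad\text{subject to}\quad \mathcal{M}(\Phi)=\mathcal{M}^*\ \text{ and }\ \mathcal{P}(\Phi)=\mathcal{P}^*,$$ over $\Phi\in W^{\frac14,4}(\mathbb{T})$ with $\mathbb{P}_+\Phi=\Phi$, has a solution. The corresponding Euler-Lagrange equation $$\frac4\pi\,\mathcal{C}_\sigma[\Phi]=\lambda\,\Lambda^{-1}\Phi+\mu\,\Phi,$$ where $\lambda,\mu\in\mathbb{C}$ are Lagrange multipliers, coincides with the equation $$-c\,\Phi+\omega\,\Lambda^{-1}\Phi=\mathcal{C}_\sigma[\Phi]$$ for the profile of traveling waves $\Phi(x-ct)e^{i\omega t}$ of the filamentation equation $\partial_tu=\partial_x\mathcal{C}_\sigma[u]$. This construction gives traveling wave solutions for any fixed $\mathcal{M}^*$ and $\mathcal{P}^*$.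
   Context: $\mathbb{T}=\mathbb{R}/(2\pi\mathbb{Z})$; functions are complex valued, with Fourier coefficients $a_k=\frac1{2\pi}\int_0^{2\pi}u(x)e^{-ikx}\,dx$. $\mathbb{P}_+$ is the Fourier projector onto positive frequencies: $\mathbb{P}_+e^{ikx}=\mathbf{1}_{[1,\infty)}(k)e^{ikx}$. The cubic term is $$\mathcal{C}_\sigma[u](x)=\mathbb{P}_+\left[\frac1{4\pi}\int_0^{2\pi}\frac{|u(x)-u(y)|^2(u(x)-u(y))}{1-\cos(x-y)}\,dy-\sigma|u(x)|^2u(x)\right].$$ $W^{\frac14,4}(\mathbb{T})$ is the fractional Sobolev space of $u\in L^4(\mathbb{T})$ with $\int_0^{2\pi}\!\int_0^{2\pi}\frac{|u(x)-u(y)|^4}{1-\cos(x-y)}\,dx\,dy<\infty$. The energy is $$\mathcal{E}_\sigma(u)=\frac1{4\pi^2}\int_0^{2\pi}\!\!\int_0^{2\pi}\frac{|u(x)-u(y)|^4}{1-\cos(x-y)}\,dx\,dy-\frac{2\sigma}{\pi}\int_0^{2\pi}|u(x)|^4\,dx.$$ The momentum is $\mathcal{P}(u)=\int_0^{2\pi}|u|^2\,dx$ and the mass is $\mathcal{M}(u)=\int_0^{2\pi}|\partial_x^{-1/2}u|^2\,dx$, where $\partial_x$ is normalized as the Fourier multiplier with symbol $2\pi ik$, so that $\mathcal{M}(u)=\sum_{k\ge1}\frac{|a_k|^2}{k}$ for $u=\sum_{k\ge1}a_ke^{ikx}$. $\Lambda$ is the Fourier multiplier with symbol $2\pi|k|$,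 and $\Lambda^{-1}$ its inverse on functions with positive spectrum. For $\Phi$ only in $W^{\frac14,4}$ the equations are understood in a weak sense, namely after pairing with a smooth function. The two equations correspond to each other through $c=-\frac{\pi}{4}\mu$, $\omega=\frac{\pi}{4}\lambda$.
   Formalization: Needs 2πM* ≤ P*: every Φ with P₊Φ=Φ has 2πM(Φ) ≤ P(Φ), so otherwise no Φ meets the constraints. The wave has speed c and frequency ω/(2π) for ∂ₓ=d/dx, or speed 2πc and frequency ω for ∂ₓ of symbol 2πik, as Φ(x-ct)e^{iωt} fits the profile equation only up to factors 2π. *)

theory Defs
  imports "HOL-Analysis.Analysis"
begin

text \<open>Functions on the circle are \<open>2\<pi>\<close>-periodic functions of a real variable, with integrals
  over one period.\<close>

abbreviation period :: "real set" where
  "period \<equiv> {0..2*pi}"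

definition periodic_2pi :: "(real \<Rightarrow> 'a) \<Rightarrow> bool" where
  "periodic_2pi u \<longleftrightarrow> (\<forall>x. u (x + 2*pi) = u x)"

definition smooth_periodic :: "(real \<Rightarrow> complex) \<Rightarrow> bool" where
  "smooth_periodic \<phi> \<longleftrightarrow> periodic_2pi \<phi> \<and>
     (\<exists>D. D 0 = \<phi> \<and> (\<forall>n x. (D n has_vector_derivative D (Suc n) x) (at x)))"

definition fourier_coeff :: "(real \<Rightarrow> complex) \<Rightarrow> int \<Rightarrow> complex" where
  "fourier_coeff u k = (LINT x:period|lborel. u x * cis (- (of_int k * x))) / of_real (2*pi)"

text \<open>The property \<open>P\<^sub>+ u = u\<close>, expressed on the Fourier side so that it makes sense for every
  integrable \<open>u\<close>, whether or not its Fourier series converges pointwise.\<close>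

definition positive_spectrum :: "(real \<Rightarrow> complex) \<Rightarrow> bool" where
  "positive_spectrum u \<longleftrightarrow>
     (\<forall>k. fourier_coeff u k = (if k \<ge> 1 then fourier_coeff u k else 0))"

text \<open>Multipliers supported on the positive frequencies, as pointwise Fourier series. They are only
  applied where the series converges absolutely: \<open>P_plus\<close> to smooth functions, and \<open>Lambda_inv\<close>,
  whose symbol is square summable, to square integrable functions.\<close>

definition pos_multiplier :: "(nat \<Rightarrow> real) \<Rightarrow> (real \<Rightarrow> complex) \<Rightarrow> real \<Rightarrow> complex" where
  "pos_multiplier m u x =
     (\<Sum>n. of_real (m (Suc n)) * fourier_coeff u (int (Suc n)) * cis (real (Suc n) * x))"

definition P_plus :: "(real \<Rightarrow> complex) \<Rightarrow> real \<Rightarrow> complex" where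
  "P_plus = pos_multiplier (\<lambda>k. 1)"

definition Lambda_inv :: "(real \<Rightarrow> complex) \<Rightarrow> real \<Rightarrow> complex" where
  "Lambda_inv = pos_multiplier (\<lambda>k. 1 / (2*pi * real k))"

definition W14_4 :: "(real \<Rightarrow> complex) \<Rightarrow> bool" where
  "W14_4 u \<longleftrightarrow> periodic_2pi u \<and> u \<in> borel_measurable borel \<and>
     set_integrable lborel period (\<lambda>x. norm (u x) ^ 4) \<and>
     set_integrable lborel (period \<times> period) (\<lambda>(x, y). norm (u x - u y) ^ 4 / (1 - cos (x - y)))"

definition admissible :: "(real \<Rightarrow> complex) \<Rightarrow> bool" where
  "admissible u \<longleftrightarrow> W14_4 u \<and> positive_spectrum u"

definition energy :: "real \<Rightarrow> (real \<Rightarrow> complex) \<Rightarrow> real" where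
  "energy \<sigma> u =
     1 / (4 * pi^2) *
       (LINT (x, y):period \<times> period|lborel. norm (u x - u y) ^ 4 / (1 - cos (x - y)))
     - 2 * \<sigma> / pi * (LINT x:period|lborel. norm (u x) ^ 4)"

definition momentum :: "(real \<Rightarrow> complex) \<Rightarrow> real" where
  "momentum u = (LINT x:period|lborel. norm (u x) ^ 2)"

text \<open>With \<open>\<partial>\<^sub>x\<close> normalized to have symbol \<open>2\<pi>ik\<close>, this is the integral of
  \<open>|\<partial>\<^sub>x\<^sup>-\<^sup>1\<^sup>/\<^sup>2 u|\<^sup>2\<close> over a period.\<close>

definition mass :: "(real \<Rightarrow> complex) \<Rightarrow> real" where
  "mass u = (\<Sum>n. norm (fourier_coeff u (int (Suc n))) ^ 2 / real (Suc n))"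

definition minimizer :: "real \<Rightarrow> real \<Rightarrow> real \<Rightarrow> (real \<Rightarrow> complex) \<Rightarrow> bool" where
  "minimizer \<sigma> M P \<Phi> \<longleftrightarrow>
     is_arg_min (energy \<sigma>) (\<lambda>\<Psi>. admissible \<Psi> \<and> mass \<Psi> = M \<and> momentum \<Psi> = P) \<Phi>"

definition cubic_kernel :: "(real \<Rightarrow> complex) \<Rightarrow> real \<Rightarrow> real \<Rightarrow> complex" where
  "cubic_kernel u x y = of_real (norm (u x - u y) ^ 2 / (1 - cos (x - y))) * (u x - u y)"

text \<open>The expression inside \<open>P\<^sub>+\<close> in the cubic term. For \<open>u\<close> only in \<open>W14_4\<close> the integral need not
  converge.\<close>

definition cubic_bracket :: "real \<Rightarrow> (real \<Rightarrow> complex) \<Rightarrow> real \<Rightarrow> complex" where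
  "cubic_bracket \<sigma> u x =
     (LINT y:period|lborel. cubic_kernel u x y) / of_real (4*pi)
     - of_real (\<sigma> * norm (u x) ^ 2) * u x"

text \<open>The weak cubic term: the \<open>L\<^sup>2\<close> pairing of \<open>C\<^sub>\<sigma>[u]\<close> with a smooth \<open>\<phi>\<close>. The
  projector is moved to \<open>\<phi>\<close> and the double integral is symmetrized in \<open>x\<close> and \<open>y\<close>, which makes it
  absolutely convergent on \<open>W14_4\<close> by Hoelder's inequality. The lemma \<open>cubic_pairing_eq\<close> below shows
  that it is the pairing with the bracket whenever that double integral converges absolutely.\<close>

definition cubic_pairing :: "real \<Rightarrow> (real \<Rightarrow> complex) \<Rightarrow> (real \<Rightarrow> complex) \<Rightarrow> complex" where
  "cubic_pairing \<sigma> u \<phi> =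
     (LINT (x, y):period \<times> period|lborel.
        cubic_kernel u x y * cnj (P_plus \<phi> x - P_plus \<phi> y)) / of_real (8*pi)
     - (LINT x:period|lborel. of_real (\<sigma> * norm (u x) ^ 2) * u x * cnj (P_plus \<phi> x))"

text \<open>The real numbers \<open>l\<close> and \<open>\<mu>\<close> are Lagrange multipliers at \<open>\<Phi>\<close> for the constraints on mass and
  momentum. The increment \<open>h\<close> may be replaced by \<open>ih\<close>, so real and imaginary variations are covered.\<close>

definition lagrange_multipliers ::
  "real \<Rightarrow> (real \<Rightarrow> complex) \<Rightarrow> real \<Rightarrow> real \<Rightarrow> bool" where
  "lagrange_multipliers \<sigma> \<Phi> l \<mu> \<longleftrightarrow>
     (\<forall>h. smooth_periodic h \<and> positive_spectrum h \<longrightarrow>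
        ((\<lambda>\<epsilon>::real. let v = (\<lambda>x. \<Phi> x + of_real \<epsilon> * h x)
                    in energy \<sigma> v - l * mass v - \<mu> * momentum v)
           has_real_derivative 0) (at 0))"

text \<open>Weak form of \<open>(4/\<pi>) C\<^sub>\<sigma>[\<Phi>] = l \<Lambda>\<^sup>-\<^sup>1 \<Phi> + \<mu> \<Phi>\<close>.\<close>

definition euler_lagrange ::
  "real \<Rightarrow> (real \<Rightarrow> complex) \<Rightarrow> complex \<Rightarrow> complex \<Rightarrow> bool" where
  "euler_lagrange \<sigma> \<Phi> l \<mu> \<longleftrightarrow>
     (\<forall>\<phi>. smooth_periodic \<phi> \<longrightarrow>
        of_real (4 / pi) * cubic_pairing \<sigma> \<Phi> \<phi> =
        (LINT x:period|lborel. (l * Lambda_inv \<Phi> x + \<mu> * \<Phi> x) * cnj (\<phi> x)))"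

text \<open>Weak form of \<open>- c \<Phi> + \<omega> \<Lambda>\<^sup>-\<^sup>1 \<Phi> = C\<^sub>\<sigma>[\<Phi>]\<close>.\<close>

definition profile_equation ::
  "real \<Rightarrow> (real \<Rightarrow> complex) \<Rightarrow> complex \<Rightarrow> complex \<Rightarrow> bool" where
  "profile_equation \<sigma> \<Phi> c \<omega> \<longleftrightarrow>
     (\<forall>\<phi>. smooth_periodic \<phi> \<longrightarrow>
        (LINT x:period|lborel. (- c * \<Phi> x + \<omega> * Lambda_inv \<Phi> x) * cnj (\<phi> x)) =
        cubic_pairing \<sigma> \<Phi> \<phi>)"

text \<open>Weak solutions, global in time, of \<open>\<partial>\<^sub>t u = \<partial>\<^sub>x C\<^sub>\<sigma>[u]\<close>, where \<open>\<partial>\<^sub>x\<close> has symbol \<open>i\<kappa>k\<close>: the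
  ordinary derivative for \<open>\<kappa> = 1\<close>, the normalization used for \<open>mass\<close> and \<open>Lambda_inv\<close> for
  \<open>\<kappa> = 2\<pi>\<close>. The equation is paired with a smooth function of \<open>x\<close>, onto which \<open>\<partial>\<^sub>x\<close> is moved with a
  change of sign.\<close>

definition filamentation_solution ::
  "real \<Rightarrow> real \<Rightarrow> (real \<Rightarrow> real \<Rightarrow> complex) \<Rightarrow> bool" where
  "filamentation_solution \<kappa> \<sigma> u \<longleftrightarrow>
     (\<forall>t. admissible (u t)) \<and>
     (\<forall>\<phi> t. smooth_periodic \<phi> \<longrightarrow>
        ((\<lambda>s. LINT x:period|lborel. u s x * cnj (\<phi> x)) has_vector_derivative
           - of_real \<kappa> * cubic_pairing \<sigma> (u t) (\<lambda>x. vector_derivative \<phi> (at x))) (at t))"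

definition travelling_wave ::
  "(real \<Rightarrow> complex) \<Rightarrow> real \<Rightarrow> real \<Rightarrow> real \<Rightarrow> real \<Rightarrow> complex" where
  "travelling_wave \<Phi> V W t x = \<Phi> (x - V * t) * cis (W * t)"

text \<open>For the travelling wave with speed \<open>V\<close> and frequency \<open>W\<close>, the equation becomes
  \<open>- V \<Phi>' + i W \<Phi> = \<partial>\<^sub>x C\<^sub>\<sigma>[\<Phi>]\<close> with the ordinary derivative \<open>\<Phi>'\<close>. Dividing by the symbol
  \<open>i\<kappa>k\<close> of \<open>\<partial>\<^sub>x\<close>, and using the symbol \<open>1/(2\<pi>k)\<close> of \<open>\<Lambda>\<^sup>-\<^sup>1\<close>, gives the profile equation with
  \<open>c = V/\<kappa>\<close> and \<open>\<omega> = 2\<pi>W/\<kappa>\<close>.\<close>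

definition profile_wave ::
  "real \<Rightarrow> (real \<Rightarrow> complex) \<Rightarrow> real \<Rightarrow> real \<Rightarrow> real \<Rightarrow> real \<Rightarrow> complex" where
  "profile_wave \<kappa> \<Phi> c \<omega> = travelling_wave \<Phi> (\<kappa> * c) (\<kappa> * \<omega> / (2*pi))"

lemma cubic_kernel_swap: "cubic_kernel u y x = - cubic_kernel u x y"
proof -
  have "cos (y - x) = cos (x - y)" by (metis cos_minus minus_diff_eq)
  then show ?thesis
    unfolding cubic_kernel_def norm_minus_commute [of "u y" "u x"]
    by (metis minus_diff_eq mult_minus_right)
qed

lemma cubic_pairing_eq:
  assumes u: "W14_4 u"
    and K: "set_integrable lborel (period \<times> period) (\<lambda>(x, y). cubic_kernel u x y)"
    and [measurable]: "P_plus \<phi> \<in> borel_measurable borel"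
    and B: "\<And>x. norm (P_plus \<phi> x) \<le> B"
  shows "cubic_pairing \<sigma> u \<phi> =
    (LINT x:period|lborel. cubic_bracket \<sigma> u x * cnj (P_plus \<phi> x))"
proof -
  define \<psi> where "\<psi> x = cnj (P_plus \<phi> x)" for x
  have [measurable]: "u \<in> borel_measurable borel" using u by (simp add: W14_4_def)
  have [measurable]: "\<psi> \<in> borel_measurable borel"
  proof -
    have "cnj \<in> borel_measurable borel"
      by (rule borel_measurable_continuous_onI) (intro continuous_intros)
    then have "(\<lambda>x. cnj (P_plus \<phi> x)) \<in> borel_measurable borel"
      by measurable
    then show ?thesis by (simp add: \<psi>_def [abs_def])
  qed
  have \<psi>B: "norm (\<psi> x) \<le> B" for x using B by (simp add: \<psi>_def)
  define F where "F p = indicator (period \<times> period) p *\<^sub>R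
      (cubic_kernel u (fst p) (snd p) * \<psi> (fst p))" for p :: "real \<times> real"
  have pm: "(lborel :: (real \<times> real) measure) = lborel \<Otimes>\<^sub>M lborel"
    by (rule lborel_prod [symmetric])
  have int_K: "integrable lborel (\<lambda>p. indicator (period \<times> period) p *\<^sub>R
      cubic_kernel u (fst p) (snd p))"
    using K by (simp add: set_integrable_def case_prod_beta)
  have mF: "(\<lambda>p::real \<times> real. \<psi> (fst p)) \<in> borel_measurable lborel"
    unfolding pm by measurable
  have F_int: "integrable lborel F"
  proof (rule Bochner_Integration.integrable_bound)
    show "integrable lborel (\<lambda>p. B * norm (indicator (period \<times> period) p *\<^sub>R
        cubic_kernel u (fst p) (snd p)))"
      using int_K by (intro integrable_mult_right integrable_norm)
    have "F = (\<lambda>p. (indicator (period \<times> period) p *\<^sub>R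
        cubic_kernel u (fst p) (snd p)) * \<psi> (fst p))"
      by (auto simp: F_def)
    then show "F \<in> borel_measurable lborel"
      using borel_measurable_times [OF borel_measurable_integrable [OF int_K] mF] by simp
    show "AE p in lborel. norm (F p) \<le> norm (B * norm (indicator (period \<times> period) p *\<^sub>R
        cubic_kernel u (fst p) (snd p)))"
    proof (rule AE_I2)
      fix p :: "real \<times> real"
      have "norm (cubic_kernel u (fst p) (snd p)) * norm (\<psi> (fst p))
          \<le> norm (cubic_kernel u (fst p) (snd p)) * B"
        by (intro mult_left_mono \<psi>B) simp
      moreover have "B \<ge> 0" using order_trans [OF norm_ge_zero \<psi>B] .
      ultimately show "norm (F p) \<le> norm (B * norm (indicator (period \<times> period) p *\<^sub>R
        cubic_kernel u (fst p) (snd p)))"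
        by (auto simp: F_def norm_mult indicator_def mult.commute abs_mult)
    qed
  qed
  have F_int': "integrable (lborel \<Otimes>\<^sub>M lborel) F" using F_int by (simp add: pm)
  have swap_int: "integrable lborel (\<lambda>(x, y). F (y, x))"
    unfolding pm by (rule lborel_pair.integrable_product_swap [OF F_int'])
  have swap: "integral\<^sup>L lborel (\<lambda>(x, y). F (y, x)) = integral\<^sup>L lborel F"
    using lborel_pair.integral_product_swap [of F] F_int' by (simp add: pm)
  have "(LINT (x, y):period \<times> period|lborel. cubic_kernel u x y * cnj (P_plus \<phi> x - P_plus \<phi> y))
      = (LINT p|lborel. F p + (case p of (x, y) \<Rightarrow> F (y, x)))"
    unfolding set_lebesgue_integral_def
  proof (rule Bochner_Integration.integral_cong [OF refl])
    fix p :: "real \<times> real"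
    obtain x y where p: "p = (x, y)" by (cases p)
    show "indicator (period \<times> period) p *\<^sub>R (case p of (x, y) \<Rightarrow> cubic_kernel u x y *
        cnj (P_plus \<phi> x - P_plus \<phi> y)) = F p + (case p of (x, y) \<Rightarrow> F (y, x))"
      using cubic_kernel_swap [of u y x]
      by (auto simp: p F_def \<psi>_def indicator_def algebra_simps)
  qed
  also have "\<dots> = 2 * integral\<^sup>L lborel F"
    by (subst Bochner_Integration.integral_add [OF F_int swap_int]) (simp add: swap)
  also have "integral\<^sup>L lborel F = (LINT x|lborel. LINT y|lborel. F (x, y))"
    using lborel_pair.integral_fst' [OF F_int'] by (simp add: pm)
  finally have dbl0: "(LINT (x, y):period \<times> period|lborel. cubic_kernel u x y *
      cnj (P_plus \<phi> x - P_plus \<phi> y)) = 2 * (LINT x|lborel. LINT y|lborel. F (x, y))" .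
  define J where "J x = (LINT y:period|lborel. cubic_kernel u x y)" for x
  have inner: "(\<lambda>x. LINT y|lborel. F (x, y)) = (\<lambda>x. indicator period x *\<^sub>R (J x * \<psi> x))"
  proof
    fix x
    have "F (x, y) = (indicator period x *\<^sub>R \<psi> x) * (indicator period y *\<^sub>R cubic_kernel u x y)" for y
      by (auto simp: F_def indicator_def)
    then have "(LINT y|lborel. F (x, y)) =
        (indicator period x *\<^sub>R \<psi> x) * (LINT y|lborel. indicator period y *\<^sub>R cubic_kernel u x y)"
      by (simp only: integral_mult_right_zero)
    then show "(LINT y|lborel. F (x, y)) = indicator period x *\<^sub>R (J x * \<psi> x)"
      by (simp add: J_def set_lebesgue_integral_def mult.commute)
  qed
  have J_int: "set_integrable lborel period (\<lambda>x. J x * \<psi> x)"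
    using lborel_pair.integrable_fst' [OF F_int']
    unfolding set_integrable_def inner .
  have "(LINT (x, y):period \<times> period|lborel. cubic_kernel u x y * cnj (P_plus \<phi> x - P_plus \<phi> y))
      = 2 * (LINT x:period|lborel. J x * \<psi> x)"
    using dbl0 unfolding inner set_lebesgue_integral_def .
  then have dbl: "(LINT (x, y):period \<times> period|lborel. cubic_kernel u x y *
      cnj (P_plus \<phi> x - P_plus \<phi> y)) / of_real (8*pi) =
      (LINT x:period|lborel. (J x * \<psi> x) / of_real (4*pi))"
    by simp
  have i1: "set_integrable lborel period (\<lambda>x. (J x * \<psi> x) / of_real (4*pi))"
    using J_int by (intro set_integrable_divide) simp_all
  have fin: "set_integrable lborel period (\<lambda>x. \<bar>\<sigma>\<bar> * B * (1 + norm (u x) ^ 4))"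
    using u by (intro set_integrable_mult_right set_integral_add)
      (auto simp: W14_4_def set_integrable_def)
  have le: "norm (u x) ^ 3 \<le> 1 + norm (u x) ^ 4" for x
  proof (cases "norm (u x) \<le> 1")
    case True
    then have "norm (u x) ^ 3 \<le> 1" by (simp add: power_le_one)
    then show ?thesis by (smt (verit) zero_le_power norm_ge_zero)
  next
    case False
    then have "norm (u x) ^ 3 \<le> norm (u x) ^ 4" by (intro power_increasing) auto
    then show ?thesis by simp
  qed
  have i2: "set_integrable lborel period (\<lambda>x. of_real (\<sigma> * norm (u x) ^ 2) * u x * \<psi> x)"
  proof (rule set_integrable_bound [OF fin])
    show "set_borel_measurable lborel period (\<lambda>x. of_real (\<sigma> * norm (u x) ^ 2) * u x * \<psi> x)"
      unfolding set_borel_measurable_def by measurable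
    show "AE x in lborel. x \<in> period \<longrightarrow>
        norm (of_real (\<sigma> * norm (u x) ^ 2) * u x * \<psi> x) \<le> norm (\<bar>\<sigma>\<bar> * B * (1 + norm (u x) ^ 4))"
    proof (rule AE_I2, rule impI)
      fix x
      have B0: "B \<ge> 0" using order_trans [OF norm_ge_zero \<psi>B] .
      have "norm (of_real (\<sigma> * norm (u x) ^ 2) * u x * \<psi> x) = \<bar>\<sigma>\<bar> * (norm (\<psi> x) * norm (u x) ^ 3)"
        by (simp add: norm_mult power_abs abs_mult power3_eq_cube power2_eq_square norm_power)
      also have "\<dots> \<le> \<bar>\<sigma>\<bar> * (B * (1 + norm (u x) ^ 4))"
        by (intro mult_left_mono mult_mono \<psi>B le B0) auto
      also have "\<dots> = norm (\<bar>\<sigma>\<bar> * B * (1 + norm (u x) ^ 4))"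
        using B0 by (simp add: abs_mult)
      finally show "norm (of_real (\<sigma> * norm (u x) ^ 2) * u x * \<psi> x) \<le> norm (\<bar>\<sigma>\<bar> * B * (1 + norm (u x) ^ 4))" .
    qed
  qed
  show ?thesis
    unfolding cubic_pairing_def dbl cubic_bracket_def J_def [symmetric]
    using set_integral_diff(2) [OF i1 i2] by (simp add: \<psi>_def left_diff_distrib)
qed

lemma set_integral_finite_sum:
  fixes f :: "'i \<Rightarrow> real \<Rightarrow> complex"
  assumes "\<And>i. i \<in> I \<Longrightarrow> set_integrable M A (f i)"
  shows "set_integrable M A (\<lambda>x. \<Sum>i\<in>I. f i x)"
    and "(LINT x:A|M. \<Sum>i\<in>I. f i x) = (\<Sum>i\<in>I. LINT x:A|M. f i x)"
  using assms
  by (auto simp: set_integrable_def set_lebesgue_integral_def scaleR_sum_right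
      intro!: Bochner_Integration.integrable_sum Bochner_Integration.integral_sum)

lemma integral_cis_period:
  "(LINT x:period|lborel. cis (of_int k * x)) = (if k = 0 then of_real (2*pi) else 0)"
proof (cases "k = 0")
  case True
  then show ?thesis
    by (simp add: set_lebesgue_integral_def cis_zero scaleR_conv_of_real)
next
  case False
  have "(LINT x:period|lborel. cis (of_int k * x)) =
      cis (of_int k * (2*pi)) / (\<i> * of_int k) - cis (of_int k * 0) / (\<i> * of_int k)"
    unfolding set_lebesgue_integral_def
  proof (rule integral_FTC_Icc)
    fix x :: real
    have "((\<lambda>z. exp (\<i> * of_int k * z) / (\<i> * of_int k)) has_field_derivative exp (\<i> * of_int k * of_real x))
        (at (of_real x))"
      using False by (auto intro!: derivative_eq_intros)
    from has_vector_derivative_real_field [OF this]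
    show "((\<lambda>x. cis (of_int k * x) / (\<i> * of_int k)) has_vector_derivative cis (of_int k * x))
        (at x within period)"
      by (simp add: cis_conv_exp mult.assoc)
  qed (auto intro!: continuous_intros)
  also have "cis (of_int k * (2*pi)) = 1"
    by (metis Ints_of_int cis_multiple_2pi mult.commute)
  finally show ?thesis using False by simp
qed

text \<open>Every frequency is at least \<open>1\<close>, so the constraints on mass and momentum are compatible only
  if \<open>2\<pi> M \<le> P\<close>.\<close>

lemma mass_le_momentum:
  assumes u: "W14_4 u"
  shows "2*pi * mass u \<le> momentum u"
proof -
  have [measurable]: "u \<in> borel_measurable borel" using u by (simp add: W14_4_def)
  have [measurable]: "(\<lambda>x. cis (- (r * x))) \<in> borel_measurable borel" for r :: real
    by (intro borel_measurable_continuous_onI continuous_intros)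
  have fin: "set_integrable lborel period (\<lambda>x. 1 + norm (u x) ^ 4)"
    using u by (intro set_integral_add) (auto simp: W14_4_def set_integrable_def)
  have le4: "norm (u x) ^ 2 \<le> 1 + norm (u x) ^ 4" "norm (u x) \<le> 1 + norm (u x) ^ 4" for x
  proof -
    let ?r = "norm (u x)"
    have *: "0 \<le> (?r^2 - 1/2)^2" "0 \<le> (?r - 1/2)^2" by auto
    show "?r ^ 2 \<le> 1 + ?r ^ 4"
      using *(1) by (simp add: power2_eq_square power4_eq_xxxx algebra_simps)
    then show "?r \<le> 1 + ?r ^ 4"
    proof (cases "?r \<le> 1")
      case True then show ?thesis by (smt (verit) zero_le_power norm_ge_zero)
    next
      case False
      then have "?r ^ 1 \<le> ?r ^ 4" by (intro power_increasing) auto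
      then show ?thesis by simp
    qed
  qed
  have i_u2: "set_integrable lborel period (\<lambda>x. norm (u x) ^ 2)"
    by (rule set_integrable_bound [OF fin])
      (auto simp: set_borel_measurable_def intro!: AE_I2 order_trans [OF le4(1)])
  have i_u: "set_integrable lborel period (\<lambda>x. u x * cis (- (r * x)))" for r
    by (rule set_integrable_bound [OF fin])
      (auto simp: set_borel_measurable_def norm_mult intro!: AE_I2 order_trans [OF le4(2)])
  have i_c: "set_integrable lborel period (\<lambda>x. cis (r * x))" for r
    by (intro borel_integrable_atLeastAtMost' continuous_intros)
  have i_Re: "set_integrable lborel period (\<lambda>x. Re (f x))"
    and I_Re: "(LINT x:period|lborel. Re (f x)) = Re (LINT x:period|lborel. f x)"
    if "set_integrable lborel period f" for f
    using integrable_Re [OF that [unfolded set_integrable_def]]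
      integral_Re [OF that [unfolded set_integrable_def]]
    by (simp_all add: set_integrable_def set_lebesgue_integral_def)
  define a where "a n = fourier_coeff u (int (Suc n))" for n
  have a: "(LINT x:period|lborel. u x * cis (- (real (Suc n) * x))) = of_real (2*pi) * a n" for n
    unfolding a_def fourier_coeff_def of_int_of_nat_eq by simp
  have bessel: "2*pi * (\<Sum>n<N. norm (a n) ^ 2) \<le> momentum u" for N
  proof -
    define S where "S = (\<Sum>n<N. norm (a n) ^ 2)"
    define s where "s x = (\<Sum>n<N. a n * cis (real (Suc n) * x))" for x
    have sq: "cnj (a n) * a n = of_real (norm (a n)) ^ 2" "a n * cnj (a n) = of_real (norm (a n)) ^ 2" for n
      using complex_norm_square [of "a n"] by (simp_all add: mult.commute)
    have us_eq: "u x * cnj (s x) = (\<Sum>n<N. cnj (a n) * (u x * cis (- (real (Suc n) * x))))" for x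
      by (simp add: s_def sum_distrib_left cis_cnj mult_ac)
    have ss_eq: "s x * cnj (s x) = (\<Sum>n<N. \<Sum>m<N. (a n * cnj (a m)) * cis (of_int (int n - int m) * x))" for x
    proof -
      have "(a n * cis (real (Suc n) * x)) * (cnj (a m) * cis (- (real (Suc m) * x))) =
          (a n * cnj (a m)) * cis (of_int (int n - int m) * x)" for n m
      proof -
        have "cis (real (Suc n) * x) * cis (- (real (Suc m) * x)) = cis (of_int (int n - int m) * x)"
          unfolding cis_mult by (rule arg_cong [where f = cis]) (simp add: algebra_simps)
        then show ?thesis by (metis mult.assoc mult.left_commute)
      qed
      then show ?thesis
        by (simp only: s_def cnj_sum complex_cnj_mult cis_cnj sum_product)
    qed
    have i_us: "set_integrable lborel period (\<lambda>x. u x * cnj (s x))"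
      unfolding us_eq by (intro set_integral_finite_sum(1) set_integrable_mult_right i_u)
    have i_ss: "set_integrable lborel period (\<lambda>x. s x * cnj (s x))"
      unfolding ss_eq by (intro set_integral_finite_sum(1) set_integrable_mult_right i_c)
    have I_us: "(LINT x:period|lborel. u x * cnj (s x)) = of_real (2*pi * S)"
      unfolding us_eq
      by (subst set_integral_finite_sum(2), intro set_integrable_mult_right i_u)
        (simp only: set_integral_mult_right a, simp add: S_def sq mult.left_commute [of "cnj _"] sum_distrib_left)
    have I_ss: "(LINT x:period|lborel. s x * cnj (s x)) = of_real (2*pi * S)"
    proof -
      have "(LINT x:period|lborel. s x * cnj (s x)) =
          (\<Sum>n<N. \<Sum>m<N. (a n * cnj (a m)) * (if n = m then of_real (2*pi) else 0))"
        unfolding ss_eq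
        by (subst set_integral_finite_sum(2),
            intro set_integral_finite_sum(1) set_integrable_mult_right i_c,
            intro sum.cong refl, subst set_integral_finite_sum(2),
            intro set_integrable_mult_right i_c)
          (simp only: set_integral_mult_right integral_cis_period right_minus_eq of_nat_eq_iff)
      also have "\<dots> = of_real (2*pi * S)"
        by (simp add: S_def sq sum_distrib_left sum_distrib_right mult.commute if_distrib cong: if_cong)
      finally show ?thesis .
    qed
    have pt: "norm (u x - s x) ^ 2 = norm (u x) ^ 2 - 2 * Re (u x * cnj (s x)) + Re (s x * cnj (s x))" for x
      unfolding cmod_power2 by (simp add: power2_eq_square algebra_simps)
    have "0 \<le> (LINT x:period|lborel. norm (u x - s x) ^ 2)"
      unfolding set_lebesgue_integral_def by (intro integral_nonneg_AE) auto
    also have "\<dots> = momentum u - 2 * (LINT x:period|lborel. Re (u x * cnj (s x)))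
        + (LINT x:period|lborel. Re (s x * cnj (s x)))"
      unfolding pt momentum_def
      by (subst set_integral_add(2) set_integral_diff(2),
          intro set_integral_diff(1) set_integrable_mult_right i_u2 i_Re i_us i_ss,
          (intro set_integrable_mult_right i_u2 i_Re i_us i_ss)?)+
        (simp only: set_integral_mult_right)
    also have "\<dots> = momentum u - 2 * (2*pi * S) + 2*pi * S"
      unfolding I_Re [OF i_us] I_Re [OF i_ss] I_us I_ss by simp
    finally show ?thesis by (simp add: S_def)
  qed
  have summ: "summable (\<lambda>n. norm (a n) ^ 2)"
  proof (rule summableI_nonneg_bounded)
    show "(\<Sum>n<N. norm (a n) ^ 2) \<le> momentum u / (2*pi)" for N
      using bessel [of N] by (simp add: field_simps)
  qed simp
  have "mass u \<le> (\<Sum>n. norm (a n) ^ 2)"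
    unfolding mass_def a_def [symmetric]
  proof (rule suminf_le)
    show *: "norm (a n) ^ 2 / real (Suc n) \<le> norm (a n) ^ 2" for n
      by (simp add: divide_le_eq mult_le_cancel_left1)
    show "summable (\<lambda>n. norm (a n) ^ 2 / real (Suc n))"
      by (rule summable_comparison_test' [OF summ]) (use * in auto)
  qed (rule summ)
  also have "\<dots> \<le> momentum u / (2*pi)"
    by (rule suminf_le_const [OF summ]) (use bessel in \<open>simp add: field_simps\<close>)
  finally show ?thesis by (simp add: field_simps)
qed

end

theory Submission
  imports Defs "HOL-Complex_Analysis.Great_Picard"
begin

text \<open>
  The minimum is attained by the direct method. A Poincare inequality on a partition of the circle into
  \<open>N\<close> cells, lemma \<open>poincare\<close>, bounds the integral of \<open>|u|\<^sup>4\<close> by the Gagliardo integral times the length of a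
  cell, up to a constant and up to finitely many cell integrals. It makes the energy coercive on the constraint set
  (\<open>energy_coercive\<close>), and it yields compactness: once a diagonal subsequence of a minimizing sequence has
  convergent cell integrals, the sequence is Cauchy in \<open>L\<^sup>4\<close> and a further subsequence converges almost
  everywhere (\<open>W14_4_compact\<close>). The constraints and the quartic term are continuous in \<open>L\<^sup>4\<close>, and the
  Gagliardo integral is lower semicontinuous by Fatou's lemma. The constraints can be met because two
  modes suffice (\<open>constraints_feasible\<close>).

  The energy is a quartic polynomial in \<open>\<Phi>\<close>. Its expansion at \<open>\<Phi>\<close> in the direction of a Lipschitz function
  on the circle has a linear term, the real part of \<open>form\<close>, and a remainder quadratic in the Lipschitz
  constant (\<open>energy_expansion\<close>). As \<open>form\<close> is conjugate linear in the test function, and as the projector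
  acts as the identity on smooth functions with positive spectrum, the vanishing of the real first
  variation is the weak Euler-Lagrange equation (\<open>lagrange_iff_euler\<close>).

  A minimizer has multipliers for one of two reasons (\<open>minimizer_multipliers\<close>). If two of its Fourier
  coefficients are nonzero, a direction tangent to both constraints is corrected to an exactly admissible
  curve by rescaling these two coefficients; the correction is explicit and of second order, so the
  first variation vanishes on tangent directions, and it is a combination of the gradients of mass and
  momentum on the others. If only one coefficient is nonzero, the two gradients are proportional, but
  then \<open>\<Phi>\<close> is a pure mode, whose cubic term is a real multiple of itself by translation invariance.

  The passage from the profile to the wave uses the invariance of the cubic form under translations and
  phase rotations to move the motion onto the test function. The equation at time \<open>t\<close> is then the profile
  equation tested against a derivative, and derivatives exhaust the test functions with positive
  spectrum (\<open>P_plus_antiderivative\<close>).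

  The Fourier analysis rests on Bessel's inequality. It gives pointwise inversion for Lipschitz functions
  by a telescoping argument (\<open>fourier_inversion\<close>), and inversion applied to correlations gives
  completeness (\<open>pairing_chord_lip_zero\<close>, \<open>fourier_complete\<close>).
\<close>


section \<open>The circle as a finite measure space\<close>

text \<open>A density rather than a restriction: the measure lives on the whole line, so Borel functions are
  measurable for it and for its square as they stand.\<close>

definition circ :: "real measure" where
  "circ = density lborel (\<lambda>x. ennreal (indicator period x))"

abbreviation circ2 :: "(real \<times> real) measure" where
  "circ2 \<equiv> circ \<Otimes>\<^sub>M circ"

lemma sets_circ [simp, measurable_cong]: "sets circ = sets borel"
  by (simp add: circ_def)

lemma space_circ [simp]: "space circ = UNIV"
  by (simp add: circ_def)

lemma emeasure_circ: "emeasure circ UNIV = ennreal (2*pi)"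
proof -
  have "emeasure circ UNIV = (\<integral>\<^sup>+ x. indicator period x \<partial>lborel)"
    unfolding circ_def by (subst emeasure_density) (auto simp: ennreal_indicator)
  also have "\<dots> = emeasure lborel period" by (rule nn_integral_indicator) simp
  finally show ?thesis by simp
qed

interpretation circ: finite_measure circ
  by standard (simp add: emeasure_circ)

interpretation circ2: pair_sigma_finite circ circ ..

lemma measure_circ [simp]: "measure circ UNIV = 2*pi"
  by (simp add: measure_def emeasure_circ)

interpretation circ2: finite_measure circ2
proof
  have "emeasure circ2 (UNIV \<times> UNIV) = emeasure circ UNIV * emeasure circ UNIV"
    by (subst circ.emeasure_pair_measure_Times) auto
  then show "emeasure circ2 (space circ2) \<noteq> \<infinity>"
    by (simp add: space_pair_measure emeasure_circ ennreal_mult_eq_top_iff)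
qed

lemma circ2_density:
  "circ2 = density lborel (\<lambda>p. ennreal (indicator (period \<times> period) p))"
proof -
  have "circ2 = density (lborel \<Otimes>\<^sub>M lborel)
      (\<lambda>(x, y). ennreal (indicator period x) * ennreal (indicator period y))"
    unfolding circ_def
    by (rule pair_measure_density)
      (auto simp: circ_def [symmetric] circ.sigma_finite_measure_axioms intro: sigma_finite_lborel)
  also have "(\<lambda>(x, y). ennreal (indicator period x) * ennreal (indicator period y)) =
      (\<lambda>p::real\<times>real. ennreal (indicator (period \<times> period) p))"
    by (auto simp: fun_eq_iff indicator_def)
  finally show ?thesis by (simp add: lborel_prod)
qed

lemma set_integrable_circ:
  fixes f :: "real \<Rightarrow> 'b::{banach, second_countable_topology}"
  assumes "f \<in> borel_measurable borel"
  shows "set_integrable lborel period f \<longleftrightarrow> integrable circ f"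
  unfolding circ_def set_integrable_def
  by (subst integrable_density) (use assms in auto)

lemma LINT_circ:
  fixes f :: "real \<Rightarrow> 'b::{banach, second_countable_topology}"
  assumes "f \<in> borel_measurable borel"
  shows "(LINT x:period|lborel. f x) = integral\<^sup>L circ f"
  unfolding circ_def set_lebesgue_integral_def
  by (subst integral_density) (use assms in auto)

lemma set_integrable_circ2:
  fixes f :: "real \<times> real \<Rightarrow> 'b::{banach, second_countable_topology}"
  assumes "f \<in> borel_measurable (borel \<Otimes>\<^sub>M borel)"
  shows "set_integrable lborel (period \<times> period) f \<longleftrightarrow> integrable circ2 f"
  unfolding circ2_density set_integrable_def
  by (subst integrable_density)
    (use assms in \<open>auto simp: borel_prod intro!: borel_measurable_indicator borel_closed closed_Times\<close>)

lemma LINT_circ2: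
  fixes f :: "real \<times> real \<Rightarrow> 'b::{banach, second_countable_topology}"
  assumes "f \<in> borel_measurable (borel \<Otimes>\<^sub>M borel)"
  shows "(LINT p:period \<times> period|lborel. f p) = integral\<^sup>L circ2 f"
  unfolding circ2_density set_lebesgue_integral_def
  by (subst integral_density)
    (use assms in \<open>auto simp: borel_prod intro!: borel_measurable_indicator borel_closed closed_Times\<close>)

lemma AE_circ2:
  assumes [measurable]: "Measurable.pred (borel \<Otimes>\<^sub>M borel) (\<lambda>p. P (fst p) (snd p))"
    and "AE x in circ. AE y in circ. P x y"
  shows "AE p in circ2. P (fst p) (snd p)"
proof (rule circ2.AE_pair_measure)
  have "Measurable.pred circ2 (\<lambda>p. P (fst p) (snd p))" by measurable
  then show "{p \<in> space circ2. P (fst p) (snd p)} \<in> sets circ2" by (simp add: pred_def)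
qed (use assms(2) in auto)

lemma integrable_circ_bounded:
  fixes f :: "real \<Rightarrow> 'b::{banach, second_countable_topology}"
  assumes "f \<in> borel_measurable borel" "\<And>x. norm (f x) \<le> B"
  shows "integrable circ f"
  by (rule circ.integrable_const_bound [of _ B])
    (use assms measurable_cong_sets [OF sets_circ refl] in auto)

subsection \<open>Translation\<close>

lemma periodic_add_int:
  assumes "periodic_2pi f"
  shows "f (x + 2*pi * of_int k) = f x"
proof -
  have nat: "f (x + 2*pi * real n) = f x" for x n
  proof (induction n)
    case (Suc n)
    have "f (x + 2*pi * real (Suc n)) = f ((x + 2*pi * real n) + 2*pi)"
      by (simp add: algebra_simps)
    then show ?case using assms Suc by (simp add: periodic_2pi_def)
  qed simp
  show ?thesis
  proof (cases k)
    case (nonneg n) then show ?thesis using nat by simp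
  next
    case (neg n)
    have "f (x + 2*pi * of_int k) = f (x + 2*pi * of_int k + 2*pi * real (Suc n))"
      by (rule nat [symmetric])
    also have "x + 2*pi * of_int k + 2*pi * real (Suc n) = x"
      by (simp add: neg algebra_simps)
    finally show ?thesis .
  qed
qed

definition angle_mod :: "real \<Rightarrow> real" where
  "angle_mod x = x - 2*pi * of_int \<lfloor>x / (2*pi)\<rfloor>"

lemma angle_mod_measurable [measurable]: "angle_mod \<in> borel_measurable borel"
  unfolding angle_mod_def [abs_def] by measurable

lemma angle_mod_range: "0 \<le> angle_mod x" "angle_mod x < 2*pi"
proof -
  have 1: "of_int \<lfloor>x / (2*pi)\<rfloor> \<le> x / (2*pi)" and 2: "x / (2*pi) < of_int \<lfloor>x / (2*pi)\<rfloor> + 1"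
    by linarith+
  have "2*pi * of_int \<lfloor>x / (2*pi)\<rfloor> \<le> 2*pi * (x / (2*pi))"
    "2*pi * (x / (2*pi)) < 2*pi * (of_int \<lfloor>x / (2*pi)\<rfloor> + 1)"
    by (intro mult_left_mono 1, simp, intro mult_strict_left_mono 2, simp)
  then show "0 \<le> angle_mod x" "angle_mod x < 2*pi"
    unfolding angle_mod_def by (simp_all add: distrib_left)
qed

lemma periodic_angle_mod:
  assumes "periodic_2pi f"
  shows "f (angle_mod x) = f x"
  using periodic_add_int [OF assms, of x "- \<lfloor>x / (2*pi)\<rfloor>"] by (simp add: angle_mod_def)

lemma angle_mod_eq: "x \<in> {0..<2*pi} \<Longrightarrow> angle_mod x = x"
proof -
  assume "x \<in> {0..<2*pi}"
  then have "\<lfloor>x / (2*pi)\<rfloor> = 0" by (intro floor_unique) (auto simp: field_simps)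
  then show ?thesis by (simp add: angle_mod_def)
qed

lemma periodic_2pi_angle_mod: "periodic_2pi angle_mod"
proof -
  have "(x + 2*pi) / (2*pi) = x / (2*pi) + 1" for x by (simp add: field_simps)
  then show ?thesis by (simp add: periodic_2pi_def angle_mod_def algebra_simps)
qed

lemma nn_integral_circ:
  assumes [measurable]: "f \<in> borel_measurable borel"
  shows "(\<integral>\<^sup>+ x. f x \<partial>circ) = (\<integral>\<^sup>+ x. f x * indicator period x \<partial>lborel)"
  unfolding circ_def by (subst nn_integral_density) (auto simp: mult.commute ennreal_indicator)

text \<open>The translated period is cut at \<open>2\<pi>\<close> and the protruding piece moved back by one period.\<close>

lemma nn_integral_circ_shift:
  fixes f :: "real \<Rightarrow> ennreal"
  assumes [measurable]: "f \<in> borel_measurable borel" and per: "periodic_2pi f"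
  shows "(\<integral>\<^sup>+ x. f (x + a) \<partial>circ) = (\<integral>\<^sup>+ x. f x \<partial>circ)"
proof -
  have pos: "(\<integral>\<^sup>+ x. f (x + a) \<partial>circ) = (\<integral>\<^sup>+ x. f x \<partial>circ)" if a: "0 \<le> a" "a < 2*pi" for a
  proof -
    have "(\<integral>\<^sup>+ x. f (x + a) \<partial>circ) = (\<integral>\<^sup>+ x. f (x + a) * indicator period x \<partial>lborel)"
      by (rule nn_integral_circ) measurable
    also have "\<dots> = (\<integral>\<^sup>+ x. f x * indicator {a..a + 2*pi} x \<partial>lborel)"
      by (subst (2) nn_integral_real_affine [where c = 1 and t = a])
        (auto intro!: nn_integral_cong simp: indicator_def add.commute)
    also have "\<dots> = (\<integral>\<^sup>+ x. f x * indicator {a..2*pi} x + f x * indicator {2*pi..a + 2*pi} x \<partial>lborel)"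
    proof (rule nn_integral_cong_AE)
      have "AE x in lborel. x \<noteq> 2*pi" by (rule AE_lborel_singleton)
      then show "AE x in lborel. f x * indicator {a..a + 2*pi} x =
          f x * indicator {a..2*pi} x + f x * indicator {2*pi..a + 2*pi} x"
        by eventually_elim (use a in \<open>auto simp: indicator_def\<close>)
    qed
    also have "\<dots> = (\<integral>\<^sup>+ x. f x * indicator {a..2*pi} x \<partial>lborel)
        + (\<integral>\<^sup>+ x. f x * indicator {2*pi..a + 2*pi} x \<partial>lborel)"
      by (rule nn_integral_add) auto
    also have "(\<integral>\<^sup>+ x. f x * indicator {2*pi..a + 2*pi} x \<partial>lborel) =
        (\<integral>\<^sup>+ x. f x * indicator {0..a} x \<partial>lborel)"
      using per by (subst nn_integral_real_affine [where c = 1 and t = "2*pi"])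
        (auto intro!: nn_integral_cong simp: indicator_def periodic_2pi_def add.commute)
    also have "(\<integral>\<^sup>+ x. f x * indicator {a..2*pi} x \<partial>lborel) + \<dots> =
        (\<integral>\<^sup>+ x. f x * indicator {a..2*pi} x + f x * indicator {0..a} x \<partial>lborel)"
      by (rule nn_integral_add [symmetric]) auto
    also have "\<dots> = (\<integral>\<^sup>+ x. f x * indicator period x \<partial>lborel)"
    proof (rule nn_integral_cong_AE)
      have "AE x in lborel. x \<noteq> a" by (rule AE_lborel_singleton)
      then show "AE x in lborel. f x * indicator {a..2*pi} x + f x * indicator {0..a} x =
          f x * indicator period x"
        by eventually_elim (use a in \<open>auto simp: indicator_def\<close>)
    qed
    finally show ?thesis by (simp add: nn_integral_circ)
  qed
  have "f (x + a) = f (x + angle_mod a)" for x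
    using periodic_add_int [OF per, of "x + a" "- \<lfloor>a / (2*pi)\<rfloor>"]
    by (simp add: angle_mod_def algebra_simps)
  then show ?thesis using pos [OF angle_mod_range] by simp
qed

definition rotate :: "real \<Rightarrow> real \<Rightarrow> real" where
  "rotate a x = angle_mod (x + a)"

lemma rotate_measurable [measurable]: "rotate a \<in> borel_measurable borel"
  unfolding rotate_def [abs_def] by measurable

text \<open>Invariance of the measure, rather than of integrals, passes to the product measure and to the
  question of integrability.\<close>

lemma distr_rotate: "distr circ circ (rotate a) = circ"
proof (rule measure_eqI)
  fix A assume "A \<in> sets (distr circ circ (rotate a))"
  then have [measurable]: "A \<in> sets borel" by simp
  have [measurable]: "rotate a \<in> measurable circ circ" by measurable
  have "emeasure (distr circ circ (rotate a)) A = (\<integral>\<^sup>+ x. indicator A (rotate a x) \<partial>circ)"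
    by (subst nn_integral_indicator [symmetric], simp, subst nn_integral_distr) auto
  also have "\<dots> = (\<integral>\<^sup>+ x. indicator A (angle_mod x) \<partial>circ)"
    unfolding rotate_def
    by (rule nn_integral_circ_shift [where f = "\<lambda>x. indicator A (angle_mod x)"])
      (use periodic_2pi_angle_mod in \<open>auto simp: periodic_2pi_def\<close>)
  also have "\<dots> = (\<integral>\<^sup>+ x. indicator A (angle_mod x) * indicator period x \<partial>lborel)"
    by (rule nn_integral_circ) measurable
  also have "\<dots> = (\<integral>\<^sup>+ x. indicator A x * indicator period x \<partial>lborel)"
  proof (rule nn_integral_cong_AE)
    have "AE x in lborel. x \<noteq> 2*pi" by (rule AE_lborel_singleton)
    then show "AE x in lborel. indicator A (angle_mod x) * indicator period x =
        (indicator A x * indicator period x :: ennreal)"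
      by eventually_elim (auto simp: indicator_def angle_mod_eq)
  qed
  also have "\<dots> = emeasure circ A"
    by (subst nn_integral_circ [symmetric]) auto
  finally show "emeasure (distr circ circ (rotate a)) A = emeasure circ A" .
qed simp

lemma integral_circ_shift:
  fixes f :: "real \<Rightarrow> 'b::{banach, second_countable_topology}"
  assumes [measurable]: "f \<in> borel_measurable borel" and per: "periodic_2pi f"
  shows "integrable circ (\<lambda>x. f (x + a)) \<longleftrightarrow> integrable circ f"
    and "(\<integral>x. f (x + a) \<partial>circ) = integral\<^sup>L circ f"
proof -
  have [measurable]: "rotate a \<in> measurable circ circ" "f \<in> borel_measurable circ" by measurable
  have eq: "f (rotate a x) = f (x + a)" for x
    unfolding rotate_def by (rule periodic_angle_mod [OF per])
  show "integrable circ (\<lambda>x. f (x + a)) \<longleftrightarrow> integrable circ f"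
    using integrable_distr_eq [of "rotate a" circ circ f] by (simp add: distr_rotate eq)
  show "(\<integral>x. f (x + a) \<partial>circ) = integral\<^sup>L circ f"
    using integral_distr [of "rotate a" circ circ f] by (simp add: distr_rotate eq)
qed

lemma integral_circ2_shift:
  fixes f :: "real \<Rightarrow> real \<Rightarrow> 'b::{banach, second_countable_topology}"
  assumes [measurable]: "(\<lambda>(x, y). f x y) \<in> borel_measurable (borel \<Otimes>\<^sub>M borel)"
    and per: "\<And>y. periodic_2pi (\<lambda>x. f x y)" "\<And>x. periodic_2pi (f x)"
  shows "integrable circ2 (\<lambda>(x, y). f (x + a) (y + a)) \<longleftrightarrow> integrable circ2 (\<lambda>(x, y). f x y)"
    and "(\<integral>(x, y). f (x + a) (y + a) \<partial>circ2) = (\<integral>(x, y). f x y \<partial>circ2)"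
proof -
  let ?T = "\<lambda>(x, y). (rotate a x, rotate a y)"
  have [measurable]: "rotate a \<in> measurable circ circ" by measurable
  have distr: "distr circ2 circ2 ?T = circ2"
    using pair_measure_distr [of "rotate a" circ circ "rotate a" circ circ]
    by (simp add: distr_rotate circ.sigma_finite_measure_axioms)
  have [measurable]: "?T \<in> measurable circ2 circ2" "(\<lambda>(x, y). f x y) \<in> borel_measurable circ2"
    by measurable
  have eq: "f (rotate a x) (rotate a y) = f (x + a) (y + a)" for x y
    unfolding rotate_def periodic_angle_mod [OF per(2)] by (rule periodic_angle_mod [OF per(1)])
  show "integrable circ2 (\<lambda>(x, y). f (x + a) (y + a)) \<longleftrightarrow> integrable circ2 (\<lambda>(x, y). f x y)"
    using integrable_distr_eq [of ?T circ2 circ2 "\<lambda>(x, y). f x y"]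
    by (simp add: distr [unfolded case_prod_unfold] eq case_prod_unfold)
  show "(\<integral>(x, y). f (x + a) (y + a) \<partial>circ2) = (\<integral>(x, y). f x y \<partial>circ2)"
    using integral_distr [of ?T circ2 circ2 "\<lambda>(x, y). f x y"]
    by (simp add: distr [unfolded case_prod_unfold] eq case_prod_unfold)
qed

section \<open>Lipschitz functions on the circle\<close>

lemma chord_sq: "norm (cis x - cis y) ^ 2 = 2 * (1 - cos (x - y))"
proof -
  have "norm (cis x - cis y) ^ 2 = (cos x - cos y)^2 + (sin x - sin y)^2"
    by (simp add: cmod_power2)
  also have "\<dots> = (sin x ^2 + cos x ^2) + (sin y ^2 + cos y^2) - 2 * (cos x * cos y + sin x * sin y)"
    by (simp add: power2_eq_square algebra_simps)
  finally show ?thesis by (simp add: cos_diff)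
qed

lemma chord_sin: "norm (cis x - cis y) = 2 * \<bar>sin ((x - y) / 2)\<bar>"
proof -
  have "norm (cis x - cis y) ^ 2 = (2 * \<bar>sin ((x - y) / 2)\<bar>) ^ 2"
  proof -
    have "cos (x - y) = cos (2 * ((x - y) / 2))"
      by (rule arg_cong [where f = cos]) simp
    also have "\<dots> = 1 - 2 * (sin ((x - y) / 2))^2" by (rule cos_double_sin)
    finally show ?thesis unfolding chord_sq by (simp add: power_mult_distrib)
  qed
  then show ?thesis by (rule power2_eq_imp_eq) auto
qed

text \<open>The distance on the circle is the chord, whose square is twice the denominator \<open>1 - cos (x - y)\<close>
  of the energy. The condition entails periodicity and continuity, and \<open>L\<close> bounds the size of the
  function as well, so that the least \<open>L\<close> is a norm.\<close>

definition chord_lip :: "real \<Rightarrow> (real \<Rightarrow> complex) \<Rightarrow> bool" where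
  "chord_lip L g \<longleftrightarrow> (\<forall>x. norm (g x) \<le> L) \<and> (\<forall>x y. norm (g x - g y) \<le> L * norm (cis x - cis y))"

lemma chord_lipD:
  assumes "chord_lip L g"
  shows "norm (g x) \<le> L" "norm (g x - g y) \<le> L * norm (cis x - cis y)" "L \<ge> 0"
  using assms order_trans [OF norm_ge_zero, of "g 0" L] by (auto simp: chord_lip_def)

lemma chord_lip_sq:
  assumes "chord_lip L g"
  shows "norm (g x - g y) ^ 2 \<le> 2 * L^2 * (1 - cos (x - y))"
proof -
  have "norm (g x - g y) ^ 2 \<le> (L * norm (cis x - cis y)) ^ 2"
    by (intro power_mono chord_lipD [OF assms]) simp
  then show ?thesis by (simp add: power_mult_distrib chord_sq algebra_simps)
qed

lemma chord_lip_cong: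
  assumes "chord_lip L g" "cis x = cis y" shows "g x = g y"
  using chord_lipD(2) [OF assms(1), of x y] assms(2) by simp

lemma cis_add_2pi [simp]: "cis (x + 2*pi) = cis x"
  by (simp add: cis.ctr)

lemma chord_lip_periodic: "chord_lip L g \<Longrightarrow> periodic_2pi g"
  unfolding periodic_2pi_def using chord_lip_cong cis_add_2pi by blast

lemma chord_lip_continuous: "chord_lip L g \<Longrightarrow> continuous_on UNIV g"
proof -
  assume g: "chord_lip L g"
  have "isCont g x" for x
  proof -
    have "((\<lambda>y. L * norm (cis y - cis x)) \<longlongrightarrow> L * norm (cis x - cis x)) (at x)"
      by (intro tendsto_intros isContD) (auto intro!: continuous_intros)
    then have "((\<lambda>y. L * norm (cis y - cis x)) \<longlongrightarrow> 0) (at x)" by simp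
    then have "((\<lambda>y. g y - g x) \<longlongrightarrow> 0) (at x)"
      by (rule Lim_null_comparison [rotated]) (use chord_lipD(2) [OF g] in auto)
    then show ?thesis unfolding isCont_def by (rule Lim_null [THEN iffD2])
  qed
  then show ?thesis by (simp add: continuous_at_imp_continuous_on)
qed

lemma chord_lip_measurable: "chord_lip L g \<Longrightarrow> g \<in> borel_measurable borel"
  by (intro borel_measurable_continuous_onI chord_lip_continuous)

lemma chord_lip_add:
  assumes g: "chord_lip L g" and h: "chord_lip M h"
  shows "chord_lip (L + M) (\<lambda>x. g x + h x)"
  unfolding chord_lip_def
proof (intro conjI allI)
  fix x y
  show "norm (g x + h x) \<le> L + M"
    using chord_lipD(1) [OF g, of x] chord_lipD(1) [OF h, of x] by norm
  have "norm (g x + h x - (g y + h y)) \<le> norm (g x - g y) + norm (h x - h y)" by norm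
  also have "\<dots> \<le> L * norm (cis x - cis y) + M * norm (cis x - cis y)"
    by (intro add_mono chord_lipD(2) g h)
  finally show "norm (g x + h x - (g y + h y)) \<le> (L + M) * norm (cis x - cis y)"
    by (simp add: algebra_simps)
qed

lemma chord_lip_cmult:
  assumes g: "chord_lip L g"
  shows "chord_lip (norm c * L) (\<lambda>x. c * g x)"
  unfolding chord_lip_def
proof (intro conjI allI)
  fix x y
  show "norm (c * g x) \<le> norm c * L"
    unfolding norm_mult by (intro mult_left_mono chord_lipD(1) [OF g]) simp
  have "norm c * norm (g x - g y) \<le> norm c * (L * norm (cis x - cis y))"
    by (intro mult_left_mono chord_lipD(2) [OF g]) simp
  then show "norm (c * g x - c * g y) \<le> norm c * L * norm (cis x - cis y)"
    by (simp add: norm_mult flip: right_diff_distrib)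
qed

lemma chord_lip_mono: "chord_lip L g \<Longrightarrow> L \<le> M \<Longrightarrow> chord_lip M g"
  unfolding chord_lip_def
  by (metis (no_types, opaque_lifting) mult_right_mono norm_ge_zero order_trans)

lemma chord_lip_cis: "chord_lip (1 + real n) (\<lambda>x. cis (real n * x))"
  unfolding chord_lip_def
proof (intro conjI allI)
  fix x y
  have "norm (cis x ^ n - cis y ^ n) \<le> real n * norm (cis x - cis y)"
    by (rule norm_power_diff) auto
  also have "\<dots> \<le> (1 + real n) * norm (cis x - cis y)"
    by (intro mult_right_mono) auto
  finally show "norm (cis (real n * x) - cis (real n * y)) \<le> (1 + real n) * norm (cis x - cis y)"
    by (simp add: Complex.DeMoivre)
qed simp

text \<open>Halving the angle: \<open>sin t = 2 sin (t/2) cos (t/2)\<close>, where the cosine is at least \<open>1/sqrt 2\<close> and,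
  by the mean value theorem, \<open>sin (t/2)\<close> at least \<open>t/2\<close> times that.\<close>

lemma sin_ge_half:
  assumes "\<bar>t\<bar> \<le> pi / 2"
  shows "\<bar>t\<bar> / 2 \<le> \<bar>sin t\<bar>"
proof -
  have pos: "t / 2 \<le> sin t" if t: "0 \<le> t" "t \<le> pi / 2" for t
  proof (cases "t = 0")
    case False
    define s where "s = t / 2"
    have s: "0 < s" "s \<le> pi / 4" using t False by (auto simp: s_def)
    have c: "sqrt 2 / 2 \<le> cos z" if "0 \<le> z" "z \<le> s" for z
      unfolding cos_45 [symmetric] using that s by (intro cos_monotone_0_pi_le) auto
    obtain z where z: "0 < z" "z < s" "sin s - sin 0 = (s - 0) * cos z"
      using MVT2 [of 0 s sin cos] s by (auto intro: DERIV_sin)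
    have "s * (sqrt 2 / 2) \<le> sin s" using z c [of z] s by simp
    then have "(s * (sqrt 2 / 2)) * (sqrt 2 / 2) \<le> sin s * cos s"
      using c [of s] s by (intro mult_mono) (auto intro!: sin_ge_zero)
    then have "s \<le> 2 * sin s * cos s" by (simp add: algebra_simps)
    then show ?thesis using sin_double [of s] by (simp add: s_def)
  qed simp
  show ?thesis
  proof (cases "0 \<le> t")
    case True
    then show ?thesis using pos [of t] assms by simp
  next
    case False
    then show ?thesis using pos [of "-t"] assms by simp
  qed
qed

text \<open>A shift by a multiple of the period brings the two points within distance \<open>\<pi>\<close>, where arc and
  chord are comparable.\<close>

lemma chord_lip_of_lipschitz:
  assumes per: "periodic_2pi f" and B: "\<And>x. norm (f x) \<le> B"
    and lip: "\<And>x y. norm (f x - f y) \<le> B * \<bar>x - y\<bar>"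
  shows "chord_lip (2 * B) f"
  unfolding chord_lip_def
proof (intro conjI allI)
  fix x y
  have B0: "0 \<le> B" using order_trans [OF norm_ge_zero B] .
  then show "norm (f x) \<le> 2 * B" using B [of x] by simp
  define k where "k = round ((x - y) / (2*pi))"
  define z where "z = y + 2*pi * of_int k"
  have "\<bar>of_int k - (x - y) / (2*pi)\<bar> \<le> 1/2"
    unfolding k_def by (rule of_int_round_abs_le)
  then have "2*pi * \<bar>of_int k - (x - y) / (2*pi)\<bar> \<le> 2*pi * (1/2)"
    by (intro mult_left_mono) auto
  also have "2*pi * \<bar>of_int k - (x - y) / (2*pi)\<bar> = \<bar>2*pi * (of_int k - (x - y) / (2*pi))\<bar>"
    by (simp add: abs_mult)
  also have "2*pi * (of_int k - (x - y) / (2*pi)) = z - x"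
    by (simp add: z_def field_simps)
  finally have xz: "\<bar>x - z\<bar> \<le> pi" by simp
  have cz: "cis z = cis y"
    using periodic_add_int [of cis y k] by (simp add: periodic_2pi_def z_def)
  have "\<bar>x - z\<bar> / 4 \<le> \<bar>sin ((x - z) / 2)\<bar>"
    using sin_ge_half [of "(x - z)/2"] xz by simp
  then have c: "\<bar>x - z\<bar> \<le> 2 * norm (cis x - cis z)"
    unfolding chord_sin by simp
  have "norm (f x - f y) = norm (f x - f z)"
    using periodic_add_int [OF per] by (simp add: z_def)
  also have "\<dots> \<le> B * \<bar>x - z\<bar>" by (rule lip)
  also have "\<dots> \<le> B * (2 * norm (cis x - cis z))" by (intro mult_left_mono c B0)
  finally show "norm (f x - f y) \<le> 2 * B * norm (cis x - cis y)" by (simp add: cz)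
qed

lemma periodic_continuous_bounded:
  fixes f :: "real \<Rightarrow> complex"
  assumes per: "periodic_2pi f" and cont: "continuous_on UNIV f"
  obtains B where "\<And>x. norm (f x) \<le> B"
proof -
  have "compact (f ` period)"
    by (intro compact_continuous_image continuous_on_subset [OF cont]) auto
  then obtain B where B: "\<And>x. x \<in> period \<Longrightarrow> norm (f x) \<le> B"
    by (meson compact_imp_bounded bounded_iff imageI)
  have "norm (f x) \<le> B" for x
    using B [of "angle_mod x"] angle_mod_range [of x] periodic_angle_mod [OF per, of x] by auto
  then show ?thesis by (rule that)
qed

subsection \<open>Smooth periodic functions\<close>

abbreviation vderiv :: "(real \<Rightarrow> complex) \<Rightarrow> real \<Rightarrow> complex" where
  "vderiv f \<equiv> \<lambda>x. vector_derivative f (at x)"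

lemma has_vector_derivative_shift:
  assumes "(g has_vector_derivative g') (at (x + a))"
  shows "((\<lambda>x. g (x + a)) has_vector_derivative g') (at (x::real))"
proof -
  have "((\<lambda>x. x + a) has_vector_derivative 1) (at x)"
    by (auto intro!: derivative_eq_intros)
  from vector_diff_chain_at [OF this assms] show ?thesis by (simp add: o_def)
qed

text \<open>Smoothness is coinductive: a family of periodic functions closed under differentiation
  consists of smooth functions.\<close>

lemma smooth_periodic_coinduct:
  assumes "X f" and step: "\<And>g. X g \<Longrightarrow> periodic_2pi g \<and>
    (\<exists>g'. X g' \<and> (\<forall>x. (g has_vector_derivative g' x) (at x)))"
  shows "smooth_periodic f"
proof -
  have "\<exists>D. \<forall>n. (X (D n) \<and> (n = 0 \<longrightarrow> D n = f)) \<and>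
      (\<forall>x. (D n has_vector_derivative D (Suc n) x) (at x))"
  proof (rule dependent_nat_choice)
    show "\<exists>g. X g \<and> (0 = (0::nat) \<longrightarrow> g = f)" using assms(1) by blast
    show "\<exists>g'. (X g' \<and> (Suc n = 0 \<longrightarrow> g' = f)) \<and> (\<forall>x. (g has_vector_derivative g' x) (at x))"
      if "X g \<and> (n = 0 \<longrightarrow> g = f)" for g n
      using step that by blast
  qed
  then obtain D where "D 0 = f" "\<forall>n x. (D n has_vector_derivative D (Suc n) x) (at x)"
    by blast
  then show ?thesis using step [OF assms(1)] unfolding smooth_periodic_def by blast
qed

lemma smooth_periodic_D:
  assumes "smooth_periodic f"
  shows "periodic_2pi f" "(f has_vector_derivative vderiv f x) (at x)" "smooth_periodic (vderiv f)"
proof -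
  obtain D where per: "periodic_2pi f" and D: "D 0 = f"
    "\<And>n x. (D n has_vector_derivative D (Suc n) x) (at x)"
    using assms unfolding smooth_periodic_def by blast
  show "periodic_2pi f" by (rule per)
  have vd: "vderiv (D n) = D (Suc n)" for n
    using D(2) by (auto intro: vector_derivative_at)
  show "(f has_vector_derivative vderiv f x) (at x)" using D(2) [of 0 x] fun_cong [OF vd [of 0], of x] D(1) by simp
  have perD: "periodic_2pi (D 1)"
    unfolding periodic_2pi_def
  proof
    fix x
    have "((\<lambda>x. D 0 (x + 2*pi)) has_vector_derivative D 1 (x + 2*pi)) (at x)"
      using D(2) [of 0] by (intro has_vector_derivative_shift) simp
    moreover have "(\<lambda>x. D 0 (x + 2*pi)) = D 0" using per D(1) by (simp add: periodic_2pi_def fun_eq_iff)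
    ultimately have "(D 0 has_vector_derivative D 1 (x + 2*pi)) (at x)" by simp
    then show "D 1 (x + 2*pi) = D 1 x"
      using D(2) [of 0 x] by (auto dest: vector_derivative_unique_at)
  qed
  have "vderiv f = D 1" using vd [of 0] D(1) by simp
  then show "smooth_periodic (vderiv f)"
    unfolding smooth_periodic_def using perD D(2)
    by (auto intro!: exI [of _ "\<lambda>n. D (Suc n)"])
qed

lemma smooth_periodic_continuous: "smooth_periodic f \<Longrightarrow> continuous_on UNIV f"
  using smooth_periodic_D(2)
  by (intro continuous_at_imp_continuous_on ballI) (metis has_vector_derivative_continuous)

lemma smooth_periodic_measurable: "smooth_periodic f \<Longrightarrow> f \<in> borel_measurable borel"
  by (intro borel_measurable_continuous_onI smooth_periodic_continuous)

lemma smooth_periodic_bounded: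
  assumes "smooth_periodic f" obtains B where "\<And>x. norm (f x) \<le> B"
  using periodic_continuous_bounded [OF smooth_periodic_D(1) [OF assms]
      smooth_periodic_continuous [OF assms]] by blast

lemma bounded_vderiv_lipschitz:
  fixes f :: "real \<Rightarrow> complex"
  assumes "\<And>x. (f has_vector_derivative f' x) (at x)" "\<And>x. norm (f' x) \<le> B"
  shows "norm (f x - f y) \<le> B * \<bar>x - y\<bar>"
proof -
  have "norm (f x - f y) \<le> B * norm (x - y)"
  proof (rule differentiable_bound [of UNIV f "\<lambda>x h. h *\<^sub>R f' x"])
    show "(f has_derivative (\<lambda>h. h *\<^sub>R f' x)) (at x within UNIV)" for x
      using assms(1) by (simp add: has_vector_derivative_def)
    show "onorm (\<lambda>h. h *\<^sub>R f' x) \<le> B" for x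
      by (rule onorm_le) (use assms(2) [of x] in \<open>simp add: mult.commute [of B] mult_left_mono\<close>)
  qed auto
  then show ?thesis by simp
qed

lemma smooth_periodic_chord_lip:
  assumes "smooth_periodic f" obtains L where "chord_lip L f"
proof -
  obtain B where B: "\<And>x. norm (f x) \<le> B" using smooth_periodic_bounded [OF assms] by blast
  obtain C where C: "\<And>x. norm (vderiv f x) \<le> C"
    using smooth_periodic_bounded [OF smooth_periodic_D(3) [OF assms]] by blast
  have "norm (f x - f y) \<le> C * \<bar>x - y\<bar>" for x y
    by (rule bounded_vderiv_lipschitz [OF smooth_periodic_D(2) [OF assms] C])
  then have "norm (f x - f y) \<le> max B C * \<bar>x - y\<bar>" for x y
    by (rule order_trans) (intro mult_right_mono; simp)
  moreover have "norm (f x) \<le> max B C" for x using B [of x] by simp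
  ultimately have "chord_lip (2 * max B C) f"
    by (intro chord_lip_of_lipschitz smooth_periodic_D(1) [OF assms])
  then show ?thesis by (rule that)
qed

lemma smooth_periodic_cis: "smooth_periodic (\<lambda>x. c * cis (real n * x))"
proof (rule smooth_periodic_coinduct [where X = "\<lambda>g. \<exists>c. g = (\<lambda>x. c * cis (real n * x))"])
  fix g assume "\<exists>c. g = (\<lambda>x. c * cis (real n * x))"
  then obtain c where g: "g = (\<lambda>x. c * cis (real n * x))" by blast
  have "((\<lambda>z. c * exp (\<i> * of_nat n * z)) has_field_derivative (c * \<i> * of_nat n) * exp (\<i> * of_nat n * of_real x))
      (at (of_real x))" for x
    by (auto intro!: derivative_eq_intros)
  from has_vector_derivative_real_field [OF this]
  have "(g has_vector_derivative (c * \<i> * of_nat n) * cis (real n * x)) (at x)" for x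
    by (simp add: g cis_conv_exp mult.assoc)
  moreover have "periodic_2pi g"
    using chord_lip_periodic [OF chord_lip_cis [of n]] by (simp add: g periodic_2pi_def)
  ultimately show "periodic_2pi g \<and> (\<exists>g'. (\<exists>c. g' = (\<lambda>x. c * cis (real n * x))) \<and>
      (\<forall>x. (g has_vector_derivative g' x) (at x)))"
    by blast
qed blast

lemma smooth_periodic_lincomb:
  assumes "smooth_periodic f" "smooth_periodic g"
  shows "smooth_periodic (\<lambda>x. f x + c * g x)"
proof (rule smooth_periodic_coinduct
    [where X = "\<lambda>k. \<exists>f g. k = (\<lambda>x. f x + c * g x) \<and> smooth_periodic f \<and> smooth_periodic g"])
  fix k assume "\<exists>f g. k = (\<lambda>x. f x + c * g x) \<and> smooth_periodic f \<and> smooth_periodic g"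
  then obtain f g where k: "k = (\<lambda>x. f x + c * g x)" and fg: "smooth_periodic f" "smooth_periodic g"
    by blast
  have "periodic_2pi k" using fg [THEN smooth_periodic_D(1)] by (simp add: k periodic_2pi_def)
  moreover have "\<forall>x. (k has_vector_derivative (vderiv f x + c * vderiv g x)) (at x)"
    unfolding k using fg [THEN smooth_periodic_D(2)]
    by (auto intro!: derivative_eq_intros)
  ultimately show "periodic_2pi k \<and> (\<exists>k'. (\<exists>f g. k' = (\<lambda>x. f x + c * g x) \<and> smooth_periodic f \<and> smooth_periodic g) \<and>
      (\<forall>x. (k has_vector_derivative k' x) (at x)))"
    using fg [THEN smooth_periodic_D(3)] by blast
qed (use assms in blast)

lemma smooth_periodic_shift:
  assumes "smooth_periodic f"
  shows "smooth_periodic (\<lambda>x. f (x + a))" and "vderiv (\<lambda>x. f (x + a)) = (\<lambda>x. vderiv f (x + a))"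
proof -
  have d: "((\<lambda>x. g (x + a)) has_vector_derivative vderiv g (x + a)) (at x)"
    if "smooth_periodic g" for g x
    by (intro has_vector_derivative_shift smooth_periodic_D(2) that)
  show "smooth_periodic (\<lambda>x. f (x + a))"
  proof (rule smooth_periodic_coinduct [where X = "\<lambda>k. \<exists>g. k = (\<lambda>x. g (x + a)) \<and> smooth_periodic g"])
    fix k assume "\<exists>g. k = (\<lambda>x. g (x + a)) \<and> smooth_periodic g"
    then obtain g where k: "k = (\<lambda>x. g (x + a))" and g: "smooth_periodic g" by blast
    have "periodic_2pi k"
      using smooth_periodic_D(1) [OF g] by (auto simp: k periodic_2pi_def add.assoc add.commute [of "2*pi"])
        (metis add.assoc add.commute)
    then show "periodic_2pi k \<and> (\<exists>k'. (\<exists>g. k' = (\<lambda>x. g (x + a)) \<and> smooth_periodic g) \<and>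
      (\<forall>x. (k has_vector_derivative k' x) (at x)))"
      using d [OF g] smooth_periodic_D(3) [OF g] k by blast
  qed (use assms in blast)
  show "vderiv (\<lambda>x. f (x + a)) = (\<lambda>x. vderiv f (x + a))"
    using d [OF assms] by (auto intro: vector_derivative_at)
qed

section \<open>Fourier coefficients\<close>

lemma integrable_circ_measurable [dest]:
  "integrable circ f \<Longrightarrow> f \<in> borel_measurable borel"
  using borel_measurable_integrable [of circ f] measurable_cong_sets [OF sets_circ refl] by blast

lemma cis_measurable [measurable]:
  "f \<in> borel_measurable M \<Longrightarrow> (\<lambda>x. cis (f x)) \<in> borel_measurable M"
  by (rule borel_measurable_continuous_on [where f = cis]) (auto intro!: continuous_intros)

lemma cnj_measurable [measurable]:
  "f \<in> borel_measurable M \<Longrightarrow> (\<lambda>x. cnj (f x)) \<in> borel_measurable M"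
  by (rule borel_measurable_continuous_on [where f = cnj]) (auto intro!: continuous_intros)

lemma integrable_mult_bounded:
  fixes u f :: "real \<Rightarrow> complex"
  assumes "integrable circ u" and [measurable]: "f \<in> borel_measurable borel"
    and B: "\<And>x. norm (f x) \<le> B"
  shows "integrable circ (\<lambda>x. u x * f x)"
proof (rule Bochner_Integration.integrable_bound)
  show "integrable circ (\<lambda>x. B * norm (u x))" using assms(1) by simp
  have [measurable]: "u \<in> borel_measurable borel" using assms(1) by blast
  show "(\<lambda>x. u x * f x) \<in> borel_measurable circ" by measurable
  have "0 \<le> B" using order_trans [OF norm_ge_zero B] .
  then show "AE x in circ. norm (u x * f x) \<le> norm (B * norm (u x))"
    by (auto simp: norm_mult mult.commute [of B] intro!: mult_left_mono B)
qed

abbreviation mode :: "int \<Rightarrow> real \<Rightarrow> complex" where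
  "mode k x \<equiv> cis (of_int k * x)"

lemma integrable_mult_cis: "integrable circ u \<Longrightarrow> integrable circ (\<lambda>x. u x * cis (r * x))"
  by (rule integrable_mult_bounded [where B = 1]) auto

lemma integrable_mult_cis_minus: "integrable circ u \<Longrightarrow> integrable circ (\<lambda>x. u x * cis (- (r * x)))"
  using integrable_mult_cis [of u "-r"] by simp

lemma integrable_cis: "integrable circ (\<lambda>x. cis (r * x))"
  by (rule integrable_circ_bounded [where B = 1]) auto

lemma fourier_coeff_circ:
  assumes [measurable]: "u \<in> borel_measurable borel"
  shows "fourier_coeff u k = (\<integral>x. u x * cis (- (of_int k * x)) \<partial>circ) / of_real (2*pi)"
  unfolding fourier_coeff_def by (subst LINT_circ) auto

lemma fourier_coeff_eq:
  assumes "integrable circ u"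
  shows "(\<integral>x. u x * cnj (mode k x) \<partial>circ) = of_real (2*pi) * fourier_coeff u k"
  using fourier_coeff_circ [of u k] assms by (auto simp: cis_cnj)

lemma fourier_coeff_lincomb:
  assumes u: "integrable circ u" and v: "integrable circ v"
  shows "fourier_coeff (\<lambda>x. u x + c * v x) k = fourier_coeff u k + c * fourier_coeff v k"
proof -
  have [measurable]: "u \<in> borel_measurable borel" "v \<in> borel_measurable borel" using u v by auto
  have "(\<integral>x. (u x + c * v x) * cis (- (of_int k * x)) \<partial>circ) =
      (\<integral>x. u x * cis (- (of_int k * x)) + c * (v x * cis (- (of_int k * x))) \<partial>circ)"
    by (simp add: algebra_simps)
  also have "\<dots> = (\<integral>x. u x * cis (- (of_int k * x)) \<partial>circ) + c * (\<integral>x. v x * cis (- (of_int k * x)) \<partial>circ)"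
    using integrable_mult_cis_minus [OF u] integrable_mult_cis_minus [OF v]
    by (subst Bochner_Integration.integral_add) auto
  finally show ?thesis by (simp add: fourier_coeff_circ add_divide_distrib)
qed

lemma fourier_coeff_cmult: "fourier_coeff (\<lambda>x. c * h x) k = c * fourier_coeff h k"
  unfolding fourier_coeff_def mult.assoc set_integral_mult_right by simp

lemma periodic_mult_mode:
  assumes "periodic_2pi f"
  shows "periodic_2pi (\<lambda>x. f x * cis (- (of_int k * x)))"
  unfolding periodic_2pi_def
proof
  fix x
  have "cis (- (of_int k * (x + 2*pi))) = cis (- (of_int k * x) + 2*pi * of_int (-k))"
    by (rule arg_cong [where f = cis]) (simp add: algebra_simps)
  also have "\<dots> = cis (- (of_int k * x))"
    by (rule periodic_add_int) (simp add: periodic_2pi_def)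
  finally show "f (x + 2*pi) * cis (- (of_int k * (x + 2*pi))) = f x * cis (- (of_int k * x))"
    using assms by (simp add: periodic_2pi_def)
qed

lemma fourier_coeff_mode: "fourier_coeff (mode j) k = (if j = k then 1 else 0)"
proof -
  have "mode j x * cis (- (of_int k * x)) = mode (j - k) x" for x
    by (simp add: cis_mult algebra_simps)
  then show ?thesis
    unfolding fourier_coeff_def using integral_cis_period [of "j - k"] by simp
qed

lemma fourier_coeff_mult_mode:
  assumes "u \<in> borel_measurable borel"
  shows "fourier_coeff (\<lambda>x. u x * mode j x) k = fourier_coeff u (k - j)"
proof -
  have "mode j x * cis (- (of_int k * x)) = cis (- (of_int (k - j) * x))" for x
    by (simp add: cis_mult algebra_simps)
  then show ?thesis unfolding fourier_coeff_def mult.assoc by (simp only:)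
qed

lemma norm_fourier_coeff_le:
  assumes "integrable circ u"
  shows "norm (fourier_coeff u k) \<le> (\<integral>x. norm (u x) \<partial>circ) / (2*pi)"
proof -
  have "norm (of_real (2*pi) * fourier_coeff u k) \<le> (\<integral>x. norm (u x * cnj (mode k x)) \<partial>circ)"
    unfolding fourier_coeff_eq [OF assms, symmetric] by (rule integral_norm_bound)
  then show ?thesis by (simp add: norm_mult field_simps)
qed

subsection \<open>Bessel's inequality\<close>

lemma integrable_of_square:
  fixes u :: "real \<Rightarrow> complex"
  assumes [measurable]: "u \<in> borel_measurable borel" and "integrable circ (\<lambda>x. norm (u x) ^ 2)"
  shows "integrable circ u"
proof (rule Bochner_Integration.integrable_bound)
  show "integrable circ (\<lambda>x. 1 + norm (u x) ^ 2)" using assms(2) by simp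
  show "u \<in> borel_measurable circ" by measurable
  have "r \<le> 1 + r^2" for r :: real
    using zero_le_power2 [of "r - 1/2"] by (simp add: power2_eq_square algebra_simps)
  then show "AE x in circ. norm (u x) \<le> norm (1 + norm (u x) ^ 2)" by simp
qed

lemma norm_add_sq: "norm (a + b :: complex) ^ 2 = norm a ^ 2 + 2 * Re (a * cnj b) + norm b ^ 2"
  unfolding cmod_power2 by (simp add: power2_eq_square algebra_simps)

text \<open>The squared norm after changing a single coefficient; iterating it to remove the modes of a
  finite set one after the other is Bessel's inequality.\<close>

lemma integral_sq_add_mode:
  assumes [measurable]: "u \<in> borel_measurable borel" and u2: "integrable circ (\<lambda>x. norm (u x) ^ 2)"
  shows "integrable circ (\<lambda>x. norm (u x + s * mode k x) ^ 2)"
    and "(\<integral>x. norm (u x + s * mode k x) ^ 2 \<partial>circ) =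
      (\<integral>x. norm (u x) ^ 2 \<partial>circ) + 2*pi * (norm (fourier_coeff u k + s) ^ 2 - norm (fourier_coeff u k) ^ 2)"
proof -
  have u: "integrable circ u" by (rule integrable_of_square) fact+
  define w where "w x = u x * cnj (s * mode k x)" for x
  have i: "integrable circ w"
    using integrable_mult_right [OF integrable_mult_cis_minus [OF u], of "cnj s" "of_int k"]
    by (simp add: w_def [abs_def] cis_cnj mult_ac)
  have "(\<integral>x. w x \<partial>circ) = (\<integral>x. cnj s * (u x * cnj (mode k x)) \<partial>circ)"
    by (simp add: w_def mult_ac)
  also have "\<dots> = cnj s * (of_real (2*pi) * fourier_coeff u k)"
    unfolding fourier_coeff_eq [OF u, symmetric] by (rule integral_mult_right_zero)
  finally have I: "(\<integral>x. Re (w x) \<partial>circ) = 2*pi * Re (fourier_coeff u k * cnj s)"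
    by (subst integral_Re [OF i]) (simp add: algebra_simps)
  have eq: "norm (u x + s * mode k x) ^ 2 = norm (u x) ^ 2 + 2 * Re (w x) + norm s ^ 2" for x
    unfolding norm_add_sq w_def by (simp add: norm_mult)
  have iw: "integrable circ (\<lambda>x. Re (w x))" by (rule integrable_Re [OF i])
  show "integrable circ (\<lambda>x. norm (u x + s * mode k x) ^ 2)"
    unfolding eq using u2 iw by (intro Bochner_Integration.integrable_add integrable_mult_right) auto
  have "(\<integral>x. norm (u x + s * mode k x) ^ 2 \<partial>circ) =
      (\<integral>x. norm (u x) ^ 2 \<partial>circ) + 2 * (\<integral>x. Re (w x) \<partial>circ) + 2*pi * norm s ^ 2"
    unfolding eq
    by (subst Bochner_Integration.integral_add Bochner_Integration.integral_add [OF u2];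
        (intro Bochner_Integration.integrable_add integrable_mult_right u2 iw circ.integrable_const)?)+ simp
  also have "\<dots> = (\<integral>x. norm (u x) ^ 2 \<partial>circ) + 2*pi * (norm (fourier_coeff u k + s) ^ 2 - norm (fourier_coeff u k) ^ 2)"
    unfolding I norm_add_sq by (simp add: algebra_simps)
  finally show "(\<integral>x. norm (u x + s * mode k x) ^ 2 \<partial>circ) =
      (\<integral>x. norm (u x) ^ 2 \<partial>circ) + 2*pi * (norm (fourier_coeff u k + s) ^ 2 - norm (fourier_coeff u k) ^ 2)" .
qed

lemma bessel:
  assumes "finite K" "u \<in> borel_measurable borel" "integrable circ (\<lambda>x. norm (u x) ^ 2)"
  shows "2*pi * (\<Sum>k\<in>K. norm (fourier_coeff u k) ^ 2) \<le> (\<integral>x. norm (u x) ^ 2 \<partial>circ)"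
  using assms
proof (induction K arbitrary: u)
  case empty
  show ?case by simp
next
  case (insert k K)
  note [measurable] = insert.prems(1)
  let ?a = "fourier_coeff u k"
  let ?v = "\<lambda>x. u x + (- ?a) * mode k x"
  have u: "integrable circ u" by (rule integrable_of_square) fact+
  have "fourier_coeff ?v j = fourier_coeff u j" if "j \<in> K" for j
    using that insert.hyps unfolding fourier_coeff_lincomb [OF u integrable_cis]
    by (auto simp: fourier_coeff_mode)
  then have "2*pi * (\<Sum>j\<in>K. norm (fourier_coeff u j) ^ 2) \<le> (\<integral>x. norm (?v x) ^ 2 \<partial>circ)"
    using insert.IH [of ?v] integral_sq_add_mode(1) [OF insert.prems, of "- ?a" k] by simp
  also have "\<dots> = (\<integral>x. norm (u x) ^ 2 \<partial>circ) - 2*pi * norm ?a ^ 2"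
    by (subst integral_sq_add_mode(2) [OF insert.prems]) simp
  finally show ?case using insert.hyps by (simp add: algebra_simps)
qed

lemma bessel_summable:
  assumes "inj f" "u \<in> borel_measurable borel" "integrable circ (\<lambda>x. norm (u x) ^ 2)"
  shows "summable (\<lambda>n::nat. norm (fourier_coeff u (f n)) ^ 2)"
    and "2*pi * (\<Sum>n. norm (fourier_coeff u (f n)) ^ 2) \<le> (\<integral>x. norm (u x) ^ 2 \<partial>circ)"
    and "(\<lambda>n. fourier_coeff u (f n)) \<longlonglongrightarrow> 0"
proof -
  let ?I = "(\<integral>x. norm (u x) ^ 2 \<partial>circ)"
  have b: "(\<Sum>n<N. norm (fourier_coeff u (f n)) ^ 2) \<le> ?I / (2*pi)" for N
  proof -
    have "inj_on f {..<N}" using assms(1) by (rule inj_on_subset) simp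
    then show ?thesis
      using bessel [of "f ` {..<N}" u] assms by (simp add: sum.reindex field_simps)
  qed
  show s: "summable (\<lambda>n. norm (fourier_coeff u (f n)) ^ 2)"
    by (rule summableI_nonneg_bounded [OF _ b]) simp
  show "2*pi * (\<Sum>n. norm (fourier_coeff u (f n)) ^ 2) \<le> ?I"
    using suminf_le_const [OF s b] by (simp add: field_simps)
  have "(\<lambda>n. sqrt (norm (fourier_coeff u (f n)) ^ 2)) \<longlonglongrightarrow> sqrt 0"
    by (intro tendsto_real_sqrt summable_LIMSEQ_zero s)
  then show "(\<lambda>n. fourier_coeff u (f n)) \<longlonglongrightarrow> 0"
    by (simp add: tendsto_norm_zero_iff)
qed

subsection \<open>Pointwise inversion\<close>

lemma sum_symmetric_interval:
  fixes F :: "int \<Rightarrow> 'a::comm_monoid_add"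
  shows "(\<Sum>k=-int N..int N. F k) = F 0 + (\<Sum>n<N. F (int (Suc n)) + F (- int (Suc n)))"
proof (induction N)
  case (Suc N)
  have "{-int (Suc N)..int (Suc N)} = insert (int (Suc N)) (insert (- int (Suc N)) {-int N..int N})"
    by auto
  then show ?case using Suc by (simp add: ac_simps)
qed simp

lemma tendsto_mult_unimodular:
  fixes a c :: "nat \<Rightarrow> complex"
  assumes "a \<longlonglongrightarrow> 0" "\<And>n. norm (c n) = 1"
  shows "(\<lambda>n. a n * c n) \<longlonglongrightarrow> 0"
  by (rule tendsto_norm_zero_cancel) (use assms in \<open>simp add: norm_mult tendsto_norm_zero\<close>)

text \<open>Chernoff's argument: dividing \<open>f - f x\<^sub>0\<close> by \<open>cis (x - x\<^sub>0) - 1\<close> leaves a bounded function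
  \<open>g\<close>, in terms of which the symmetric partial sums at \<open>x\<^sub>0\<close> telescope; the two remaining
  coefficients of \<open>g\<close> tend to zero by Bessel's inequality.\<close>

lemma fourier_inversion:
  assumes f: "chord_lip L f"
  shows "(\<lambda>N. \<Sum>k=-int N..int N. fourier_coeff f k * mode k x0) \<longlonglongrightarrow> f x0"
proof -
  note [measurable] = chord_lip_measurable [OF f]
  define g where "g x = (f x - f x0) / (cis (x - x0) - 1)" for x
  have [measurable]: "g \<in> borel_measurable borel" unfolding g_def [abs_def] by measurable
  have n: "norm (cis (x - x0) - 1) = norm (cis x - cis x0)" for x
    by (simp add: chord_sin [of "x - x0" 0, simplified] chord_sin)
  have gB: "norm (g x) \<le> L" for x
  proof (cases "cis x = cis x0")
    case True
    then show ?thesis using chord_lip_cong [OF f True] chord_lipD(3) [OF f] by (simp add: g_def)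
  next
    case False
    then show ?thesis using chord_lipD(2) [OF f, of x x0]
      by (simp add: g_def norm_divide n field_simps)
  qed
  have ig: "integrable circ g" by (rule integrable_circ_bounded [OF _ gB]) measurable
  have "norm (g x) ^ 2 \<le> L^2" for x by (rule power_mono [OF gB]) simp
  then have ig2: "integrable circ (\<lambda>x. norm (g x) ^ 2)"
    by (intro integrable_circ_bounded [where B = "L^2"]) auto
  define c where "c = f x0"
  \<comment> \<open>The factor \<open>1\<close> gives the sum the shape of a linear combination.\<close>
  have f_eq: "f x = c * mode 0 x + 1 * (cis (- x0) * (g x * mode 1 x) + (-1) * g x)" for x
  proof (cases "cis x = cis x0")
    case True
    then have "cis (x - x0) = 1" using n [of x] by simp
    then show ?thesis using chord_lip_cong [OF f True]
      by (simp add: g_def c_def)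
  next
    case False
    then have "cis (x - x0) - 1 \<noteq> 0" using n [of x] by (metis norm_eq_zero right_minus_eq)
    then have "f x - f x0 = g x * (cis (x - x0) - 1)" by (simp add: g_def)
    also have "cis (x - x0) = cis (-x0) * mode 1 x" by (simp add: cis_mult)
    finally show ?thesis by (simp add: c_def algebra_simps)
  qed
  define b where "b k = fourier_coeff g k * mode k x0" for k
  have coeff: "fourier_coeff f k * mode k x0 = (if k = 0 then c else 0) + (b (k - 1) - b k)" for k
  proof -
    have i1: "integrable circ (\<lambda>x. g x * mode 1 x)" by (rule integrable_mult_cis [OF ig])
    have i0: "integrable circ (\<lambda>x. c * mode 0 x)" by (rule integrable_circ_bounded [where B = "norm c"]) auto
    have "integrable circ (\<lambda>x. cis (- x0) * (g x * mode 1 x) + (-1) * g x)"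
      using i1 ig by simp
    note lc = fourier_coeff_lincomb [OF i0 this, of 1 k]
    have "f = (\<lambda>x. c * mode 0 x + 1 * (cis (- x0) * (g x * mode 1 x) + (-1) * g x))"
      by (rule ext) (rule f_eq)
    then have "fourier_coeff f k = fourier_coeff (\<lambda>x. c * mode 0 x) k
        + 1 * fourier_coeff (\<lambda>x. cis (- x0) * (g x * mode 1 x) + (-1) * g x) k"
      using lc by (simp only:)
    also have "fourier_coeff (\<lambda>x. c * mode 0 x) k = c * fourier_coeff (mode 0) k"
      by (rule fourier_coeff_cmult)
    also have "fourier_coeff (\<lambda>x. cis (- x0) * (g x * mode 1 x) + (-1) * g x) k =
        cis (- x0) * fourier_coeff g (k - 1) - fourier_coeff g k"
    proof -
      have "fourier_coeff (\<lambda>x. cis (- x0) * (g x * mode 1 x)) k = cis (- x0) * fourier_coeff (\<lambda>x. g x * mode 1 x) k"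
        by (rule fourier_coeff_cmult)
      moreover have "fourier_coeff (\<lambda>x. cis (- x0) * (g x * mode 1 x) + (-1) * g x) k =
          fourier_coeff (\<lambda>x. cis (- x0) * (g x * mode 1 x)) k + (-1) * fourier_coeff g k"
        by (rule fourier_coeff_lincomb) (use i1 ig in auto)
      ultimately show ?thesis using fourier_coeff_mult_mode [of g 1 k] by simp
    qed
    finally have e: "fourier_coeff f k = c * (if 0 = k then 1 else 0)
        + (cis (- x0) * fourier_coeff g (k - 1) - fourier_coeff g k)"
      by (simp only: fourier_coeff_mode mult_1)
    have "fourier_coeff f k * mode k x0 = c * (if 0 = k then 1 else 0) * mode k x0
        + (fourier_coeff g (k - 1) * (cis (- x0) * mode k x0) - fourier_coeff g k * mode k x0)"
      unfolding e by (simp only: algebra_simps)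
    also have "cis (- x0) * mode k x0 = mode (k - 1) x0" by (simp add: cis_mult algebra_simps)
    finally show ?thesis by (auto simp: b_def)
  qed
  have tele: "(\<Sum>k=-int N..int N. b (k - 1) - b k) = b (- int (Suc N)) - b (int N)" for N
    unfolding sum_symmetric_interval
    by (induction N) (auto simp: algebra_simps)
  have "(\<Sum>k=-int N..int N. fourier_coeff f k * mode k x0) = c + (b (- int (Suc N)) - b (int N))" for N
    unfolding coeff sum.distrib tele by simp
  moreover have "(\<lambda>N. b (- int (Suc N))) \<longlonglongrightarrow> 0"
    unfolding b_def
    by (rule tendsto_mult_unimodular [OF bessel_summable(3) [OF _ _ ig2]]) (auto simp: inj_def)
  moreover have "(\<lambda>N. b (int N)) \<longlonglongrightarrow> 0"
    unfolding b_def
    by (rule tendsto_mult_unimodular [OF bessel_summable(3) [OF _ _ ig2]]) (auto simp: inj_def)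
  ultimately show ?thesis by (auto simp: c_def intro!: tendsto_eq_intros)
qed

subsection \<open>Smooth functions\<close>

lemma integrable_smooth: "smooth_periodic f \<Longrightarrow> integrable circ f"
  by (rule smooth_periodic_bounded, assumption)
    (rule integrable_circ_bounded [OF smooth_periodic_measurable])

lemma fourier_coeff_vderiv:
  assumes "smooth_periodic f"
  shows "fourier_coeff (vderiv f) k = \<i> * of_int k * fourier_coeff f k"
proof -
  note i = integrable_mult_cis_minus [OF integrable_smooth]
  have [measurable]: "f \<in> borel_measurable borel" "vderiv f \<in> borel_measurable borel"
    using assms smooth_periodic_D(3) smooth_periodic_measurable by blast+
  define F where "F x = f x * cis (- (of_int k * x))" for x
  define F' where "F' x = vderiv f x * cis (- (of_int k * x)) + (- \<i> * of_int k) * (f x * cis (- (of_int k * x)))" for x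
  have d: "(F has_vector_derivative F' x) (at x within period)" for x
  proof -
    have "((\<lambda>z. exp (- \<i> * of_int k * z)) has_field_derivative (- \<i> * of_int k) * exp (- \<i> * of_int k * of_real x)) (at (of_real x))"
      by (auto intro!: derivative_eq_intros)
    from has_vector_derivative_real_field [OF this]
    have c: "((\<lambda>x. cis (- (of_int k * x))) has_vector_derivative (- \<i> * of_int k) * cis (- (of_int k * x))) (at x)"
      by (simp add: cis_conv_exp mult.assoc)
    have "(F has_vector_derivative F' x) (at x)"
      using has_vector_derivative_mult [OF smooth_periodic_D(2) [OF assms] c]
      by (simp add: F_def [abs_def] F'_def algebra_simps)
    then show ?thesis by (rule has_vector_derivative_at_within)
  qed
  have "continuous_on period F'"
    unfolding F'_def
    by (intro continuous_intros continuous_on_subset [OF smooth_periodic_continuous]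
        smooth_periodic_D(3) assms) auto
  with d have "(LINT x:period|lborel. F' x) = F (2*pi) - F 0"
    unfolding set_lebesgue_integral_def by (intro integral_FTC_Icc) auto
  also have "F (2*pi) = F 0"
  proof -
    have "cis (- (of_int k * (2*pi))) = 1"
      using cis_multiple_2pi [of "of_int (-k)"] by (simp add: mult_ac)
    moreover have "f (2*pi) = f 0"
      using smooth_periodic_D(1) [OF assms] unfolding periodic_2pi_def by (metis add_0)
    ultimately show ?thesis by (simp add: F_def)
  qed
  finally have "0 = (\<integral>x. F' x \<partial>circ)"
    by (subst (asm) LINT_circ) (auto simp: F'_def [abs_def])
  also have "\<dots> = (\<integral>x. vderiv f x * cis (- (of_int k * x)) \<partial>circ)
      + (- \<i> * of_int k) * (\<integral>x. f x * cis (- (of_int k * x)) \<partial>circ)"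
    unfolding F'_def
    by (subst Bochner_Integration.integral_add)
      (auto intro!: integrable_mult_right i assms smooth_periodic_D(3) simp del: mult_minus_left)
  finally show ?thesis by (simp add: fourier_coeff_circ)
qed

text \<open>Two integrations by parts.\<close>

lemma fourier_coeff_decay:
  assumes "smooth_periodic f"
  obtains C where "C \<ge> 0" "\<And>k. norm (fourier_coeff f k) * of_int k ^ 2 \<le> C"
proof -
  let ?g = "vderiv (vderiv f)"
  have g: "smooth_periodic ?g" by (intro smooth_periodic_D(3) assms)
  have "norm (fourier_coeff f k) * of_int k ^ 2 \<le> (\<integral>x. norm (?g x) \<partial>circ) / (2*pi)" for k
    using norm_fourier_coeff_le [OF integrable_smooth [OF g], of k]
    unfolding fourier_coeff_vderiv [OF smooth_periodic_D(3) [OF assms]] fourier_coeff_vderiv [OF assms]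
    by (simp add: norm_mult power2_eq_square mult_ac abs_mult [symmetric])
  then show ?thesis by (intro that [of "(\<integral>x. norm (?g x) \<partial>circ) / (2*pi)"]) auto
qed

text \<open>The coefficients of frequency at least \<open>1\<close>, numbered from \<open>0\<close> as in \<open>mass\<close> and \<open>P_plus\<close>.\<close>

abbreviation pos_coeff :: "(real \<Rightarrow> complex) \<Rightarrow> nat \<Rightarrow> complex" where
  "pos_coeff u n \<equiv> fourier_coeff u (int (Suc n))"

lemma summable_fourier_coeff:
  assumes "smooth_periodic f"
  shows "summable (\<lambda>n. norm (pos_coeff f n))" "summable (\<lambda>n. norm (fourier_coeff f (- int (Suc n))))"
proof -
  obtain C where C: "\<And>k. norm (fourier_coeff f k) * of_int k ^ 2 \<le> C"
    using fourier_coeff_decay [OF assms] by blast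
  have s: "summable (\<lambda>n. C / real (Suc n) ^ 2)"
    using summable_mult [OF inverse_squares_sums [THEN sums_summable], of C] by simp
  have "norm (pos_coeff f n) \<le> C / real (Suc n) ^ 2" for n
    using C [of "int (Suc n)"] by (simp add: field_simps)
  then show "summable (\<lambda>n. norm (pos_coeff f n))"
    by (intro summable_comparison_test' [OF s]) simp
  have "norm (fourier_coeff f (- int (Suc n))) \<le> C / real (Suc n) ^ 2" for n
  proof -
    have "of_int (- int (Suc n)) ^ 2 = real (Suc n) ^ 2" by (simp add: power2_eq_square algebra_simps)
    then show ?thesis using C [of "- int (Suc n)"] by (simp add: pos_le_divide_eq)
  qed
  then show "summable (\<lambda>n. norm (fourier_coeff f (- int (Suc n))))"
    by (intro summable_comparison_test' [OF s]) simp
qed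

lemma sum_symmetric_positive:
  fixes F :: "int \<Rightarrow> 'a::comm_monoid_add"
  assumes "\<And>k. k \<le> 0 \<Longrightarrow> F k = 0"
  shows "(\<Sum>k=-int N..int N. F k) = (\<Sum>n<N. F (int (Suc n)))"
  unfolding sum_symmetric_interval using assms by simp

lemma positive_spectrum_iff: "positive_spectrum u \<longleftrightarrow> (\<forall>k\<le>0. fourier_coeff u k = 0)"
proof -
  have "k \<ge> 1 \<longleftrightarrow> \<not> k \<le> 0" for k :: int by auto
  then show ?thesis unfolding positive_spectrum_def by simp
qed

definition mode_series :: "(nat \<Rightarrow> complex) \<Rightarrow> real \<Rightarrow> complex" where
  "mode_series c x = (\<Sum>n. c n * cis (real (Suc n) * x))"

lemma P_plus_mode_series: "P_plus f = mode_series (pos_coeff f)"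
  by (rule ext) (simp add: P_plus_def pos_multiplier_def mode_series_def)

lemma Lambda_inv_mode_series: "Lambda_inv f = mode_series (\<lambda>n. pos_coeff f n / of_real (2*pi * real (Suc n)))"
  by (rule ext) (simp add: Lambda_inv_def pos_multiplier_def mode_series_def field_simps)

lemma mode_series_measurable [measurable]: "mode_series c \<in> borel_measurable borel"
  unfolding mode_series_def [abs_def] by measurable

lemma mode_series_summable: "summable (\<lambda>n. norm (c n)) \<Longrightarrow> summable (\<lambda>n. c n * cis (real (Suc n) * x))"
  by (rule summable_norm_cancel) (simp add: norm_mult)

lemma norm_mode_series_le:
  assumes "summable (\<lambda>n. norm (c n))"
  shows "norm (mode_series c x) \<le> (\<Sum>n. norm (c n))"
  unfolding mode_series_def
  using summable_norm [of "\<lambda>n. c n * cis (real (Suc n) * x)"] assms by (simp add: norm_mult)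

lemma integrable_mode_series: "summable (\<lambda>n. norm (c n)) \<Longrightarrow> integrable circ (mode_series c)"
  by (intro integrable_circ_bounded [OF _ norm_mode_series_le]) auto

lemma pairing_mode_series:
  assumes u: "integrable circ u" and c: "summable (\<lambda>n. norm (c n))"
  shows "(\<lambda>n. of_real (2*pi) * pos_coeff u n * cnj (c n)) sums (\<integral>x. u x * cnj (mode_series c x) \<partial>circ)"
proof -
  define f where "f n x = u x * cnj (c n * cis (real (Suc n) * x))" for n x
  have f: "f n x = cnj (c n) * (u x * cnj (mode (int (Suc n)) x))" for n x
    by (simp add: f_def)
  have if_: "integrable circ (f n)" for n
    unfolding f [abs_def] using integrable_mult_cis_minus [OF u, of "real (Suc n)"]
    by (intro integrable_mult_right) (simp add: cis_cnj)
  have nf: "norm (f n x) = norm (c n) * norm (u x)" for n x by (simp add: f_def norm_mult)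
  have I: "(\<integral>x. f n x \<partial>circ) = of_real (2*pi) * pos_coeff u n * cnj (c n)" for n
    unfolding f using fourier_coeff_eq [OF u, of "int (Suc n)"] by simp
  have fs: "(\<lambda>n. f n x) sums (u x * cnj (mode_series c x))" for x
  proof -
    have "(\<lambda>n. c n * cis (real (Suc n) * x)) sums mode_series c x"
      unfolding mode_series_def by (rule summable_sums [OF mode_series_summable [OF c]])
    from sums_mult [OF sums_cnj [THEN iffD2, OF this], of "u x"]
    show ?thesis by (simp add: f_def [abs_def])
  qed
  have "(\<lambda>n. \<integral>x. f n x \<partial>circ) sums (\<integral>x. (\<Sum>n. f n x) \<partial>circ)"
  proof (rule sums_integral [OF if_])
    show "AE x in circ. summable (\<lambda>n. norm (f n x))" using c by (simp add: nf summable_mult2)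
    show "summable (\<lambda>n. \<integral>x. norm (f n x) \<partial>circ)" using c by (simp add: nf summable_mult2)
  qed
  then show ?thesis unfolding I using sums_unique [OF fs] by (simp add: sums_unique)
qed

lemma fourier_coeff_mode_series:
  assumes c: "summable (\<lambda>n. norm (c n))"
  shows "fourier_coeff (mode_series c) k = (if k \<ge> 1 then c (nat (k - 1)) else 0)"
proof -
  note S = integrable_mode_series [OF c]
  have "(\<integral>x. mode k x * cnj (mode_series c x) \<partial>circ) = cnj (\<integral>x. mode_series c x * cnj (mode k x) \<partial>circ)"
    by (simp add: mult.commute flip: Bochner_Integration.integral_cnj)
  also have "\<dots> = of_real (2*pi) * cnj (fourier_coeff (mode_series c) k)"
    by (simp add: fourier_coeff_eq [OF S] del: of_real_mult)
  finally have "(\<lambda>n. of_real (2*pi) * pos_coeff (mode k) n * cnj (c n)) sums (of_real (2*pi) * cnj (fourier_coeff (mode_series c) k))"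
    using pairing_mode_series [OF integrable_cis c, of "of_int k"] by simp
  moreover have "(\<lambda>n. of_real (2*pi) * pos_coeff (mode k) n * cnj (c n)) sums
      (of_real (2*pi) * cnj (if k \<ge> 1 then c (nat (k - 1)) else 0))"
  proof (cases "k \<ge> 1")
    case True
    then have "k = int (Suc n) \<longleftrightarrow> n = nat (k - 1)" for n by auto
    then have "(\<lambda>n. of_real (2*pi) * pos_coeff (mode k) n * cnj (c n)) =
        (\<lambda>n. if n = nat (k - 1) then of_real (2*pi) * cnj (c n) else 0)"
      by (auto simp: fourier_coeff_mode)
    then show ?thesis using True sums_single [of "nat (k - 1)" "\<lambda>n. of_real (2*pi) * cnj (c n)"] by simp
  next
    case False
    then have "(\<lambda>n. of_real (2*pi) * pos_coeff (mode k) n * cnj (c n)) = (\<lambda>n. 0)"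
      by (auto simp: fourier_coeff_mode)
    then show ?thesis using False by simp
  qed
  ultimately have "of_real (2*pi) * cnj (fourier_coeff (mode_series c) k) =
      of_real (2*pi) * cnj (if k \<ge> 1 then c (nat (k - 1)) else 0)" by (rule sums_unique2)
  then show ?thesis by simp
qed

lemma fourier_coeff_P_plus:
  assumes "smooth_periodic f"
  shows "fourier_coeff (P_plus f) k = (if k \<ge> 1 then fourier_coeff f k else 0)"
  unfolding P_plus_mode_series fourier_coeff_mode_series [OF summable_fourier_coeff(1) [OF assms]]
  by auto

lemma P_plus_positive: "smooth_periodic f \<Longrightarrow> positive_spectrum (P_plus f)"
  by (simp add: positive_spectrum_iff fourier_coeff_P_plus)

lemma mode_series_derivative:
  assumes c: "summable (\<lambda>n. norm (c n))" and c': "summable (\<lambda>n. norm (of_nat (Suc n) * c n))"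
  shows "(mode_series c has_vector_derivative mode_series (\<lambda>n. \<i> * of_nat (Suc n) * c n) x) (at x)"
proof -
  let ?d = "\<lambda>n. \<i> * of_nat (Suc n) * c n"
  let ?f = "\<lambda>n x. c n * cis (real (Suc n) * x)"
  let ?f' = "\<lambda>n x. ?d n * cis (real (Suc n) * x)"
  have d: "(?f n has_vector_derivative ?f' n x) (at x)" for n x
  proof -
    have "((\<lambda>z. c n * exp (\<i> * of_nat (Suc n) * z)) has_field_derivative
        ?d n * exp (\<i> * of_nat (Suc n) * of_real x)) (at (of_real x))"
      by (auto intro!: derivative_eq_intros)
    from has_vector_derivative_real_field [OF this] show ?thesis
      by (simp add: cis_conv_exp mult.assoc)
  qed
  have unif: "uniform_limit UNIV (\<lambda>n x. \<Sum>i<n. ?f' i x) (mode_series ?d) sequentially"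
    unfolding mode_series_def by (rule Weierstrass_m_test [OF _ c']) (simp add: norm_mult del: of_nat_Suc)
  have "\<exists>g. \<forall>x\<in>UNIV. (\<lambda>n. ?f n x) sums g x \<and>
      (g has_derivative (\<lambda>h. h *\<^sub>R mode_series ?d x)) (at x within UNIV)"
  proof (rule has_derivative_series [where f' = "\<lambda>n x h. h *\<^sub>R ?f' n x" and x = 0])
    show "(?f n has_derivative (\<lambda>h. h *\<^sub>R ?f' n x)) (at x within UNIV)" for n x
      using d [of n x] by (simp add: has_vector_derivative_def)
    show "\<forall>\<^sub>F n in sequentially. \<forall>x\<in>UNIV. \<forall>h. norm ((\<Sum>i<n. h *\<^sub>R ?f' i x)
        - h *\<^sub>R mode_series ?d x) \<le> e * norm h" if "e > 0" for e
      using uniform_limitD [OF unif that]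
    proof eventually_elim
      case (elim n)
      show ?case
      proof (intro ballI allI)
        fix x h :: real
        have "norm ((\<Sum>i<n. ?f' i x) - mode_series ?d x) \<le> e"
          using elim by (simp add: dist_norm less_imp_le)
        then have "\<bar>h\<bar> * norm ((\<Sum>i<n. ?f' i x) - mode_series ?d x) \<le> \<bar>h\<bar> * e"
          by (rule mult_left_mono) simp
        then show "norm ((\<Sum>i<n. h *\<^sub>R ?f' i x) - h *\<^sub>R mode_series ?d x) \<le> e * norm h"
          unfolding scaleR_sum_right [symmetric] scaleR_diff_right [symmetric] norm_scaleR
          by (simp add: mult.commute [of e])
      qed
    qed
    show "(\<lambda>n. ?f n 0) sums mode_series c 0"
      unfolding mode_series_def by (rule summable_sums [OF mode_series_summable [OF c]])
  qed auto
  then obtain g where g: "\<And>x. (\<lambda>n. ?f n x) sums g x"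
      "\<And>x. (g has_derivative (\<lambda>h. h *\<^sub>R mode_series ?d x)) (at x)"
    by auto
  have "g = mode_series c"
    by (rule ext) (use g(1) in \<open>simp add: mode_series_def sums_iff\<close>)
  then show ?thesis
    using g(2) [of x] by (simp add: has_vector_derivative_def)
qed

lemma P_plus_derivative:
  assumes f: "smooth_periodic f"
  shows "(P_plus f has_vector_derivative P_plus (vderiv f) x) (at x)"
proof -
  have e: "pos_coeff (vderiv f) n = \<i> * of_nat (Suc n) * pos_coeff f n" for n
    by (simp add: fourier_coeff_vderiv [OF f])
  have "summable (\<lambda>n. norm (of_nat (Suc n) * pos_coeff f n))"
    using summable_fourier_coeff(1) [OF smooth_periodic_D(3) [OF f]]
    unfolding e by (simp add: norm_mult del: of_nat_Suc)
  from mode_series_derivative [OF summable_fourier_coeff(1) [OF f] this]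
  show ?thesis unfolding P_plus_mode_series e .
qed

lemma mode_series_periodic: "periodic_2pi (mode_series c)"
proof -
  have "cis (real (Suc n) * (x + 2*pi)) = cis (real (Suc n) * x)" for n x
    using chord_lip_periodic [OF chord_lip_cis [of "Suc n"]] unfolding periodic_2pi_def by blast
  then show ?thesis by (simp add: periodic_2pi_def mode_series_def)
qed

lemma smooth_P_plus:
  assumes "smooth_periodic f" shows "smooth_periodic (P_plus f)"
proof (rule smooth_periodic_coinduct [where X = "\<lambda>g. \<exists>f. smooth_periodic f \<and> g = P_plus f"])
  fix g assume "\<exists>f. smooth_periodic f \<and> g = P_plus f"
  then obtain f where "smooth_periodic f" "g = P_plus f" by blast
  then show "periodic_2pi g \<and> (\<exists>g'. (\<exists>f. smooth_periodic f \<and> g' = P_plus f) \<and>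
      (\<forall>x. (g has_vector_derivative g' x) (at x)))"
    using P_plus_derivative mode_series_periodic [of "pos_coeff f"] smooth_periodic_D(3)
    unfolding P_plus_mode_series [symmetric] by blast
qed (use assms in blast)

text \<open>For a positive spectrum the symmetric partial sums are the partial sums of the series that
  defines \<open>P_plus\<close>, and they converge to the function.\<close>

lemma P_plus_eq_self:
  assumes "smooth_periodic f" "positive_spectrum f"
  shows "P_plus f = f"
proof
  fix x
  obtain L where "chord_lip L f" using smooth_periodic_chord_lip [OF assms(1)] by blast
  from fourier_inversion [OF this, of x]
  have "(\<lambda>N. \<Sum>n<N. pos_coeff f n * mode (int (Suc n)) x) \<longlonglongrightarrow> f x"
    using assms(2) by (subst (asm) sum_symmetric_positive) (auto simp: positive_spectrum_iff)
  then have "(\<lambda>n. pos_coeff f n * cis (real (Suc n) * x)) sums f x"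
    by (simp add: sums_def)
  then show "P_plus f x = f x" by (simp add: P_plus_mode_series mode_series_def sums_iff)
qed

text \<open>Against a smooth function only the coefficients matter: the symmetric partial sums of its
  Fourier series converge boundedly.\<close>

lemma pairing_smooth:
  assumes u: "integrable circ u" "positive_spectrum u" and f: "smooth_periodic f"
  shows "(\<lambda>n. of_real (2*pi) * pos_coeff u n * cnj (pos_coeff f n)) sums (\<integral>x. u x * cnj (f x) \<partial>circ)"
proof -
  note [measurable] = smooth_periodic_measurable [OF f]
  have [measurable]: "u \<in> borel_measurable borel" using u(1) by blast
  define S where "S N x = (\<Sum>k=-int N..int N. fourier_coeff f k * mode k x)" for N x
  have [measurable]: "S N \<in> borel_measurable borel" for N unfolding S_def [abs_def] by measurable
  define B where "B = norm (fourier_coeff f 0) + ((\<Sum>n. norm (pos_coeff f n)) + (\<Sum>n. norm (fourier_coeff f (- int (Suc n)))))"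
  have B: "norm (S N x) \<le> B" for N x
  proof -
    have "norm (S N x) \<le> (\<Sum>k=-int N..int N. norm (fourier_coeff f k))"
      unfolding S_def by (rule order_trans [OF norm_sum]) (simp add: norm_mult)
    also have "\<dots> = norm (fourier_coeff f 0) + ((\<Sum>n<N. norm (pos_coeff f n)) + (\<Sum>n<N. norm (fourier_coeff f (- int (Suc n)))))"
      unfolding sum_symmetric_interval sum.distrib ..
    also have "\<dots> \<le> B"
      unfolding B_def by (intro add_mono order_refl sum_le_suminf summable_fourier_coeff f) auto
    finally show ?thesis .
  qed
  obtain L where L: "chord_lip L f" using smooth_periodic_chord_lip [OF f] by blast
  have lim: "(\<lambda>N. \<integral>x. u x * cnj (S N x) \<partial>circ) \<longlonglongrightarrow> (\<integral>x. u x * cnj (f x) \<partial>circ)"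
  proof (rule integral_dominated_convergence [where w = "\<lambda>x. norm (u x) * B"])
    show "integrable circ (\<lambda>x. norm (u x) * B)" using u(1) by simp
    show "AE x in circ. (\<lambda>N. u x * cnj (S N x)) \<longlonglongrightarrow> u x * cnj (f x)"
      unfolding S_def by (intro AE_I2 tendsto_intros fourier_inversion [OF L])
    show "AE x in circ. norm (u x * cnj (S N x)) \<le> norm (u x) * B" for N
      by (intro AE_I2) (simp add: norm_mult mult_left_mono B)
  qed measurable
  have "(\<integral>x. u x * cnj (S N x) \<partial>circ) = (\<Sum>n<N. of_real (2*pi) * pos_coeff u n * cnj (pos_coeff f n))" for N
  proof -
    have "(\<integral>x. u x * cnj (S N x) \<partial>circ) = (\<integral>x. (\<Sum>k=-int N..int N. cnj (fourier_coeff f k) * (u x * cnj (mode k x))) \<partial>circ)"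
      by (simp add: S_def sum_distrib_left mult_ac)
    also have "\<dots> = (\<Sum>k=-int N..int N. cnj (fourier_coeff f k) * (of_real (2*pi) * fourier_coeff u k))"
      using integrable_mult_cis_minus [OF u(1)]
      by (subst Bochner_Integration.integral_sum) (auto simp: cis_cnj fourier_coeff_circ)
    also have "\<dots> = (\<Sum>n<N. cnj (pos_coeff f n) * (of_real (2*pi) * pos_coeff u n))"
      using u(2) by (intro sum_symmetric_positive) (auto simp: positive_spectrum_iff)
    finally show ?thesis by (simp add: mult_ac)
  qed
  then show ?thesis using lim by (simp add: sums_def)
qed

lemma pairing_P_plus:
  assumes "integrable circ u" "positive_spectrum u" "smooth_periodic f"
  shows "(\<integral>x. u x * cnj (P_plus f x) \<partial>circ) = (\<integral>x. u x * cnj (f x) \<partial>circ)"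
proof (rule sums_unique2)
  show "(\<lambda>n. of_real (2*pi) * pos_coeff u n * cnj (pos_coeff f n)) sums (\<integral>x. u x * cnj (P_plus f x) \<partial>circ)"
    using pairing_smooth [OF assms(1,2) smooth_P_plus [OF assms(3)]]
    by (simp add: fourier_coeff_P_plus assms(3))
qed (rule pairing_smooth [OF assms])

subsection \<open>Completeness\<close>

text \<open>The correlation of \<open>u\<close> with a Lipschitz function is Lipschitz, and its coefficients
  are products that vanish with those of \<open>u\<close>; pointwise inversion applies to it.\<close>

lemma pairing_chord_lip_zero:
  assumes u: "integrable circ u" and zero: "\<And>k. fourier_coeff u k = 0" and f: "chord_lip L f"
  shows "(\<integral>x. u x * f x \<partial>circ) = 0"
proof -
  note [measurable] = chord_lip_measurable [OF f]
  have [measurable]: "u \<in> borel_measurable borel" using u by blast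
  define F where "F t = (\<integral>x. u x * f (x + t) \<partial>circ)" for t
  let ?I = "\<integral>x. norm (u x) \<partial>circ"
  have i: "integrable circ (\<lambda>x. u x * f (x + t))" for t
    by (rule integrable_mult_bounded [OF u _ chord_lipD(1) [OF f]]) measurable
  have "chord_lip (?I * L) F"
    unfolding chord_lip_def
  proof (intro conjI allI)
    fix s t
    show "norm (F s) \<le> ?I * L"
      unfolding F_def integral_mult_left_zero [symmetric]
      by (rule Bochner_Integration.integral_norm_bound_integral [OF i])
        (use u in \<open>auto simp: norm_mult intro!: mult_left_mono chord_lipD(1) [OF f]\<close>)
    have d: "F s - F t = (\<integral>x. u x * f (x + s) - u x * f (x + t) \<partial>circ)"
      unfolding F_def by (rule Bochner_Integration.integral_diff [OF i i, symmetric])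
    have "norm (F s - F t) \<le> (\<integral>x. norm (u x) * (L * norm (cis s - cis t)) \<partial>circ)"
      unfolding d
    proof (rule Bochner_Integration.integral_norm_bound_integral)
      fix x
      have "norm (f (x + s) - f (x + t)) \<le> L * norm (cis (x + s) - cis (x + t))"
        by (rule chord_lipD(2) [OF f])
      also have "norm (cis (x + s) - cis (x + t)) = norm (cis s - cis t)"
        unfolding chord_sin by simp
      finally show "norm (u x * f (x + s) - u x * f (x + t)) \<le> norm (u x) * (L * norm (cis s - cis t))"
        by (simp add: norm_mult mult_left_mono flip: right_diff_distrib)
    qed (use u i in auto)
    then show "norm (F s - F t) \<le> ?I * L * norm (cis s - cis t)" by (simp add: mult.assoc)
  qed
  note F = this
  have per: "periodic_2pi (\<lambda>t. f t * cis (- (of_int k * t)))" for k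
    by (rule periodic_mult_mode [OF chord_lip_periodic [OF f]])
  have "fourier_coeff F k = 0" for k
  proof -
    have [measurable]: "F \<in> borel_measurable borel" by (rule chord_lip_measurable [OF F])
    have iG: "integrable circ2 (\<lambda>(x, t). u x * (f (x + t) * cis (- (of_int k * t))))"
    proof (rule circ2.Fubini_integrable)
      have iy: "integrable circ (\<lambda>t. u x * (f (x + t) * cis (- (of_int k * t))))" for x
        by (rule integrable_circ_bounded [where B = "norm (u x) * L"])
          (auto simp: norm_mult intro!: mult_left_mono chord_lipD(1) [OF f])
      then show "AE x in circ. integrable circ (\<lambda>t. case (x, t) of (x, t) \<Rightarrow> u x * (f (x + t) * cis (- (of_int k * t))))"
        by simp
      show "integrable circ (\<lambda>x. \<integral>t. norm (case (x, t) of (x, t) \<Rightarrow> u x * (f (x + t) * cis (- (of_int k * t)))) \<partial>circ)"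
      proof (rule Bochner_Integration.integrable_bound)
        show "integrable circ (\<lambda>x. norm (u x) * (L * (2*pi)))" using u by simp
        have b: "(\<integral>t. norm (u x * (f (x + t) * cis (- (of_int k * t)))) \<partial>circ) \<le> norm (u x) * (L * (2*pi))" for x
        proof -
          have "(\<integral>t. norm (u x * (f (x + t) * cis (- (of_int k * t)))) \<partial>circ) \<le> (\<integral>t. norm (u x) * L \<partial>circ)"
            by (rule integral_mono [OF integrable_norm [OF iy]])
              (auto simp: norm_mult intro!: mult_left_mono chord_lipD(1) [OF f])
          then show ?thesis by (simp add: mult_ac)
        qed
        show "AE x in circ. norm (\<integral>t. norm (case (x, t) of (x, t) \<Rightarrow> u x * (f (x + t) * cis (- (of_int k * t)))) \<partial>circ)
            \<le> norm (norm (u x) * (L * (2*pi)))"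
          using b chord_lipD(3) [OF f] by (auto simp: abs_mult)
      qed measurable
    qed measurable
    have "(\<integral>t. F t * cis (- (of_int k * t)) \<partial>circ) = (\<integral>t. (\<integral>x. u x * (f (x + t) * cis (- (of_int k * t))) \<partial>circ) \<partial>circ)"
      unfolding F_def by (simp add: mult.assoc flip: integral_mult_left_zero)
    also have "\<dots> = (\<integral>x. (\<integral>t. u x * (f (x + t) * cis (- (of_int k * t))) \<partial>circ) \<partial>circ)"
      by (rule circ2.Fubini_integral [OF iG])
    also have "\<dots> = (\<integral>x. u x * mode k x * (of_real (2*pi) * fourier_coeff f k) \<partial>circ)"
    proof (rule Bochner_Integration.integral_cong [OF refl])
      fix x
      have e: "f (x + t) * cis (- (of_int k * t)) = mode k x * (f (t + x) * cis (- (of_int k * (t + x))))" for t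
        by (simp add: cis_mult algebra_simps add.commute [of x])
      have "(\<integral>t. f (t + x) * cis (- (of_int k * (t + x))) \<partial>circ) = (\<integral>t. f t * cis (- (of_int k * t)) \<partial>circ)"
        by (rule integral_circ_shift(2) [OF _ per]) measurable
      then show "(\<integral>t. u x * (f (x + t) * cis (- (of_int k * t))) \<partial>circ) =
          u x * mode k x * (of_real (2*pi) * fourier_coeff f k)"
        unfolding e by (simp add: fourier_coeff_circ)
    qed
    also have "\<dots> = (\<integral>x. u x * cnj (mode (- k) x) \<partial>circ) * (of_real (2*pi) * fourier_coeff f k)"
      by (simp add: cis_cnj flip: integral_mult_left_zero)
    also have "\<dots> = 0"
      unfolding fourier_coeff_eq [OF u] zero by simp
    finally show ?thesis by (simp add: fourier_coeff_circ)
  qed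
  then have "F 0 = 0" using fourier_inversion [OF F, of 0] by (simp add: LIMSEQ_const_iff)
  then show ?thesis by (simp add: F_def)
qed

section \<open>The energy space\<close>

lemma AE_circ:
  assumes "AE x in lborel. x \<in> period \<longrightarrow> P x"
  shows "AE x in circ. P x"
  unfolding circ_def
  by (subst AE_density) (use assms in \<open>auto simp: indicator_def\<close>)

lemma AE_circ_period: "AE x in circ. x \<in> {0<..<2*pi} - {a}"
proof (rule AE_circ)
  have "AE x in lborel. x \<noteq> 0" "AE x in lborel. x \<noteq> 2*pi" "AE x in lborel. x \<noteq> a"
    by (rule AE_lborel_singleton)+
  then show "AE x in lborel. x \<in> period \<longrightarrow> x \<in> {0<..<2*pi} - {a}"
    by eventually_elim auto
qed

lemma periodic_eq_of_cis:
  assumes u: "periodic_2pi u" and "cis x = cis y"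
  shows "u x = u y"
proof -
  have "sin ((x - y) / 2) = 0" using assms(2) chord_sin [of x y] by simp
  then obtain k :: int where "(x - y) / 2 = of_int k * pi" by (auto simp: sin_zero_iff_int2)
  then have "x = y + 2*pi * of_int k" by (simp add: field_simps)
  then show ?thesis using periodic_add_int [OF u] by simp
qed

lemma one_minus_cos_bounds: "0 \<le> 1 - cos t" "1 - cos t \<le> 2" for t :: real
  using cos_le_one [of t] cos_ge_minus_one [of t] by linarith+

lemma one_minus_cos_le: "1 - cos t \<le> t^2 / 2" for t :: real
proof -
  have "norm (cis t - cis 0) \<le> \<bar>t\<bar>"
    unfolding chord_sin using abs_sin_x_le_abs_x [of "t / 2"] by simp
  then have "norm (cis t - cis 0) ^ 2 \<le> \<bar>t\<bar> ^ 2" by (rule power_mono) simp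
  then show ?thesis unfolding chord_sq by simp
qed

lemma periodic_eq_of_cos:
  assumes u: "periodic_2pi u" and "1 - cos (x - y) = 0"
  shows "u x = u y"
  by (rule periodic_eq_of_cis [OF u]) (use chord_sq [of x y] assms(2) in simp)

text \<open>The integrand of the Gagliardo integral of \<open>W14_4\<close>, as a function of a pair, so that it can be
  integrated against the product measure.\<close>

definition gag :: "(real \<Rightarrow> complex) \<Rightarrow> real \<times> real \<Rightarrow> real" where
  "gag u p = norm (u (fst p) - u (snd p)) ^ 4 / (1 - cos (fst p - snd p))"

definition gagliardo :: "(real \<Rightarrow> complex) \<Rightarrow> real" where
  "gagliardo u = integral\<^sup>L circ2 (gag u)"

lemma gag_measurable [measurable]:
  assumes [measurable]: "u \<in> borel_measurable borel"
  shows "gag u \<in> borel_measurable (borel \<Otimes>\<^sub>M borel)"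
  unfolding gag_def [abs_def] by measurable

lemma gag_nonneg: "0 \<le> gag u p"
  unfolding gag_def using one_minus_cos_bounds by simp

lemma gagliardo_nonneg: "0 \<le> gagliardo u"
  unfolding gagliardo_def by (rule integral_nonneg_AE) (simp add: gag_nonneg)

lemma gag_alt: "gag u = (\<lambda>(x, y). norm (u x - u y) ^ 4 / (1 - cos (x - y)))"
  by (auto simp: gag_def)

lemma W14_4_iff: "W14_4 u \<longleftrightarrow> periodic_2pi u \<and> u \<in> borel_measurable borel \<and>
    integrable circ (\<lambda>x. norm (u x) ^ 4) \<and> integrable circ2 (gag u)"
proof (cases "u \<in> borel_measurable borel")
  case [measurable]: True
  have 1: "(\<lambda>x. norm (u x) ^ 4) \<in> borel_measurable borel" by measurable
  show ?thesis
    unfolding W14_4_def set_integrable_circ [OF 1] gag_alt [symmetric]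
    using set_integrable_circ2 [OF gag_measurable [OF True]] by simp
qed (simp add: W14_4_def)

lemma W14_4D:
  assumes "W14_4 u"
  shows "periodic_2pi u" "u \<in> borel_measurable borel" "integrable circ (\<lambda>x. norm (u x) ^ 4)"
    "integrable circ2 (gag u)"
  using assms by (auto simp: W14_4_iff)

lemma energy_eq:
  assumes [measurable]: "u \<in> borel_measurable borel"
  shows "energy \<sigma> u = gagliardo u / (4 * pi^2) - 2 * \<sigma> / pi * (\<integral>x. norm (u x) ^ 4 \<partial>circ)"
  using LINT_circ2 [OF gag_measurable [OF assms]] LINT_circ [of "\<lambda>x. norm (u x) ^ 4"]
  unfolding energy_def gagliardo_def gag_alt by simp

lemma momentum_eq:
  assumes [measurable]: "u \<in> borel_measurable borel"
  shows "momentum u = (\<integral>x. norm (u x) ^ 2 \<partial>circ)"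
  unfolding momentum_def by (subst LINT_circ) auto

lemma power_le_1_plus_power4: "0 \<le> r \<Longrightarrow> k \<le> 4 \<Longrightarrow> r ^ k \<le> 1 + r ^ 4" for r :: real
proof (cases "r \<le> 1")
  case True
  assume "0 \<le> r"
  then have "r ^ k \<le> 1" "0 \<le> r ^ 4" using True by (auto simp: power_le_one)
  then show ?thesis by linarith
next
  case False
  assume "k \<le> 4"
  then have "r ^ k \<le> r ^ 4" using False by (intro power_increasing) auto
  then show ?thesis by simp
qed

lemma W14_4_integrable_power:
  assumes "W14_4 u" "k \<le> 4"
  shows "integrable circ (\<lambda>x. norm (u x) ^ k)"
proof (rule Bochner_Integration.integrable_bound)
  note [measurable] = W14_4D(2) [OF assms(1)]
  show "integrable circ (\<lambda>x. 1 + norm (u x) ^ 4)" using W14_4D(3) [OF assms(1)] by simp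
  show "(\<lambda>x. norm (u x) ^ k) \<in> borel_measurable circ" by measurable
  show "AE x in circ. norm (norm (u x) ^ k) \<le> norm (1 + norm (u x) ^ 4)"
    using power_le_1_plus_power4 [OF _ assms(2)] by (auto intro!: AE_I2 order_trans [OF _ abs_ge_self])
qed

lemma W14_4_integrable: "W14_4 u \<Longrightarrow> integrable circ u"
  using W14_4_integrable_power [of u 2] W14_4D(2) by (intro integrable_of_square) auto

lemma norm_add_pow4: "norm (a + b) ^ 4 \<le> 8 * (norm a ^ 4 + norm b ^ 4)"
  for a b :: "'a::real_normed_vector"
proof -
  let ?a = "norm a" and ?b = "norm b"
  have "norm (a + b) ^ 4 \<le> (?a + ?b) ^ 4" by (intro power_mono norm_triangle_ineq) simp
  also have "\<dots> = ((?a + ?b)^2)^2" by (simp flip: power_mult)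
  also have "\<dots> \<le> (2 * (?a^2 + ?b^2))^2"
    using zero_le_power2 [of "?a - ?b"]
    by (intro power_mono) (auto simp: power2_eq_square algebra_simps)
  also have "\<dots> \<le> 8 * ((?a^2)^2 + (?b^2)^2)"
    using zero_le_power2 [of "?a^2 - ?b^2"] by (simp add: power2_eq_square algebra_simps)
  finally show ?thesis by (simp flip: power_mult)
qed

lemma W14_4_add:
  assumes u: "W14_4 u" and v: "W14_4 v"
  shows "W14_4 (\<lambda>x. u x + v x)" and "gagliardo (\<lambda>x. u x + v x) \<le> 8 * (gagliardo u + gagliardo v)"
proof -
  note [measurable] = W14_4D(2) [OF u] W14_4D(2) [OF v]
  have g: "gag (\<lambda>x. u x + v x) p \<le> 8 * (gag u p + gag v p)" for p
  proof -
    obtain x y where p: "p = (x, y)" by (cases p)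
    have "norm ((u x - u y) + (v x - v y)) ^ 4 \<le> 8 * (norm (u x - u y) ^ 4 + norm (v x - v y) ^ 4)"
      by (rule norm_add_pow4)
    from divide_right_mono [OF this one_minus_cos_bounds(1) [of "x - y"]] show ?thesis
      by (simp add: gag_def p algebra_simps add_divide_distrib)
  qed
  have i8: "integrable circ2 (\<lambda>p. 8 * (gag u p + gag v p))" using W14_4D(4) [OF u] W14_4D(4) [OF v] by simp
  have i: "integrable circ2 (gag (\<lambda>x. u x + v x))"
    by (rule Bochner_Integration.integrable_bound [OF i8])
      (use g gag_nonneg in \<open>auto simp: abs_of_nonneg intro!: AE_I2 order_trans [OF g]\<close>)
  moreover have "integrable circ (\<lambda>x. norm (u x + v x) ^ 4)"
  proof (rule Bochner_Integration.integrable_bound)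
    show "integrable circ (\<lambda>x. 8 * (norm (u x) ^ 4 + norm (v x) ^ 4))"
      using W14_4D(3) [OF u] W14_4D(3) [OF v] by simp
  qed (use norm_add_pow4 in \<open>auto intro!: AE_I2\<close>)
  ultimately show "W14_4 (\<lambda>x. u x + v x)"
    using W14_4D(1) [OF u] W14_4D(1) [OF v] by (auto simp: W14_4_iff periodic_2pi_def)
  have "gagliardo (\<lambda>x. u x + v x) \<le> (\<integral>p. 8 * (gag u p + gag v p) \<partial>circ2)"
    unfolding gagliardo_def by (rule integral_mono [OF i i8 g])
  also have "\<dots> = 8 * (gagliardo u + gagliardo v)"
    unfolding gagliardo_def using W14_4D(4) [OF u] W14_4D(4) [OF v] by simp
  finally show "gagliardo (\<lambda>x. u x + v x) \<le> 8 * (gagliardo u + gagliardo v)" .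
qed

lemma gag_cmult: "gag (\<lambda>x. c * u x) p = norm c ^ 4 * gag u p"
  by (simp add: gag_def norm_mult power_mult_distrib flip: right_diff_distrib)

lemma W14_4_cmult:
  assumes u: "W14_4 u"
  shows "W14_4 (\<lambda>x. c * u x)" and "gagliardo (\<lambda>x. c * u x) = norm c ^ 4 * gagliardo u"
  using W14_4D [OF u]
  by (auto simp: W14_4_iff gagliardo_def gag_cmult [abs_def] norm_mult power_mult_distrib periodic_2pi_def)

lemma W14_4_diff:
  assumes u: "W14_4 u" and v: "W14_4 v"
  shows "W14_4 (\<lambda>x. u x - v x)" and "gagliardo (\<lambda>x. u x - v x) \<le> 8 * (gagliardo u + gagliardo v)"
  using W14_4_add [OF u W14_4_cmult(1) [OF v, of "-1"]] W14_4_cmult(2) [OF v, of "-1"] by auto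

lemma W14_4_chord_lip:
  assumes g: "chord_lip L g"
  shows "W14_4 g"
proof -
  note [measurable] = chord_lip_measurable [OF g]
  have b: "gag g p \<le> 8 * L^4" for p
  proof -
    let ?q = "1 - cos (fst p - snd p)"
    have q: "0 \<le> ?q" "?q \<le> 2" by (rule one_minus_cos_bounds)+
    have "norm (g (fst p) - g (snd p)) ^ 4 = (norm (g (fst p) - g (snd p)) ^ 2)^2"
      by (simp flip: power_mult)
    also have "\<dots> \<le> (2 * L^2 * ?q)^2" by (intro power_mono chord_lip_sq [OF g]) simp
    also have "\<dots> = 4 * L^4 * ?q * ?q" by (simp add: power2_eq_square power4_eq_xxxx)
    also have "\<dots> \<le> 4 * L^4 * 2 * ?q" using q by (intro mult_right_mono mult_left_mono) auto
    finally have "norm (g (fst p) - g (snd p)) ^ 4 \<le> 8 * L^4 * ?q" by simp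
    moreover have "?q = 0 \<or> 0 < ?q" using q by linarith
    ultimately show ?thesis
      unfolding gag_def by (auto simp: divide_le_eq)
  qed
  have "integrable circ2 (gag g)"
    by (rule circ2.integrable_const_bound [of _ "8 * L^4"]) (use b gag_nonneg in \<open>auto simp: abs_of_nonneg\<close>)
  moreover have "integrable circ (\<lambda>x. norm (g x) ^ 4)"
    by (rule integrable_circ_bounded [of _ "L^4"]) (auto intro!: power_mono chord_lipD(1) [OF g])
  ultimately show ?thesis using chord_lip_periodic [OF g] by (simp add: W14_4_iff)
qed

text \<open>Where the denominator vanishes the quotient is \<open>0\<close>; periodicity makes the numerator vanish there
  too.\<close>

lemma norm_diff_pow4_le_gag:
  assumes "periodic_2pi u" "1 - cos (x - y) \<le> C"
  shows "norm (u x - u y) ^ 4 \<le> C * gag u (x, y)"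
proof (cases "1 - cos (x - y) = 0")
  case True
  then have "u x = u y" by (rule periodic_eq_of_cos [OF assms(1)])
  then show ?thesis by (simp add: gag_def)
next
  case False
  then have q: "0 < 1 - cos (x - y)" using one_minus_cos_bounds(1) [of "x - y"] by linarith
  then have "norm (u x - u y) ^ 4 = (1 - cos (x - y)) * gag u (x, y)" by (simp add: gag_def)
  also have "\<dots> \<le> C * gag u (x, y)" by (intro mult_right_mono assms gag_nonneg)
  finally show ?thesis .
qed

lemma integrable_diff_pow4:
  assumes u: "W14_4 u"
  shows "integrable circ2 (\<lambda>p. norm (u (fst p) - u (snd p)) ^ 4)"
proof (rule Bochner_Integration.integrable_bound)
  note [measurable] = W14_4D(2) [OF u]
  show "integrable circ2 (\<lambda>p. 2 * gag u p)" using W14_4D(4) [OF u] by simp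
  show "(\<lambda>p. norm (u (fst p) - u (snd p)) ^ 4) \<in> borel_measurable circ2" by measurable
  show "AE p in circ2. norm (norm (u (fst p) - u (snd p)) ^ 4) \<le> norm (2 * gag u p)"
    using norm_diff_pow4_le_gag [OF W14_4D(1) [OF u] one_minus_cos_bounds(2)] gag_nonneg
    by (auto simp: abs_mult)
qed

subsection \<open>A Poincare inequality on a partition\<close>

definition cell :: "nat \<Rightarrow> nat \<Rightarrow> real set" where
  "cell N j = {2*pi * real j / real N ..< 2*pi * real (Suc j) / real N}"

definition cell_integral :: "nat \<Rightarrow> nat \<Rightarrow> (real \<Rightarrow> complex) \<Rightarrow> complex" where
  "cell_integral N j u = (\<integral>x. indicator (cell N j) x *\<^sub>R u x \<partial>circ)"

lemma cell_measurable [measurable]: "cell N j \<in> sets borel"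
  by (simp add: cell_def)

lemma mem_cell_iff:
  assumes "N > 0"
  shows "x \<in> cell N j \<longleftrightarrow> \<lfloor>x * real N / (2*pi)\<rfloor> = int j"
  unfolding cell_def floor_eq_iff using assms by (simp add: field_simps)

lemma cell_subset: "j < N \<Longrightarrow> cell N j \<subseteq> {0..<2*pi}"
proof
  fix x assume j: "j < N" and x: "x \<in> cell N j"
  have "2*pi * real (Suc j) \<le> 2*pi * real N" using j by (intro mult_left_mono) auto
  then have "2*pi * real (Suc j) / real N \<le> 2*pi" using j by (simp add: field_simps)
  moreover have "0 \<le> 2*pi * real j / real N" by simp
  moreover have "2*pi * real j / real N \<le> x" "x < 2*pi * real (Suc j) / real N"
    using x by (simp_all only: cell_def atLeastLessThan_iff)
  ultimately show "x \<in> {0..<2*pi}" unfolding atLeastLessThan_iff by linarith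
qed

lemma measure_cell: "j < N \<Longrightarrow> measure circ (cell N j) = 2*pi / real N"
proof -
  assume j: "j < N"
  have "emeasure circ (cell N j) = (\<integral>\<^sup>+ x. indicator (cell N j) x * indicator period x \<partial>lborel)"
    by (subst nn_integral_indicator [symmetric], simp, rule nn_integral_circ) measurable
  also have "\<dots> = (\<integral>\<^sup>+ x. indicator (cell N j) x \<partial>lborel)"
    using cell_subset [OF j] by (intro nn_integral_cong) (auto simp: indicator_def)
  also have "\<dots> = ennreal (2*pi * real (Suc j) / real N - 2*pi * real j / real N)"
    unfolding cell_def using j by (subst nn_integral_indicator) (auto simp: divide_right_mono)
  also have "2*pi * real (Suc j) / real N - 2*pi * real j / real N = 2*pi / real N"
    by (simp add: distrib_left add_divide_distrib)
  finally show ?thesis by (simp add: measure_def)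
qed

lemma sum_indicator_cell:
  assumes "N > 0"
  shows "(\<Sum>j<N. indicator (cell N j) x :: real) = indicator {0..<2*pi} x"
proof (cases "x \<in> {0..<2*pi}")
  case True
  define k where "k = nat \<lfloor>x * real N / (2*pi)\<rfloor>"
  have "x * real N < 2*pi * real N" using True assms by (intro mult_strict_right_mono) auto
  then have "x * real N / (2*pi) < real N" by (simp add: field_simps)
  moreover have "0 \<le> x * real N / (2*pi)" using True by simp
  ultimately have k: "k < N" "\<lfloor>x * real N / (2*pi)\<rfloor> = int k" unfolding k_def by linarith+
  have "(\<Sum>j<N. indicator (cell N j) x :: real) = (\<Sum>j<N. if j = k then 1 else 0)"
    by (intro sum.cong refl) (auto simp: indicator_def mem_cell_iff [OF assms] k(2))
  also have "\<dots> = 1" using k(1) by simp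
  finally show ?thesis using True by simp
next
  case False
  then have "x \<notin> cell N j" if "j < N" for j using cell_subset [OF that] by blast
  then show ?thesis using False by (simp add: indicator_def)
qed

text \<open>Jensen's inequality for the fourth power, from its tangent line at the mean.\<close>

lemma jensen_pow4:
  fixes f :: "real \<Rightarrow> real"
  assumes [measurable]: "I \<in> sets borel" and f: "integrable circ f" "integrable circ (\<lambda>x. f x ^ 4)"
    and m: "measure circ I = m" "m > 0"
  shows "(\<integral>x. indicator I x * f x \<partial>circ) ^ 4 \<le> m ^ 3 * (\<integral>x. indicator I x * f x ^ 4 \<partial>circ)"
proof -
  define S where "S = (\<integral>x. indicator I x * f x \<partial>circ)"
  define t where "t = S / m"
  have i1: "integrable circ (\<lambda>x. indicator I x * f x)"
    using integrable_mult_indicator [OF _ f(1), of I] by simp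
  have i4: "integrable circ (\<lambda>x. indicator I x * f x ^ 4)"
    using integrable_mult_indicator [OF _ f(2), of I] by simp
  have i0: "integrable circ (\<lambda>x. indicator I x :: real)"
    by (rule integrable_circ_bounded [where B = 1]) (auto simp: indicator_def)
  have tangent: "t ^ 4 + 4 * t ^ 3 * (s - t) \<le> s ^ 4" for s :: real
  proof -
    have "s ^ 4 - (t ^ 4 + 4 * t ^ 3 * (s - t)) = (s - t)^2 * ((s + t)^2 + 2 * t^2)"
      by (simp add: power2_eq_square power3_eq_cube power4_eq_xxxx algebra_simps)
    moreover have "0 \<le> (s - t)^2 * ((s + t)^2 + 2 * t^2)" by simp
    ultimately show ?thesis by linarith
  qed
  have "(\<integral>x. (4 * t ^ 3) * (indicator I x * f x) + (-3 * t ^ 4) * indicator I x \<partial>circ)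
      \<le> (\<integral>x. indicator I x * f x ^ 4 \<partial>circ)"
  proof (rule integral_mono [OF _ i4])
    show "integrable circ (\<lambda>x. (4 * t ^ 3) * (indicator I x * f x) + (-3 * t ^ 4) * indicator I x)"
      using i1 i0 by (intro Bochner_Integration.integrable_add integrable_mult_right)
    show "(4 * t ^ 3) * (indicator I x * f x) + (-3 * t ^ 4) * indicator I x \<le> indicator I x * f x ^ 4" for x
      using tangent [of "f x"] by (auto simp: indicator_def algebra_simps power3_eq_cube power4_eq_xxxx)
  qed
  also have "(\<integral>x. (4 * t ^ 3) * (indicator I x * f x) + (-3 * t ^ 4) * indicator I x \<partial>circ)
      = (4 * t ^ 3) * S + (-3 * t ^ 4) * m"
    using i1 i0 m(1) unfolding S_def by (subst Bochner_Integration.integral_add) auto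
  also have "\<dots> = m * t ^ 4" using m(2) by (simp add: t_def power3_eq_cube power4_eq_xxxx field_simps)
  finally have "m ^ 3 * (m * t ^ 4) \<le> m ^ 3 * (\<integral>x. indicator I x * f x ^ 4 \<partial>circ)"
    using m(2) by (intro mult_left_mono) auto
  moreover have "m ^ 3 * (m * t ^ 4) = S ^ 4"
    using m(2) by (simp add: t_def power_divide power3_eq_cube power4_eq_xxxx)
  ultimately show ?thesis by (simp add: S_def)
qed

text \<open>On the cell \<open>d u(x) = \<integral> (u(x) - u(y)) dy + \<integral> u\<close>. The fourth power of the first integral is controlled
  by Jensen's inequality and \<open>1 - cos (x - y) \<le> d\<^sup>2 / 2\<close>; integrating over \<open>x\<close> gives the estimate.\<close>

lemma poincare_cell:
  assumes u: "W14_4 u" and j: "j < N"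
  defines "d \<equiv> 2*pi / real N"
  shows "d * (\<integral>x. indicator (cell N j) x * norm (u x) ^ 4 \<partial>circ) \<le>
      4 * d^2 * (\<integral>p. indicator (cell N j) (fst p) * indicator (cell N j) (snd p) * gag u p \<partial>circ2)
      + 8 / d^2 * norm (cell_integral N j u) ^ 4"
proof -
  note [measurable] = W14_4D(2) [OF u]
  define I where "I = cell N j"
  have [measurable]: "I \<in> sets borel" by (simp add: I_def)
  have d: "0 < d" using j by (simp add: d_def)
  have mI: "measure circ I = d" by (simp add: I_def d_def measure_cell [OF j])
  define A where "A = (\<integral>x. indicator I x *\<^sub>R u x \<partial>circ)"
  define G where "G x = (\<integral>y. indicator I y * norm (u x - u y) ^ 4 \<partial>circ)" for x
  have cancel: "d * X \<le> 4 * d^2 * Y + 8 / d^2 * T"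
    if "d ^ 4 * X \<le> 8 * d ^ 3 * (d^2 / 2 * Y) + 8 * T * d" for X Y T
  proof -
    have "d ^ 3 * (4 * d^2 * Y + 8 / d^2 * T) = 8 * d ^ 3 * (d^2 / 2 * Y) + 8 * T * d"
      using d by (simp add: distrib_left power2_eq_square power3_eq_cube)
    moreover have "d ^ 3 * (d * X) = d ^ 4 * X" by (simp add: power3_eq_cube power4_eq_xxxx)
    ultimately have "d ^ 3 * (d * X) \<le> d ^ 3 * (4 * d^2 * Y + 8 / d^2 * T)" using that by linarith
    then show ?thesis using d by (subst (asm) mult_le_cancel_left_pos) auto
  qed
  have i0: "integrable circ (indicator I :: real \<Rightarrow> real)"
    by (rule integrable_circ_bounded [where B = 1]) (auto simp: indicator_def)
  have iu: "integrable circ u" by (rule W14_4_integrable [OF u])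
  have iu4: "integrable circ (\<lambda>x. norm (u x) ^ 4)" by (rule W14_4D(3) [OF u])
  have id: "integrable circ (\<lambda>y. norm (u x - u y))" for x using iu by simp
  have id4: "integrable circ (\<lambda>y. norm (u x - u y) ^ 4)" for x
  proof (rule Bochner_Integration.integrable_bound)
    show "integrable circ (\<lambda>y. 8 * (norm (u x) ^ 4 + norm (u y) ^ 4))" using iu4 by simp
    show "AE y in circ. norm (norm (u x - u y) ^ 4) \<le> norm (8 * (norm (u x) ^ 4 + norm (u y) ^ 4))"
      using norm_add_pow4 [of "u x" "- u y" for y] by (auto intro!: AE_I2)
  qed measurable
  have pt: "d ^ 4 * norm (u x) ^ 4 \<le> 8 * d ^ 3 * G x + 8 * norm A ^ 4" for x
  proof -
    have iI: "integrable circ (\<lambda>y. indicator I y *\<^sub>R (u x - u y))" "integrable circ (\<lambda>y. indicator I y *\<^sub>R u y)"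
      using iu by (auto intro!: integrable_mult_indicator)
    have "(\<integral>y. indicator I y *\<^sub>R (u x - u y) \<partial>circ) + A = (\<integral>y. indicator I y *\<^sub>R u x \<partial>circ)"
      unfolding A_def by (subst Bochner_Integration.integral_add [OF iI, symmetric]) (simp add: scaleR_diff_right)
    also have "\<dots> = (\<integral>y. indicator I y \<partial>circ) *\<^sub>R u x"
      by (rule integral_scaleR_left)
        (auto intro!: integrable_circ_bounded [where B = 1] simp: indicator_def)
    also have "\<dots> = d *\<^sub>R u x" using mI by simp
    finally have e: "(\<integral>y. indicator I y *\<^sub>R (u x - u y) \<partial>circ) + A = d *\<^sub>R u x" .
    have "d ^ 4 * norm (u x) ^ 4 = norm (d *\<^sub>R u x) ^ 4" using d by (simp add: power_mult_distrib)
    also have "\<dots> \<le> 8 * (norm (\<integral>y. indicator I y *\<^sub>R (u x - u y) \<partial>circ) ^ 4 + norm A ^ 4)"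
      unfolding e [symmetric] by (rule norm_add_pow4)
    also have "norm (\<integral>y. indicator I y *\<^sub>R (u x - u y) \<partial>circ) ^ 4 \<le> (\<integral>y. indicator I y * norm (u x - u y) \<partial>circ) ^ 4"
      using integral_norm_bound [of circ "\<lambda>y. indicator I y *\<^sub>R (u x - u y)"] by (intro power_mono) auto
    also have "\<dots> \<le> d ^ 3 * G x"
      unfolding G_def by (rule jensen_pow4 [OF _ id id4 mI d]) simp
    finally show ?thesis by simp
  qed
  have i2: "integrable circ2 (\<lambda>(x, y). indicator I x * (indicator I y * norm (u x - u y) ^ 4))"
  proof (rule Bochner_Integration.integrable_bound [OF integrable_diff_pow4 [OF u]])
  qed (auto simp: indicator_def)
  have iG: "integrable circ (\<lambda>x. indicator I x * G x)"
    using circ2.integrable_fst [OF i2] by (simp add: G_def)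
  have G_le: "(\<integral>x. indicator I x * G x \<partial>circ) \<le> d^2 / 2 * (\<integral>p. indicator I (fst p) * indicator I (snd p) * gag u p \<partial>circ2)"
  proof -
    have "(\<integral>x. indicator I x * G x \<partial>circ) = (\<integral>p. (case p of (x, y) \<Rightarrow> indicator I x * (indicator I y * norm (u x - u y) ^ 4)) \<partial>circ2)"
      unfolding circ2.integral_fst [OF i2, symmetric] by (simp add: G_def)
    also have "\<dots> \<le> (\<integral>p. d^2 / 2 * (indicator I (fst p) * indicator I (snd p) * gag u p) \<partial>circ2)"
    proof (rule integral_mono [OF i2])
      show "integrable circ2 (\<lambda>p. d^2 / 2 * (indicator I (fst p) * indicator I (snd p) * gag u p))"
        by (intro integrable_mult_right, rule Bochner_Integration.integrable_bound [OF W14_4D(4) [OF u]])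
          (auto simp: indicator_def)
      fix p :: "real \<times> real"
      obtain x y where p: "p = (x, y)" by (cases p)
      show "(case p of (x, y) \<Rightarrow> indicator I x * (indicator I y * norm (u x - u y) ^ 4)) \<le>
          d^2 / 2 * (indicator I (fst p) * indicator I (snd p) * gag u p)"
      proof (cases "x \<in> I \<and> y \<in> I")
        case True
        have e: "2*pi * real (Suc j) / real N = 2*pi * real j / real N + d"
          by (simp add: d_def distrib_left add_divide_distrib)
        have "\<bar>x - y\<bar> \<le> d"
          using True e unfolding I_def cell_def atLeastLessThan_iff by linarith
        then have "(x - y)^2 \<le> d^2" by (metis abs_ge_zero power2_abs power_mono)
        moreover have "1 - cos (x - y) \<le> (x - y)^2 / 2"
          by (rule one_minus_cos_le)
        ultimately have q: "1 - cos (x - y) \<le> d^2 / 2" by simp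
        show ?thesis using norm_diff_pow4_le_gag [OF W14_4D(1) [OF u] q] True by (simp add: p)
      qed (auto simp: p)
    qed
    finally show ?thesis by (simp only: integral_mult_right_zero)
  qed
  have "d ^ 4 * (\<integral>x. indicator I x * norm (u x) ^ 4 \<partial>circ) = (\<integral>x. d ^ 4 * (indicator I x * norm (u x) ^ 4) \<partial>circ)"
    by simp
  also have "\<dots> \<le> (\<integral>x. 8 * d ^ 3 * (indicator I x * G x) + 8 * norm A ^ 4 * indicator I x \<partial>circ)"
  proof (rule integral_mono)
    show "integrable circ (\<lambda>x. d ^ 4 * (indicator I x * norm (u x) ^ 4))"
      using integrable_mult_indicator [OF _ iu4, of I] by simp
    show "integrable circ (\<lambda>x. 8 * d ^ 3 * (indicator I x * G x) + 8 * norm A ^ 4 * indicator I x)"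
      using iG i0 by (intro Bochner_Integration.integrable_add integrable_mult_right)
    show "d ^ 4 * (indicator I x * norm (u x) ^ 4) \<le> 8 * d ^ 3 * (indicator I x * G x) + 8 * norm A ^ 4 * indicator I x" for x
      using pt [of x] by (simp add: indicator_def)
  qed
  also have "\<dots> = 8 * d ^ 3 * (\<integral>x. indicator I x * G x \<partial>circ) + 8 * norm A ^ 4 * d"
    using mI iG i0 by (subst Bochner_Integration.integral_add) auto
  also have "\<dots> \<le> 8 * d ^ 3 * (d^2 / 2 * (\<integral>p. indicator I (fst p) * indicator I (snd p) * gag u p \<partial>circ2)) + 8 * norm A ^ 4 * d"
    using d by (intro add_mono mult_left_mono G_le) auto
  finally have "d * (\<integral>x. indicator I x * norm (u x) ^ 4 \<partial>circ) \<le>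
      4 * d^2 * (\<integral>p. indicator I (fst p) * indicator I (snd p) * gag u p \<partial>circ2) + 8 / d^2 * norm A ^ 4"
    by (rule cancel)
  then show ?thesis by (simp add: I_def A_def cell_integral_def)
qed

text \<open>The mean of \<open>u\<close> over a cell controls \<open>u\<close> there up to the oscillation of \<open>u\<close> on the cell, and
  the oscillation is controlled by the Gagliardo integral with a gain of the cell length.\<close>

lemma poincare:
  assumes u: "W14_4 u" and N: "N > 0"
  defines "d \<equiv> 2*pi / real N"
  shows "(\<integral>x. norm (u x) ^ 4 \<partial>circ) \<le> 4 * d * gagliardo u + 8 / d^3 * (\<Sum>j<N. norm (cell_integral N j u) ^ 4)"
proof -
  note [measurable] = W14_4D(2) [OF u]
  have d: "0 < d" using N by (simp add: d_def)
  let ?g = "\<lambda>j p. indicator (cell N j) (fst p) * indicator (cell N j) (snd p) * gag u p"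
  have ig: "integrable circ2 (?g j)" for j
    by (rule Bochner_Integration.integrable_bound [OF W14_4D(4) [OF u]]) (auto simp: indicator_def)
  have i4: "integrable circ (\<lambda>x. indicator (cell N j) x * norm (u x) ^ 4)" for j
    using integrable_mult_indicator [OF _ W14_4D(3) [OF u], of "cell N j"] by simp
  have "(\<integral>x. norm (u x) ^ 4 \<partial>circ) = (\<integral>x. (\<Sum>j<N. indicator (cell N j) x * norm (u x) ^ 4) \<partial>circ)"
  proof (rule integral_cong_AE)
    show "AE x in circ. norm (u x) ^ 4 = (\<Sum>j<N. indicator (cell N j) x * norm (u x) ^ 4)"
      using AE_circ_period [of 0]
      by eventually_elim (simp add: sum_indicator_cell [OF N] flip: sum_distrib_right)
  qed measurable
  also have "\<dots> = (\<Sum>j<N. \<integral>x. indicator (cell N j) x * norm (u x) ^ 4 \<partial>circ)"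
    by (rule Bochner_Integration.integral_sum [OF i4])
  finally have "d * (\<integral>x. norm (u x) ^ 4 \<partial>circ) = (\<Sum>j<N. d * (\<integral>x. indicator (cell N j) x * norm (u x) ^ 4 \<partial>circ))"
    by (simp add: sum_distrib_left)
  also have "\<dots> \<le> (\<Sum>j<N. 4 * d^2 * integral\<^sup>L circ2 (?g j) + 8 / d^2 * norm (cell_integral N j u) ^ 4)"
    unfolding d_def by (intro sum_mono poincare_cell [OF u]) simp
  also have "\<dots> = 4 * d^2 * (\<Sum>j<N. integral\<^sup>L circ2 (?g j)) + 8 / d^2 * (\<Sum>j<N. norm (cell_integral N j u) ^ 4)"
    by (simp add: sum.distrib sum_distrib_left)
  also have "(\<Sum>j<N. integral\<^sup>L circ2 (?g j)) = (\<integral>p. (\<Sum>j<N. ?g j p) \<partial>circ2)"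
    by (rule Bochner_Integration.integral_sum [OF ig, symmetric])
  also have "\<dots> \<le> gagliardo u"
    unfolding gagliardo_def
  proof (rule integral_mono)
    show "integrable circ2 (\<lambda>p. \<Sum>j<N. ?g j p)" by (intro Bochner_Integration.integrable_sum ig)
    fix p :: "real \<times> real"
    have "(\<Sum>j<N. ?g j p) \<le> (\<Sum>j<N. indicator (cell N j) (fst p) * gag u p)"
      by (intro sum_mono) (auto simp: indicator_def gag_nonneg)
    also have "\<dots> \<le> gag u p"
      unfolding sum_distrib_right [symmetric] sum_indicator_cell [OF N] by (auto simp: indicator_def gag_nonneg)
    finally show "(\<Sum>j<N. ?g j p) \<le> gag u p" .
  qed (rule W14_4D(4) [OF u])
  finally have "d * (\<integral>x. norm (u x) ^ 4 \<partial>circ) \<le> 4 * d^2 * gagliardo u + 8 / d^2 * (\<Sum>j<N. norm (cell_integral N j u) ^ 4)"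
    using d by simp
  also have "\<dots> = d * (4 * d * gagliardo u + 8 / d^3 * (\<Sum>j<N. norm (cell_integral N j u) ^ 4))"
    using d by (simp add: power2_eq_square power3_eq_cube field_simps)
  finally show ?thesis using d by (subst (asm) mult_le_cancel_left_pos) auto
qed

text \<open>Indicators of intervals are limits of Lipschitz functions, so all cell integrals vanish once
  the Fourier coefficients do.\<close>

lemma integral_interval_zero:
  assumes u: "integrable circ u" and zero: "\<And>k. fourier_coeff u k = 0" and ab: "0 \<le> a" "b \<le> 2*pi"
  shows "(\<integral>x. indicator {a..<b} x *\<^sub>R u x \<partial>circ) = 0"
proof -
  have [measurable]: "u \<in> borel_measurable borel" using u by blast
  define K where "K = cis ` (period - {a<..<b})"
  have "compact (period - {a<..<b})" by (intro compact_diff) auto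
  then have "compact K" unfolding K_def by (intro compact_continuous_image continuous_intros)
  then have K: "closed K" by (rule compact_imp_closed)
  have "0 \<in> period - {a<..<b}" using ab by simp
  then have K0: "K \<noteq> {}" unfolding K_def by blast
  define f where "f m x = complex_of_real (min 1 (real m * infdist (cis x) K))" for m x
  have lip: "chord_lip (1 + real m) (f m)" for m
    unfolding chord_lip_def
  proof (intro conjI allI)
    fix x y
    have nn: "0 \<le> infdist z K" for z by (rule infdist_nonneg)
    then have "norm (f m x) \<le> 1" by (auto simp: f_def simp del: of_real_mult)
    then show "norm (f m x) \<le> 1 + real m" by simp
    have i1: "infdist (cis x) K \<le> infdist (cis y) K + norm (cis x - cis y)"
      using infdist_triangle [of "cis x" K "cis y"] by (simp add: dist_norm)
    have i2: "infdist (cis y) K \<le> infdist (cis x) K + norm (cis x - cis y)"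
      using infdist_triangle [of "cis y" K "cis x"] by (simp add: dist_norm norm_minus_commute)
    have "\<bar>real m * infdist (cis x) K - real m * infdist (cis y) K\<bar> = real m * \<bar>infdist (cis x) K - infdist (cis y) K\<bar>"
      by (simp add: abs_mult flip: right_diff_distrib)
    also have "\<dots> \<le> real m * norm (cis x - cis y)" using i1 i2 by (intro mult_left_mono) auto
    finally have "\<bar>min 1 (real m * infdist (cis x) K) - min 1 (real m * infdist (cis y) K)\<bar> \<le> real m * norm (cis x - cis y)"
      by linarith
    also have "\<dots> \<le> (1 + real m) * norm (cis x - cis y)" by (intro mult_right_mono) auto
    finally show "norm (f m x - f m y) \<le> (1 + real m) * norm (cis x - cis y)"
      unfolding f_def by (simp only: of_real_diff [symmetric] norm_of_real)
  qed
  have [measurable]: "f m \<in> borel_measurable borel" for m by (rule chord_lip_measurable [OF lip])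
  have lim: "(\<lambda>m. f m x) \<longlonglongrightarrow> indicator {a..<b} x" if x: "x \<in> {0<..<2*pi} - {a}" for x
  proof (cases "x \<in> {a..<b}")
    case True
    have "cis x \<notin> K"
    proof
      assume "cis x \<in> K"
      then obtain y where y: "y \<in> period - {a<..<b}" "cis x = cis y" unfolding K_def by blast
      have "angle_mod x = angle_mod y" by (rule periodic_eq_of_cis [OF periodic_2pi_angle_mod y(2)])
      moreover have "angle_mod x = x" using x by (intro angle_mod_eq) auto
      moreover have "angle_mod y = (if y = 2*pi then 0 else y)"
      proof (cases "y = 2*pi")
        case False
        then show ?thesis using y(1) angle_mod_eq [of y] by simp
      qed (simp add: angle_mod_def)
      ultimately show False using y(1) True x by (auto split: if_splits)
    qed
    then have pos: "0 < infdist (cis x) K"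
      using infdist_pos_not_in_closed [OF K K0] by simp
    obtain M where M: "1 < real M * infdist (cis x) K" using reals_Archimedean3 [OF pos] by blast
    have "f m x = 1" if "m \<ge> M" for m
    proof -
      have "real M * infdist (cis x) K \<le> real m * infdist (cis x) K" using that pos by (intro mult_right_mono) auto
      then show ?thesis using M by (simp add: f_def min_def)
    qed
    then have "eventually (\<lambda>m. f m x = 1) sequentially" by (auto simp: eventually_sequentially)
    then show ?thesis using True by (simp add: tendsto_eventually)
  next
    case False
    then have "cis x \<in> K" using x unfolding K_def by (intro imageI) auto
    then have "f m x = 0" for m by (simp add: f_def infdist_zero)
    then show ?thesis using False by simp
  qed
  have "(\<lambda>m. \<integral>x. u x * f m x \<partial>circ) \<longlonglongrightarrow> (\<integral>x. u x * indicator {a..<b} x \<partial>circ)"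
  proof (rule integral_dominated_convergence [where w = "\<lambda>x. norm (u x)"])
    show "AE x in circ. (\<lambda>m. u x * f m x) \<longlonglongrightarrow> u x * indicator {a..<b} x"
      using AE_circ_period [of a] by eventually_elim (intro tendsto_intros lim)
    have "norm (f m x) \<le> 1" for m x using infdist_nonneg [of "cis x" K] by (auto simp: f_def simp del: of_real_mult)
    then show "AE x in circ. norm (u x * f m x) \<le> norm (u x)" for m
      by (auto simp: norm_mult intro!: AE_I2 mult_left_le)
  qed (use u in auto)
  moreover have "(\<integral>x. u x * f m x \<partial>circ) = 0" for m
    by (rule pairing_chord_lip_zero [OF u zero lip])
  ultimately have "(\<integral>x. u x * indicator {a..<b} x \<partial>circ) = 0" by (simp add: LIMSEQ_const_iff)
  moreover have "u x * indicator {a..<b} x = indicator {a..<b} x *\<^sub>R u x" for x by (simp add: indicator_def)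
  ultimately show ?thesis by simp
qed

text \<open>All cell integrals vanish, so the Poincare inequality bounds the integral of \<open>|u|\<^sup>4\<close> by the Gagliardo
  integral times an arbitrarily small cell length.\<close>

lemma fourier_complete:
  assumes u: "W14_4 u" and zero: "\<And>k. fourier_coeff u k = 0"
  shows "AE x in circ. u x = 0"
proof -
  let ?I = "\<integral>x. norm (u x) ^ 4 \<partial>circ"
  have bound: "?I \<le> 8 * pi * gagliardo u / real (Suc N)" for N
  proof -
    have "cell_integral (Suc N) j u = 0" if j: "j < Suc N" for j
    proof -
      have "2*pi * real (Suc j) \<le> 2*pi * real (Suc N)" using j by (intro mult_left_mono) auto
      then have "2*pi * real (Suc j) / real (Suc N) \<le> 2*pi" by (simp add: field_simps del: of_nat_Suc)
      then show ?thesis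
        unfolding cell_integral_def cell_def
        by (intro integral_interval_zero W14_4_integrable [OF u] zero) auto
    qed
    then show ?thesis using poincare [OF u, of "Suc N"] by simp
  qed
  have "(\<lambda>N. 8 * pi * gagliardo u / real (Suc N)) \<longlonglongrightarrow> 0"
    using LIMSEQ_Suc [OF lim_const_over_n [of "8 * pi * gagliardo u"]] by simp
  then have "?I \<le> 0" by (rule LIMSEQ_le_const) (use bound in auto)
  then have "?I = 0" by (simp add: order_antisym)
  then have "AE x in circ. norm (u x) ^ 4 = 0"
    by (subst (asm) integral_nonneg_eq_0_iff_AE) (use W14_4D(3) [OF u] in auto)
  then show ?thesis by simp
qed

section \<open>Compactness\<close>

text \<open>Continuity of a quartic or quadratic functional follows from its Young-type bounds
  \<open>\<eta> \<cdot> (bounded) + C(\<eta>) \<cdot> (small)\<close>, which take the place of the triangle inequality in \<open>L\<^sup>4\<close>.\<close>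

lemma tendsto_of_small_multiples:
  fixes F :: "nat \<Rightarrow> real"
  assumes bound: "\<And>\<eta> n. 0 < \<eta> \<Longrightarrow> \<bar>F n - l\<bar> \<le> \<eta> * B + C \<eta> * e n" and e: "e \<longlonglongrightarrow> 0"
  shows "F \<longlonglongrightarrow> l"
proof (rule LIMSEQ_I)
  fix r :: real assume r: "0 < r"
  define \<eta> where "\<eta> = r / (2 * (\<bar>B\<bar> + 1))"
  have \<eta>: "0 < \<eta>" using r by (simp add: \<eta>_def)
  have "\<eta> * B \<le> \<eta> * (\<bar>B\<bar> + 1)" using \<eta> by (intro mult_left_mono) auto
  also have "\<dots> = r / 2" by (simp add: \<eta>_def field_simps)
  finally have B: "\<eta> * B \<le> r / 2" .
  have "(\<lambda>n. C \<eta> * e n) \<longlonglongrightarrow> C \<eta> * 0" by (intro tendsto_intros e)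
  then have "eventually (\<lambda>n. C \<eta> * e n < r / 2) sequentially"
    using r by (intro order_tendstoD(2)) auto
  then obtain N where "\<And>n. n \<ge> N \<Longrightarrow> C \<eta> * e n < r / 2" by (auto simp: eventually_sequentially)
  then have "norm (F n - l) < r" if "n \<ge> N" for n
    using bound [OF \<eta>, of n] B that by fastforce
  then show "\<exists>N. \<forall>n\<ge>N. norm (F n - l) < r" by blast
qed

lemma norm_pow4_diff_le:
  fixes a b :: complex
  assumes \<eta>: "0 < \<eta>"
  shows "\<bar>norm a ^ 4 - norm b ^ 4\<bar> \<le> \<eta> * (norm a ^ 4 + norm b ^ 4) + 256 / \<eta>^3 * norm (a - b) ^ 4"
proof -
  define p q d M where "p = norm a" and "q = norm b" and "d = norm (a - b)" and "M = max (norm a) (norm b)"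
  have nn: "0 \<le> p" "0 \<le> q" "0 \<le> d" "0 \<le> M" "p \<le> M" "q \<le> M" by (auto simp: p_def q_def d_def M_def le_max_iff_disj)
  have pq: "\<bar>p - q\<bar> \<le> d" unfolding p_def q_def d_def by (rule norm_triangle_ineq3)
  have "p ^ 4 - q ^ 4 = (p - q) * ((p + q) * (p^2 + q^2))"
    by (simp add: power2_eq_square power4_eq_xxxx algebra_simps)
  then have "\<bar>p ^ 4 - q ^ 4\<bar> = \<bar>p - q\<bar> * ((p + q) * (p^2 + q^2))" using nn by (simp add: abs_mult)
  also have "\<dots> \<le> d * ((M + M) * (M^2 + M^2))"
    using nn by (intro mult_mono pq add_mono power_mono mult_nonneg_nonneg) auto
  also have "\<dots> = 4 * d * M ^ 3" by (simp add: power2_eq_square power3_eq_cube)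
  finally have 1: "\<bar>p ^ 4 - q ^ 4\<bar> \<le> 4 * d * M ^ 3" .
  have M4: "M ^ 4 \<le> p ^ 4 + q ^ 4" by (auto simp: M_def p_def q_def max_def)
  show ?thesis
  proof (cases "4 * d \<le> \<eta> * M")
    case True
    then have "4 * d * M ^ 3 \<le> \<eta> * M * M ^ 3" using nn by (intro mult_right_mono) auto
    also have "\<dots> = \<eta> * M ^ 4" by (simp add: power3_eq_cube power4_eq_xxxx)
    also have "\<dots> \<le> \<eta> * (p ^ 4 + q ^ 4)" using \<eta> M4 by (intro mult_left_mono) auto
    also have "\<dots> \<le> \<eta> * (p ^ 4 + q ^ 4) + 256 / \<eta>^3 * d ^ 4" using \<eta> nn by simp
    finally show ?thesis using 1 by (simp add: p_def q_def d_def)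
  next
    case False
    then have "M \<le> 4 * d / \<eta>" using \<eta> by (simp add: field_simps)
    then have "4 * d * M ^ 3 \<le> 4 * d * (4 * d / \<eta>) ^ 3" using nn by (intro mult_left_mono power_mono) auto
    also have "\<dots> = 256 / \<eta>^3 * d ^ 4"
      by (simp add: power_divide power_mult_distrib power3_eq_cube power4_eq_xxxx)
    also have "\<dots> \<le> \<eta> * (p ^ 4 + q ^ 4) + 256 / \<eta>^3 * d ^ 4" using \<eta> nn by simp
    finally show ?thesis using 1 by (simp add: p_def q_def d_def)
  qed
qed

lemma norm_sq_diff_le:
  fixes a b :: complex
  assumes \<eta>: "0 < \<eta>"
  shows "\<bar>norm a ^ 2 - norm b ^ 2\<bar> \<le> \<eta> * (norm a ^ 2 + norm b ^ 2) + 4 / \<eta> * norm (a - b) ^ 2"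
proof -
  define p q d M where "p = norm a" and "q = norm b" and "d = norm (a - b)" and "M = max (norm a) (norm b)"
  have nn: "0 \<le> p" "0 \<le> q" "0 \<le> d" "0 \<le> M" "p \<le> M" "q \<le> M" by (auto simp: p_def q_def d_def M_def le_max_iff_disj)
  have pq: "\<bar>p - q\<bar> \<le> d" unfolding p_def q_def d_def by (rule norm_triangle_ineq3)
  have "p ^ 2 - q ^ 2 = (p - q) * (p + q)"
    by (simp add: power2_eq_square algebra_simps)
  then have "\<bar>p ^ 2 - q ^ 2\<bar> = \<bar>p - q\<bar> * (p + q)" using nn by (simp add: abs_mult)
  also have "\<dots> \<le> d * (M + M)" using nn by (intro mult_mono pq add_mono) auto
  finally have 1: "\<bar>p ^ 2 - q ^ 2\<bar> \<le> 2 * d * M" by simp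
  have M2: "M ^ 2 \<le> p ^ 2 + q ^ 2" by (auto simp: M_def p_def q_def max_def)
  show ?thesis
  proof (cases "2 * d \<le> \<eta> * M")
    case True
    then have "2 * d * M \<le> \<eta> * M * M" using nn by (intro mult_right_mono) auto
    also have "\<dots> = \<eta> * M ^ 2" by (simp add: power2_eq_square)
    also have "\<dots> \<le> \<eta> * (p ^ 2 + q ^ 2)" using \<eta> M2 by (intro mult_left_mono) auto
    also have "\<dots> \<le> \<eta> * (p ^ 2 + q ^ 2) + 4 / \<eta> * d ^ 2" using \<eta> nn by simp
    finally show ?thesis using 1 by (simp add: p_def q_def d_def)
  next
    case False
    then have "M \<le> 2 * d / \<eta>" using \<eta> by (simp add: field_simps)
    then have "2 * d * M \<le> 2 * d * (2 * d / \<eta>)" using nn by (intro mult_left_mono) auto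
    also have "\<dots> = 4 / \<eta> * d ^ 2" by (simp add: power2_eq_square)
    also have "\<dots> \<le> \<eta> * (p ^ 2 + q ^ 2) + 4 / \<eta> * d ^ 2" using \<eta> nn by simp
    finally show ?thesis using 1 by (simp add: p_def q_def d_def)
  qed
qed

lemma power_le_pow4_scaled:
  fixes d \<theta> :: real
  assumes "0 \<le> d" "0 < \<theta>"
  shows "d \<le> \<theta> + d ^ 4 / \<theta> ^ 3" "d ^ 2 \<le> \<theta> + d ^ 4 / \<theta>"
proof -
  show "d \<le> \<theta> + d ^ 4 / \<theta> ^ 3"
  proof (cases "d \<le> \<theta>")
    case True
    then show ?thesis using assms by (simp add: add_increasing2)
  next
    case False
    then have "d * \<theta> ^ 3 \<le> d * d ^ 3" using assms by (intro mult_left_mono power_mono) auto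
    then have "d \<le> d ^ 4 / \<theta> ^ 3" using assms by (simp add: pos_le_divide_eq power3_eq_cube power4_eq_xxxx)
    then show ?thesis using assms by simp
  qed
  show "d ^ 2 \<le> \<theta> + d ^ 4 / \<theta>"
  proof (cases "d ^ 2 \<le> \<theta>")
    case True
    then show ?thesis using assms by (simp add: add_increasing2)
  next
    case False
    then have "d^2 * \<theta> \<le> d^2 * d^2" using assms by (intro mult_left_mono) auto
    then have "d^2 \<le> d ^ 4 / \<theta>" using assms by (simp add: pos_le_divide_eq power2_eq_square power4_eq_xxxx)
    then show ?thesis using assms by simp
  qed
qed

context
  fixes w :: "nat \<Rightarrow> real \<Rightarrow> complex" and \<Phi> :: "real \<Rightarrow> complex" and B :: real
  assumes w: "\<And>n. W14_4 (w n)" and \<Phi>: "W14_4 \<Phi>"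
    and B: "\<And>n. (\<integral>x. norm (w n x) ^ 4 \<partial>circ) \<le> B"
    and conv: "(\<lambda>n. \<integral>x. norm (w n x - \<Phi> x) ^ 4 \<partial>circ) \<longlonglongrightarrow> 0"
begin

private lemma diff: "W14_4 (\<lambda>x. w n x - \<Phi> x)"
  by (rule W14_4_diff [OF w \<Phi>])

lemma conv_L4: "(\<lambda>n. \<integral>x. norm (w n x) ^ 4 \<partial>circ) \<longlonglongrightarrow> (\<integral>x. norm (\<Phi> x) ^ 4 \<partial>circ)"
proof (rule tendsto_of_small_multiples [OF _ conv])
  fix \<eta> :: real and n assume \<eta>: "0 < \<eta>"
  note i = W14_4D(3) [OF w] W14_4D(3) [OF \<Phi>] W14_4D(3) [OF diff]
  have "\<bar>(\<integral>x. norm (w n x) ^ 4 \<partial>circ) - (\<integral>x. norm (\<Phi> x) ^ 4 \<partial>circ)\<bar>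
      = norm (\<integral>x. norm (w n x) ^ 4 - norm (\<Phi> x) ^ 4 \<partial>circ)"
    using i by simp
  also have "\<dots> \<le> (\<integral>x. \<eta> * (norm (w n x) ^ 4 + norm (\<Phi> x) ^ 4) + 256 / \<eta>^3 * norm (w n x - \<Phi> x) ^ 4 \<partial>circ)"
    by (rule Bochner_Integration.integral_norm_bound_integral)
      (use i norm_pow4_diff_le [OF \<eta>] in auto)
  also have "\<dots> = \<eta> * ((\<integral>x. norm (w n x) ^ 4 \<partial>circ) + (\<integral>x. norm (\<Phi> x) ^ 4 \<partial>circ))
      + 256 / \<eta>^3 * (\<integral>x. norm (w n x - \<Phi> x) ^ 4 \<partial>circ)"
    using i by simp
  also have "\<dots> \<le> \<eta> * (B + (\<integral>x. norm (\<Phi> x) ^ 4 \<partial>circ)) + 256 / \<eta>^3 * (\<integral>x. norm (w n x - \<Phi> x) ^ 4 \<partial>circ)"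
    using \<eta> B by (intro add_mono mult_left_mono) auto
  finally show "\<bar>(\<integral>x. norm (w n x) ^ 4 \<partial>circ) - (\<integral>x. norm (\<Phi> x) ^ 4 \<partial>circ)\<bar>
      \<le> \<eta> * (B + (\<integral>x. norm (\<Phi> x) ^ 4 \<partial>circ)) + 256 / \<eta>^3 * (\<integral>x. norm (w n x - \<Phi> x) ^ 4 \<partial>circ)" .
qed

lemma conv_diff_sq: "(\<lambda>n. \<integral>x. norm (w n x - \<Phi> x) ^ 2 \<partial>circ) \<longlonglongrightarrow> 0"
proof (rule tendsto_of_small_multiples [OF _ conv])
  fix \<eta> :: real and n assume \<eta>: "0 < \<eta>"
  have "(\<integral>x. norm (w n x - \<Phi> x) ^ 2 \<partial>circ) \<le> (\<integral>x. \<eta> + norm (w n x - \<Phi> x) ^ 4 / \<eta> \<partial>circ)"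
    using W14_4_integrable_power [OF diff, of 2] W14_4D(3) [OF diff] power_le_pow4_scaled(2) [OF _ \<eta>]
    by (intro integral_mono) auto
  also have "\<dots> = \<eta> * (2*pi) + (1 / \<eta>) * (\<integral>x. norm (w n x - \<Phi> x) ^ 4 \<partial>circ)"
    using W14_4D(3) [OF diff] by simp
  finally show "\<bar>(\<integral>x. norm (w n x - \<Phi> x) ^ 2 \<partial>circ) - 0\<bar> \<le>
      \<eta> * (2*pi) + (1 / \<eta>) * (\<integral>x. norm (w n x - \<Phi> x) ^ 4 \<partial>circ)"
    by simp
qed

lemma L2_bound: "(\<integral>x. norm (w n x) ^ 2 \<partial>circ) \<le> 2*pi + B"
proof -
  have "(\<integral>x. norm (w n x) ^ 2 \<partial>circ) \<le> (\<integral>x. 1 + norm (w n x) ^ 4 \<partial>circ)"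
    using W14_4_integrable_power [OF w, of 2] W14_4D(3) [OF w] power_le_1_plus_power4 [of _ 2]
    by (intro integral_mono) auto
  also have "\<dots> \<le> 2*pi + B" using W14_4D(3) [OF w] B [of n] by simp
  finally show ?thesis .
qed

lemma conv_L2: "(\<lambda>n. \<integral>x. norm (w n x) ^ 2 \<partial>circ) \<longlonglongrightarrow> (\<integral>x. norm (\<Phi> x) ^ 2 \<partial>circ)"
proof (rule tendsto_of_small_multiples [OF _ conv_diff_sq])
  fix \<eta> :: real and n assume \<eta>: "0 < \<eta>"
  have i: "integrable circ (\<lambda>x. norm (w n x) ^ 2)" "integrable circ (\<lambda>x. norm (\<Phi> x) ^ 2)"
      "integrable circ (\<lambda>x. norm (w n x - \<Phi> x) ^ 2)"
    using W14_4_integrable_power [of _ 2] w \<Phi> diff by auto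
  have "\<bar>(\<integral>x. norm (w n x) ^ 2 \<partial>circ) - (\<integral>x. norm (\<Phi> x) ^ 2 \<partial>circ)\<bar>
      = norm (\<integral>x. norm (w n x) ^ 2 - norm (\<Phi> x) ^ 2 \<partial>circ)"
    using i by simp
  also have "\<dots> \<le> (\<integral>x. \<eta> * (norm (w n x) ^ 2 + norm (\<Phi> x) ^ 2) + 4 / \<eta> * norm (w n x - \<Phi> x) ^ 2 \<partial>circ)"
    by (rule Bochner_Integration.integral_norm_bound_integral)
      (use i norm_sq_diff_le [OF \<eta>] in auto)
  also have "\<dots> = \<eta> * ((\<integral>x. norm (w n x) ^ 2 \<partial>circ) + (\<integral>x. norm (\<Phi> x) ^ 2 \<partial>circ))
      + 4 / \<eta> * (\<integral>x. norm (w n x - \<Phi> x) ^ 2 \<partial>circ)"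
    using i by simp
  also have "\<dots> \<le> \<eta> * (2*pi + B + (\<integral>x. norm (\<Phi> x) ^ 2 \<partial>circ)) + 4 / \<eta> * (\<integral>x. norm (w n x - \<Phi> x) ^ 2 \<partial>circ)"
    using \<eta> L2_bound by (intro add_mono mult_left_mono) auto
  finally show "\<bar>(\<integral>x. norm (w n x) ^ 2 \<partial>circ) - (\<integral>x. norm (\<Phi> x) ^ 2 \<partial>circ)\<bar>
      \<le> \<eta> * (2*pi + B + (\<integral>x. norm (\<Phi> x) ^ 2 \<partial>circ)) + 4 / \<eta> * (\<integral>x. norm (w n x - \<Phi> x) ^ 2 \<partial>circ)" .
qed

lemma fourier_coeff_diff:
  "fourier_coeff (\<lambda>x. w n x - \<Phi> x) k = fourier_coeff (w n) k - fourier_coeff \<Phi> k"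
  using fourier_coeff_lincomb [OF W14_4_integrable [OF w] W14_4_integrable [OF \<Phi>], of n "-1" k] by simp

lemma conv_fourier_coeff: "(\<lambda>n. fourier_coeff (w n) k) \<longlonglongrightarrow> fourier_coeff \<Phi> k"
proof -
  have b: "norm (fourier_coeff (w n) k - fourier_coeff \<Phi> k) ^ 2 \<le> (\<integral>x. norm (w n x - \<Phi> x) ^ 2 \<partial>circ)" for n
  proof -
    have "2*pi * norm (fourier_coeff (w n) k - fourier_coeff \<Phi> k) ^ 2 \<le> (\<integral>x. norm (w n x - \<Phi> x) ^ 2 \<partial>circ)"
      using bessel [of "{k}" "\<lambda>x. w n x - \<Phi> x"] W14_4_integrable_power [OF diff, of 2] W14_4D(2) [OF diff]
      by (simp add: fourier_coeff_diff)
    moreover have "1 * norm (fourier_coeff (w n) k - fourier_coeff \<Phi> k) ^ 2 \<le> 2*pi * norm (fourier_coeff (w n) k - fourier_coeff \<Phi> k) ^ 2"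
      using pi_gt3 by (intro mult_right_mono) auto
    ultimately show ?thesis by simp
  qed
  have "(\<lambda>n. norm (fourier_coeff (w n) k - fourier_coeff \<Phi> k) ^ 2) \<longlonglongrightarrow> 0"
    by (rule tendsto_sandwich [OF _ _ tendsto_const conv_diff_sq]) (use b in auto)
  then have "(\<lambda>n. sqrt (norm (fourier_coeff (w n) k - fourier_coeff \<Phi> k) ^ 2)) \<longlonglongrightarrow> sqrt 0"
    by (rule tendsto_real_sqrt)
  then show ?thesis by (simp add: tendsto_norm_zero_iff LIM_zero_iff)
qed

end

lemma pos_coeff_sq_summable:
  assumes "W14_4 u"
  shows "summable (\<lambda>n. norm (pos_coeff u n) ^ 2)"
    and "(\<Sum>n. norm (pos_coeff u n) ^ 2) \<le> (\<integral>x. norm (u x) ^ 2 \<partial>circ) / (2*pi)"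
proof -
  have inj: "inj (\<lambda>n. int (Suc n))" by (simp add: inj_def)
  note b = bessel_summable [OF inj W14_4D(2) [OF assms] W14_4_integrable_power [OF assms, of 2, simplified]]
  show "summable (\<lambda>n. norm (pos_coeff u n) ^ 2)" by (rule b)
  show "(\<Sum>n. norm (pos_coeff u n) ^ 2) \<le> (\<integral>x. norm (u x) ^ 2 \<partial>circ) / (2*pi)"
    using b(2) by (simp add: field_simps)
qed

lemma summable_weighted:
  fixes a :: "nat \<Rightarrow> real"
  assumes "summable a" "\<And>n. 0 \<le> a n"
  shows "summable (\<lambda>n. a n / real (Suc n))" "(\<Sum>n. a n / real (Suc n)) \<le> (\<Sum>n. a n)"
proof -
  have le: "a n / real (Suc n) \<le> a n" for n
    using assms(2) [of n] by (simp add: divide_le_eq mult_le_cancel_left1)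
  show s: "summable (\<lambda>n. a n / real (Suc n))"
    by (rule summable_comparison_test' [OF assms(1)]) (use le assms(2) in auto)
  show "(\<Sum>n. a n / real (Suc n)) \<le> (\<Sum>n. a n)" by (rule suminf_le [OF le s assms(1)])
qed

lemma mass_summable:
  assumes "W14_4 u"
  shows "summable (\<lambda>n. norm (pos_coeff u n) ^ 2 / real (Suc n))"
    and "mass u \<le> (\<integral>x. norm (u x) ^ 2 \<partial>circ) / (2*pi)"
  using summable_weighted [OF pos_coeff_sq_summable(1) [OF assms]] pos_coeff_sq_summable(2) [OF assms]
  by (auto simp: mass_def)

text \<open>The mass is a quadratic form dominated by the momentum, hence continuous along sequences
  that converge in square mean.\<close>

lemma conv_mass:
  assumes w: "\<And>n. W14_4 (w n)" and \<Phi>: "W14_4 \<Phi>"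
    and B: "\<And>n. (\<integral>x. norm (w n x) ^ 4 \<partial>circ) \<le> B"
    and conv: "(\<lambda>n. \<integral>x. norm (w n x - \<Phi> x) ^ 4 \<partial>circ) \<longlonglongrightarrow> 0"
  shows "(\<lambda>n. mass (w n)) \<longlonglongrightarrow> mass \<Phi>"
proof (rule tendsto_of_small_multiples [OF _ conv_diff_sq [OF assms]])
  fix \<eta> :: real and n assume \<eta>: "0 < \<eta>"
  let ?M = "2*pi + B" and ?P = "\<integral>x. norm (\<Phi> x) ^ 2 \<partial>circ" and ?D = "\<integral>x. norm (w n x - \<Phi> x) ^ 2 \<partial>circ"
  note d = W14_4_diff(1) [OF w \<Phi>, of n]
  define a b c where "a k = norm (pos_coeff (w n) k) ^ 2 / real (Suc k)"
    and "b k = norm (pos_coeff \<Phi> k) ^ 2 / real (Suc k)"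
    and "c k = norm (pos_coeff (\<lambda>x. w n x - \<Phi> x) k) ^ 2 / real (Suc k)" for k
  have m: "suminf a = mass (w n)" "suminf b = mass \<Phi>" "suminf c = mass (\<lambda>x. w n x - \<Phi> x)"
    unfolding mass_def a_def [abs_def] b_def [abs_def] c_def [abs_def] by (rule refl)+
  have s: "summable a" "summable b" "summable c"
    unfolding a_def [abs_def] b_def [abs_def] c_def [abs_def] by (rule mass_summable(1) w \<Phi> d)+
  have "\<bar>a k - b k\<bar> \<le> \<eta> * (a k + b k) + 4 / \<eta> * c k" for k
    using divide_right_mono [OF norm_sq_diff_le [OF \<eta>, of "pos_coeff (w n) k" "pos_coeff \<Phi> k"], of "real (Suc k)"]
    unfolding a_def b_def c_def fourier_coeff_diff [OF assms]
    by (simp add: add_divide_distrib abs_divide distrib_left flip: diff_divide_distrib)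
  then have "norm (\<Sum>k. a k - b k) \<le> (\<Sum>k. \<eta> * (a k + b k) + 4 / \<eta> * c k)"
    by (intro norm_suminf_le summable_add summable_mult s) auto
  also have "\<dots> = \<eta> * (suminf a + suminf b) + 4 / \<eta> * suminf c"
    by (intro sums_unique [symmetric] sums_add sums_mult summable_sums s)
  also have "(\<Sum>k. a k - b k) = suminf a - suminf b" using s by (simp add: suminf_diff)
  finally have "\<bar>mass (w n) - mass \<Phi>\<bar> \<le> \<eta> * (mass (w n) + mass \<Phi>) + 4 / \<eta> * mass (\<lambda>x. w n x - \<Phi> x)"
    unfolding m real_norm_def .
  also have "\<dots> \<le> \<eta> * (?M / (2*pi) + ?P / (2*pi)) + 4 / \<eta> * (?D / (2*pi))"
  proof (intro add_mono mult_left_mono)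
    show "mass (w n) \<le> ?M / (2*pi)"
      using mass_summable(2) [OF w, of n] L2_bound [OF assms, of n] divide_right_mono [of _ ?M "2*pi"]
      by (meson order_trans pi_ge_zero mult_nonneg_nonneg zero_le_numeral)
  qed (use \<eta> mass_summable(2) \<Phi> d in auto)
  finally show "\<bar>mass (w n) - mass \<Phi>\<bar> \<le> \<eta> * (?M / (2*pi) + ?P / (2*pi)) + 4 / \<eta> / (2*pi) * ?D"
    by simp
qed

subsection \<open>Extraction of convergent subsequences\<close>

lemma fatou_bound:
  fixes f :: "nat \<Rightarrow> 'a \<Rightarrow> real"
  assumes i: "\<And>n. integrable M (f n)" and nn: "\<And>n x. 0 \<le> f n x" and [measurable]: "g \<in> borel_measurable M"
    and lim: "AE x in M. (\<lambda>n. f n x) \<longlonglongrightarrow> g x"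
    and C: "eventually (\<lambda>n. integral\<^sup>L M (f n) \<le> C) sequentially"
  shows "integrable M g" "integral\<^sup>L M g \<le> C"
proof -
  have [measurable]: "f n \<in> borel_measurable M" for n using i by auto
  have g0: "AE x in M. 0 \<le> g x"
    using lim by eventually_elim (rule LIMSEQ_le_const, auto simp: nn)
  obtain n where "integral\<^sup>L M (f n) \<le> C" using eventually_happens [OF C] by auto
  moreover have "0 \<le> integral\<^sup>L M (f n)" by (rule integral_nonneg_AE) (simp add: nn)
  ultimately have C0: "0 \<le> C" by linarith
  have "(\<integral>\<^sup>+ x. ennreal (g x) \<partial>M) = (\<integral>\<^sup>+ x. liminf (\<lambda>n. ennreal (f n x)) \<partial>M)"
  proof (rule nn_integral_cong_AE)
    show "AE x in M. ennreal (g x) = liminf (\<lambda>n. ennreal (f n x))"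
      using lim by eventually_elim (rule lim_imp_Liminf [symmetric], auto intro: tendsto_ennrealI)
  qed
  also have "\<dots> \<le> liminf (\<lambda>n. \<integral>\<^sup>+ x. ennreal (f n x) \<partial>M)" by (rule nn_integral_liminf) measurable
  also have "\<dots> \<le> ennreal C"
  proof (rule Liminf_le)
    show "eventually (\<lambda>n. (\<integral>\<^sup>+ x. ennreal (f n x) \<partial>M) \<le> ennreal C) sequentially"
      using C by eventually_elim (subst nn_integral_eq_integral, auto simp: i nn ennreal_leI)
  qed simp
  finally have le: "(\<integral>\<^sup>+ x. ennreal (g x) \<partial>M) \<le> ennreal C" .
  show ig: "integrable M g"
    by (rule integrableI_nonneg) (use g0 le in \<open>auto simp: top.not_eq_extremum intro: le_less_trans\<close>)
  have "ennreal (integral\<^sup>L M g) \<le> ennreal C"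
    using le nn_integral_eq_integral [OF ig g0] by simp
  then show "integral\<^sup>L M g \<le> C" using C0 by (simp add: ennreal_le_iff)
qed

lemma AE_summable_of_integrals:
  fixes f :: "nat \<Rightarrow> 'a \<Rightarrow> 'b::{banach, second_countable_topology}"
  assumes i: "\<And>n. integrable M (f n)" and s: "summable (\<lambda>n. \<integral>x. norm (f n x) \<partial>M)"
  shows "AE x in M. summable (\<lambda>n. norm (f n x))"
proof -
  have [measurable]: "f n \<in> borel_measurable M" for n using i by auto
  have "(\<integral>\<^sup>+ x. (\<Sum>n. ennreal (norm (f n x))) \<partial>M) = (\<Sum>n. \<integral>\<^sup>+ x. ennreal (norm (f n x)) \<partial>M)"
    by (rule nn_integral_suminf) measurable
  also have "\<dots> = (\<Sum>n. ennreal (\<integral>x. norm (f n x) \<partial>M))"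
    using i by (intro suminf_cong nn_integral_eq_integral) auto
  also have "\<dots> = ennreal (\<Sum>n. \<integral>x. norm (f n x) \<partial>M)"
    by (rule suminf_ennreal2 [OF _ s]) (auto intro: integral_nonneg_AE)
  finally have "AE x in M. (\<Sum>n. ennreal (norm (f n x))) \<noteq> \<infinity>"
    by (intro nn_integral_PInf_AE) auto
  then show ?thesis by eventually_elim (rule summable_suminf_not_top, auto)
qed

lemma AE_circ2_both:
  assumes "AE x in circ. Q x"
  shows "AE p in circ2. Q (fst p) \<and> Q (snd p)"
proof -
  obtain N where N: "\<And>x. x \<notin> N \<Longrightarrow> Q x" "N \<in> null_sets circ"
    using assms by (auto simp: eventually_ae_filter)
  have [measurable]: "N \<in> sets borel" using N(2) by auto
  have "AE x in circ. x \<notin> N" by (rule AE_not_in [OF N(2)])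
  then have "AE x in circ. AE y in circ. x \<notin> N \<and> y \<notin> N" by auto
  then have "AE p in circ2. fst p \<notin> N \<and> snd p \<notin> N" by (intro AE_circ2) auto
  then show ?thesis by eventually_elim (use N in auto)
qed

lemma cell_integral_diff:
  assumes "integrable circ u" "integrable circ v"
  shows "cell_integral N j (\<lambda>x. u x - v x) = cell_integral N j u - cell_integral N j v"
  unfolding cell_integral_def scaleR_diff_right
  using assms by (intro Bochner_Integration.integral_diff integrable_mult_indicator) auto

lemma norm_cell_integral_le:
  assumes "integrable circ u"
  shows "norm (cell_integral N j u) \<le> (\<integral>x. norm (u x) \<partial>circ)"
  unfolding cell_integral_def
proof (rule Bochner_Integration.integral_norm_bound_integral)
  show "integrable circ (\<lambda>x. indicator (cell N j) x *\<^sub>R u x)"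
    using assms by (intro integrable_mult_indicator) auto
qed (use assms in \<open>auto simp: indicator_def\<close>)


text \<open>A bound on the Gagliardo integrals makes the oscillation inside the cells of a fine partition
  uniformly small, so the convergence of its finitely many cell integrals controls the whole
  \<open>L\<^sup>4\<close> distance.\<close>

lemma L4_cauchy_of_cells:
  assumes v: "\<And>n. W14_4 (v n)" and G: "\<And>n. gagliardo (v n) \<le> G"
    and cells: "\<And>N j. convergent (\<lambda>n. cell_integral N j (v n))" and \<epsilon>: "0 < \<epsilon>"
  shows "\<exists>n0. \<forall>m\<ge>n0. \<forall>n\<ge>n0. (\<integral>x. norm (v m x - v n x) ^ 4 \<partial>circ) \<le> \<epsilon>"
proof -
  have G0: "0 \<le> G" using gagliardo_nonneg [of "v 0"] G [of 0] by linarith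
  obtain N :: nat where N: "256 * pi * G / \<epsilon> + 1 < real N" using reals_Archimedean2 by blast
  moreover have "0 \<le> 256 * pi * G / \<epsilon>" using G0 \<epsilon> by simp
  ultimately have N0: "N > 0" by (intro Nat.gr0I) auto
  define d where "d = 2*pi / real N"
  have d: "0 < d" using N0 by (simp add: d_def)
  have "256 * pi * G / \<epsilon> \<le> real N" using N by simp
  then have small: "4 * d * (16 * G) \<le> \<epsilon> / 2"
    using \<epsilon> N0 by (simp add: d_def field_simps)
  obtain A where A: "\<And>j. (\<lambda>n. cell_integral N j (v n)) \<longlonglongrightarrow> A j"
    using cells unfolding convergent_def by metis
  \<comment> \<open>Chosen so that the \<open>N\<close> terms \<open>(2\<theta>)\<^sup>4 \<le> 16\<theta>\<close>, weighted by \<open>8/d\<^sup>3\<close>, add up to at most \<open>\<epsilon>/2\<close>.\<close>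
  define \<theta> where "\<theta> = min 1 (\<epsilon> * d^3 / (256 * real N))"
  have \<theta>: "0 < \<theta>" "\<theta> \<le> 1" "\<theta> \<le> \<epsilon> * d^3 / (256 * real N)"
    using \<epsilon> d N0 by (auto simp: \<theta>_def)
  have "\<forall>j\<in>{..<N}. eventually (\<lambda>n. norm (cell_integral N j (v n) - A j) < \<theta>) sequentially"
    using A \<theta>(1) by (auto simp: tendsto_iff dist_norm)
  then have "eventually (\<lambda>n. \<forall>j\<in>{..<N}. norm (cell_integral N j (v n) - A j) < \<theta>) sequentially"
    by (simp add: eventually_ball_finite)
  then obtain n0 where n0: "\<And>n j. n \<ge> n0 \<Longrightarrow> j < N \<Longrightarrow> norm (cell_integral N j (v n) - A j) < \<theta>"
    by (auto simp: eventually_sequentially)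
  have "(\<integral>x. norm (v m x - v n x) ^ 4 \<partial>circ) \<le> \<epsilon>" if mn: "m \<ge> n0" "n \<ge> n0" for m n
  proof -
    note w = W14_4_diff [OF v v, of m n]
    have "gagliardo (\<lambda>x. v m x - v n x) \<le> 8 * (G + G)"
      by (rule order_trans [OF w(2)]) (intro mult_left_mono add_mono G, simp)
    then have "4 * d * gagliardo (\<lambda>x. v m x - v n x) \<le> 4 * d * (8 * (G + G))" using d by (intro mult_left_mono) auto
    moreover have "8 * (G + G) = 16 * G" by simp
    ultimately have 1: "4 * d * gagliardo (\<lambda>x. v m x - v n x) \<le> \<epsilon> / 2"
      using small by (simp only: order_trans)
    have "norm (cell_integral N j (\<lambda>x. v m x - v n x)) ^ 4 \<le> 16 * \<theta>" if j: "j < N" for j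
    proof -
      have "cell_integral N j (\<lambda>x. v m x - v n x) = (cell_integral N j (v m) - A j) - (cell_integral N j (v n) - A j)"
        by (simp add: cell_integral_diff W14_4_integrable v)
      moreover have "norm ((cell_integral N j (v m) - A j) - (cell_integral N j (v n) - A j)) \<le> 2 * \<theta>"
        using n0 [OF mn(1) j] n0 [OF mn(2) j] norm_triangle_ineq4 [of "cell_integral N j (v m) - A j" "cell_integral N j (v n) - A j"]
        by linarith
      ultimately have "norm (cell_integral N j (\<lambda>x. v m x - v n x)) ^ 4 \<le> (2 * \<theta>) ^ 4"
        by (simp only: power_mono norm_ge_zero)
      also have "\<dots> = 16 * (\<theta> * \<theta> ^ 3)" by (simp add: power_mult_distrib power3_eq_cube power4_eq_xxxx)
      also have "\<dots> \<le> 16 * (\<theta> * 1)" using \<theta> by (intro mult_left_mono power_le_one) auto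
      finally show ?thesis by simp
    qed
    then have "(\<Sum>j<N. norm (cell_integral N j (\<lambda>x. v m x - v n x)) ^ 4) \<le> (\<Sum>j<N. 16 * \<theta>)"
      by (intro sum_mono) auto
    also have "\<dots> = real N * (16 * \<theta>)" by simp
    also have "\<dots> \<le> real N * (16 * (\<epsilon> * d^3 / (256 * real N)))"
      by (intro mult_left_mono \<theta>(3)) auto
    also have "\<dots> = d^3 / 8 * (\<epsilon> / 2)" using N0 by simp
    finally have "8 / d^3 * (\<Sum>j<N. norm (cell_integral N j (\<lambda>x. v m x - v n x)) ^ 4) \<le> 8 / d^3 * (d^3 / 8 * (\<epsilon> / 2))"
      using d by (intro mult_left_mono) auto
    then have 2: "8 / d^3 * (\<Sum>j<N. norm (cell_integral N j (\<lambda>x. v m x - v n x)) ^ 4) \<le> \<epsilon> / 2"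
      using d by simp
    show ?thesis
      using order_trans [OF poincare [OF w(1) N0, folded d_def] add_mono [OF 1 2]] by simp
  qed
  then show ?thesis by blast
qed

lemma fast_subsequence:
  assumes "\<And>\<epsilon>. 0 < \<epsilon> \<Longrightarrow> \<exists>n0. \<forall>m\<ge>n0. \<forall>n\<ge>n0. E m n \<le> (\<epsilon>::real)"
  obtains r :: "nat \<Rightarrow> nat" where "strict_mono r" "\<And>n m. n \<le> m \<Longrightarrow> E (r n) (r m) \<le> (1/16) ^ n"
proof -
  have "\<forall>k. \<exists>n0. \<forall>m\<ge>n0. \<forall>n\<ge>n0. E m n \<le> (1/16) ^ k" using assms by simp
  then obtain n0 where n0: "\<And>k m n. m \<ge> n0 k \<Longrightarrow> n \<ge> n0 k \<Longrightarrow> E m n \<le> (1/16) ^ k" by metis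
  define r where "r n = n + (\<Sum>i\<le>n. n0 i)" for n
  have sm: "strict_mono r" by (rule strict_mono_Suc_iff [THEN iffD2]) (simp add: r_def)
  have ge: "n0 n \<le> r n" for n unfolding r_def by (simp add: sum.atMost_Suc trans_le_add2 member_le_sum)
  have "E (r n) (r m) \<le> (1/16) ^ n" if "n \<le> m" for n m
  proof (rule n0 [OF ge])
    have "r n \<le> r m" using sm that by (simp add: strict_mono_less_eq)
    then show "n0 n \<le> r m" using ge [of n] by linarith
  qed
  then show ?thesis using sm that by blast
qed

text \<open>A subsequence that is Cauchy at a geometric rate converges almost everywhere; Fatou's lemma
  then gives convergence in \<open>L\<^sup>4\<close> and the lower semicontinuity of the Gagliardo integral.\<close>

lemma geometric_cauchy_limit:
  assumes w: "\<And>n. W14_4 (w n)" and G: "\<And>n. gagliardo (w n) \<le> G"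
    and B: "\<And>n. (\<integral>x. norm (w n x) ^ 4 \<partial>circ) \<le> B"
    and fast: "\<And>n m. n \<le> m \<Longrightarrow> (\<integral>x. norm (w n x - w m x) ^ 4 \<partial>circ) \<le> (1/16) ^ n"
  obtains \<Phi> where "W14_4 \<Phi>" "(\<lambda>n. \<integral>x. norm (w n x - \<Phi> x) ^ 4 \<partial>circ) \<longlonglongrightarrow> 0"
    "\<And>C. eventually (\<lambda>n. gagliardo (w n) \<le> C) sequentially \<Longrightarrow> gagliardo \<Phi> \<le> C"
proof -
  note [measurable] = W14_4D(2) [OF w]
  \<comment> \<open>Where the limit does not exist, \<open>lim\<close> still depends only on the sequence of values, which keeps
    \<open>\<Phi>\<close> periodic.\<close>
  define \<Phi> where "\<Phi> x = lim (\<lambda>n. w n x)" for x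
  have [measurable]: "\<Phi> \<in> borel_measurable borel" unfolding \<Phi>_def [abs_def] by measurable
  have per: "periodic_2pi \<Phi>"
    using W14_4D(1) [OF w] by (simp add: \<Phi>_def periodic_2pi_def)
  note id = W14_4_diff(1) [OF w w]
  \<comment> \<open>The rate \<open>16\<^sup>-\<^sup>n\<close> for fourth powers leaves \<open>2\<^sup>-\<^sup>n\<close> for the \<open>L\<^sup>1\<close> distances: Young at scale \<open>2\<^sup>-\<^sup>n\<close>
    costs a factor \<open>8\<^sup>n\<close>.\<close>
  have step: "(\<integral>x. norm (w n x - w (Suc n) x) \<partial>circ) \<le> (2*pi + 1) * (1/2) ^ n" for n
  proof -
    have "(\<integral>x. norm (w n x - w (Suc n) x) \<partial>circ) \<le> (\<integral>x. (1/2)^n + norm (w n x - w (Suc n) x) ^ 4 / ((1/2)^n)^3 \<partial>circ)"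
      using W14_4_integrable [OF id] W14_4D(3) [OF id] power_le_pow4_scaled(1) [of _ "(1/2)^n"]
      by (intro integral_mono) auto
    also have "\<dots> = 2*pi * (1/2)^n + (\<integral>x. norm (w n x - w (Suc n) x) ^ 4 \<partial>circ) / ((1/2)^n)^3"
      using W14_4D(3) [OF id] by simp
    also have "\<dots> \<le> 2*pi * (1/2)^n + (1/16)^n / ((1/2)^n)^3"
      using fast [of n "Suc n"] by (intro add_mono divide_right_mono) auto
    also have "(1/16)^n / ((1/2)^n)^3 = ((1/16) / (1/2)^3 :: real) ^ n"
    proof -
      have "((1/2)^n)^3 = ((1/2 :: real)^3)^n" by (simp only: power_mult [symmetric] mult.commute)
      then show ?thesis by (simp only: power_divide)
    qed
    finally show ?thesis by (simp add: power3_eq_cube algebra_simps)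
  qed
  have "AE x in circ. summable (\<lambda>n. norm (w n x - w (Suc n) x))"
  proof (rule AE_summable_of_integrals)
    show "integrable circ (\<lambda>x. w n x - w (Suc n) x)" for n by (rule W14_4_integrable [OF id])
    show "summable (\<lambda>n. \<integral>x. norm (w n x - w (Suc n) x) \<partial>circ)"
      by (rule summable_comparison_test' [where g = "\<lambda>n. (2*pi + 1) * (1/2) ^ n"])
        (use step in \<open>auto intro!: summable_mult summable_geometric\<close>)
  qed
  then have ae: "AE x in circ. (\<lambda>n. w n x) \<longlonglongrightarrow> \<Phi> x"
  proof eventually_elim
    case (elim x)
    then have "summable (\<lambda>n. w n x - w (Suc n) x)" by (rule summable_norm_cancel)
    then have "convergent (\<lambda>n. \<Sum>i<n. w i x - w (Suc i) x)" by (simp add: summable_iff_convergent)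
    then have "convergent (\<lambda>n. w 0 x - w n x)"
      using sum_lessThan_telescope' [of "\<lambda>i. w i x"] by simp
    then have "convergent (\<lambda>n. w 0 x - (w 0 x - w n x))"
      by (rule convergent_diff [OF convergent_const])
    then show ?case by (simp add: \<Phi>_def convergent_LIMSEQ_iff)
  qed
  have i4: "integrable circ (\<lambda>x. norm (\<Phi> x) ^ 4)"
  proof (rule fatou_bound(1) [where f = "\<lambda>n x. norm (w n x) ^ 4" and C = B])
    show "AE x in circ. (\<lambda>n. norm (w n x) ^ 4) \<longlonglongrightarrow> norm (\<Phi> x) ^ 4"
      using ae by eventually_elim (intro tendsto_intros)
  qed (use B W14_4D(3) [OF w] in auto)
  have gag_lim: "AE p in circ2. (\<lambda>n. gag (w n) p) \<longlonglongrightarrow> gag \<Phi> p"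
    using AE_circ2_both [OF ae]
  proof eventually_elim
    case (elim p)
    then have "(\<lambda>n. norm (w n (fst p) - w n (snd p)) ^ 4 * inverse (1 - cos (fst p - snd p))) \<longlonglongrightarrow>
        norm (\<Phi> (fst p) - \<Phi> (snd p)) ^ 4 * inverse (1 - cos (fst p - snd p))"
      by (intro tendsto_intros) auto
    then show ?case by (simp add: gag_def divide_inverse)
  qed
  have [measurable]: "gag \<Phi> \<in> borel_measurable circ2" by measurable
  have ig: "integrable circ2 (gag \<Phi>)"
    by (rule fatou_bound(1) [OF _ _ _ gag_lim, where C = G])
      (use W14_4D(4) [OF w] gag_nonneg G in \<open>auto simp: gagliardo_def\<close>)
  have W: "W14_4 \<Phi>" using per i4 ig by (simp add: W14_4_iff)
  have rate: "(\<integral>x. norm (w n x - \<Phi> x) ^ 4 \<partial>circ) \<le> (1/16) ^ n" for n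
  proof (rule fatou_bound(2) [where f = "\<lambda>m x. norm (w n x - w m x) ^ 4"])
    show "AE x in circ. (\<lambda>m. norm (w n x - w m x) ^ 4) \<longlonglongrightarrow> norm (w n x - \<Phi> x) ^ 4"
      using ae by eventually_elim (intro tendsto_intros)
    show "eventually (\<lambda>m. (\<integral>x. norm (w n x - w m x) ^ 4 \<partial>circ) \<le> (1/16) ^ n) sequentially"
      using fast by (auto simp: eventually_sequentially)
  qed (use W14_4D(3) [OF id] in auto)
  have "(\<lambda>n. \<integral>x. norm (w n x - \<Phi> x) ^ 4 \<partial>circ) \<longlonglongrightarrow> 0"
  proof (rule tendsto_sandwich [where f = "\<lambda>_. 0" and h = "\<lambda>n. (1/16) ^ n"])
    show "(\<lambda>n. (1/16 :: real) ^ n) \<longlonglongrightarrow> 0" by (rule LIMSEQ_realpow_zero) auto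
    show "eventually (\<lambda>n. 0 \<le> (\<integral>x. norm (w n x - \<Phi> x) ^ 4 \<partial>circ)) sequentially"
      by (intro always_eventually allI integral_nonneg_AE AE_I2) simp
    show "eventually (\<lambda>n. (\<integral>x. norm (w n x - \<Phi> x) ^ 4 \<partial>circ) \<le> (1/16) ^ n) sequentially"
      using rate by (intro always_eventually allI)
  qed (rule tendsto_const)
  moreover have "gagliardo \<Phi> \<le> C" if "eventually (\<lambda>n. gagliardo (w n) \<le> C) sequentially" for C
    unfolding gagliardo_def
    by (rule fatou_bound(2) [OF _ _ _ gag_lim]) (use W14_4D(4) [OF w] gag_nonneg that in \<open>auto simp: gagliardo_def\<close>)
  ultimately show ?thesis by (rule that [OF W])
qed

text \<open>The cell integrals of all partitions are countably many bounded sequences; a diagonal subsequence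
  makes them all converge.\<close>

lemma W14_4_compact:
  assumes u: "\<And>n. W14_4 (u n)" and G: "\<And>n. gagliardo (u n) \<le> G"
    and B: "\<And>n. (\<integral>x. norm (u n x) ^ 4 \<partial>circ) \<le> B"
  obtains r \<Phi> where "strict_mono (r :: nat \<Rightarrow> nat)" "W14_4 \<Phi>"
    "(\<lambda>n. \<integral>x. norm (u (r n) x - \<Phi> x) ^ 4 \<partial>circ) \<longlonglongrightarrow> 0"
    "\<And>C. eventually (\<lambda>n. gagliardo (u (r n)) \<le> C) sequentially \<Longrightarrow> gagliardo \<Phi> \<le> C"
proof -
  have bound: "norm (cell_integral (fst p) (snd p) (u n)) \<le> 2*pi + B" for n p
  proof -
    have "norm (cell_integral (fst p) (snd p) (u n)) \<le> (\<integral>x. norm (u n x) \<partial>circ)"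
      by (rule norm_cell_integral_le [OF W14_4_integrable [OF u]])
    also have "\<dots> \<le> (\<integral>x. 1 + norm (u n x) ^ 4 \<partial>circ)"
      using W14_4_integrable [OF u] W14_4D(3) [OF u] power_le_1_plus_power4 [of _ 1]
      by (intro integral_mono) auto
    also have "\<dots> \<le> 2*pi + B" using W14_4D(3) [OF u] B [of n] by simp
    finally show ?thesis .
  qed
  obtain k :: "nat \<Rightarrow> nat" where k: "strict_mono k"
      "\<And>p. p \<in> UNIV \<Longrightarrow> \<exists>l. (\<lambda>n. cell_integral (fst p) (snd p) (u (k n))) \<longlonglongrightarrow> l"
    using function_convergent_subsequence [of "UNIV :: (nat \<times> nat) set"
        "\<lambda>n p. cell_integral (fst p) (snd p) (u n)" "2*pi + B"] bound
    by (metis countableI_type)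
  have cells: "convergent (\<lambda>n. cell_integral N j (u (k n)))" for N j
    using k(2) [of "(N, j)"] by (auto simp: convergent_def)
  have "\<exists>n0. \<forall>m\<ge>n0. \<forall>n\<ge>n0. (\<integral>x. norm (u (k m) x - u (k n) x) ^ 4 \<partial>circ) \<le> \<epsilon>" if "0 < \<epsilon>" for \<epsilon>
    by (rule L4_cauchy_of_cells [OF u G cells that])
  from fast_subsequence [OF this] obtain s :: "nat \<Rightarrow> nat" where s: "strict_mono s"
    "\<And>n m. n \<le> m \<Longrightarrow> (\<integral>x. norm (u (k (s n)) x - u (k (s m)) x) ^ 4 \<partial>circ) \<le> (1/16) ^ n"
    by metis
  obtain \<Phi> where \<Phi>: "W14_4 \<Phi>" "(\<lambda>n. \<integral>x. norm (u (k (s n)) x - \<Phi> x) ^ 4 \<partial>circ) \<longlonglongrightarrow> 0"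
    "\<And>C. eventually (\<lambda>n. gagliardo (u (k (s n))) \<le> C) sequentially \<Longrightarrow> gagliardo \<Phi> \<le> C"
    using geometric_cauchy_limit [of "\<lambda>n. u (k (s n))" G B, OF u G B s(2)] by blast
  show ?thesis
    by (rule that [of "k \<circ> s" \<Phi>]) (use \<Phi> strict_mono_o [OF k(1) s(1)] in auto)
qed

section \<open>Existence of minimizers\<close>

lemma admissibleD:
  assumes "admissible u"
  shows "W14_4 u" "positive_spectrum u" "u \<in> borel_measurable borel" "integrable circ u"
    "integrable circ (\<lambda>x. norm (u x) ^ 2)"
  using assms W14_4D(2) W14_4_integrable W14_4_integrable_power [of u 2] by (auto simp: admissible_def)

lemma chord_lip_mode: "chord_lip (1 + real k) (mode (int k))"
  using chord_lip_cis [of k] by simp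

lemma W14_4_add_mode:
  assumes "W14_4 u" shows "W14_4 (\<lambda>x. u x + s * mode (int k) x)"
  by (intro W14_4_add(1) W14_4_cmult(1) assms W14_4_chord_lip [OF chord_lip_mode])

lemma fourier_coeff_add_mode:
  assumes "integrable circ u"
  shows "fourier_coeff (\<lambda>x. u x + s * mode j x) k = fourier_coeff u k + (if j = k then s else 0)"
  by (simp only: fourier_coeff_lincomb [OF assms integrable_cis] fourier_coeff_mode) simp

lemma admissible_add_mode:
  assumes u: "admissible u" and k: "k \<ge> 1"
  shows "admissible (\<lambda>x. u x + s * mode (int k) x)"
  unfolding admissible_def positive_spectrum_iff fourier_coeff_add_mode [OF admissibleD(4) [OF u]]
  using W14_4_add_mode [OF admissibleD(1) [OF u]] admissibleD(2) [OF u] k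
  by (auto simp: positive_spectrum_iff)

lemma momentum_add_mode:
  assumes u: "W14_4 u"
  shows "momentum (\<lambda>x. u x + s * mode k x) =
    momentum u + 2*pi * (norm (fourier_coeff u k + s) ^ 2 - norm (fourier_coeff u k) ^ 2)"
proof -
  note [measurable] = W14_4D(2) [OF u]
  have "momentum (\<lambda>x. u x + s * mode k x) = (\<integral>x. norm (u x + s * mode k x) ^ 2 \<partial>circ)"
    by (rule momentum_eq) measurable
  also have "\<dots> = (\<integral>x. norm (u x) ^ 2 \<partial>circ) + 2*pi * (norm (fourier_coeff u k + s) ^ 2 - norm (fourier_coeff u k) ^ 2)"
    by (rule integral_sq_add_mode(2)) (use W14_4_integrable_power [OF u, of 2] in auto)
  finally show ?thesis by (simp add: momentum_eq)
qed

lemma mass_add_mode: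
  assumes u: "W14_4 u" and k: "k \<ge> 1"
  shows "mass (\<lambda>x. u x + s * mode (int k) x) =
    mass u + (norm (fourier_coeff u (int k) + s) ^ 2 - norm (fourier_coeff u (int k)) ^ 2) / real k"
proof -
  let ?d = "norm (fourier_coeff u (int k) + s) ^ 2 - norm (fourier_coeff u (int k)) ^ 2"
  let ?v = "\<lambda>x. u x + s * mode (int k) x"
  have "(\<lambda>n. norm (pos_coeff u n) ^ 2 / real (Suc n) + (if n = k - 1 then ?d / real k else 0)) sums (mass u + ?d / real k)"
    unfolding mass_def
    by (intro sums_add summable_sums mass_summable(1) u) (rule sums_single)
  moreover have "norm (pos_coeff u n) ^ 2 / real (Suc n) + (if n = k - 1 then ?d / real k else 0) =
      norm (pos_coeff ?v n) ^ 2 / real (Suc n)" for n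
  proof (cases "n = k - 1")
    case True
    then have "Suc n = k" using k by simp
    then have "int (Suc n) = int k" "real (Suc n) = real k" by simp_all
    then show ?thesis
      unfolding fourier_coeff_add_mode [OF W14_4_integrable [OF u]] using True
      by (simp add: diff_divide_distrib del: of_nat_Suc)
  next
    case False
    then have "int k \<noteq> int (Suc n)" using k by auto
    then show ?thesis
      unfolding fourier_coeff_add_mode [OF W14_4_integrable [OF u]] using False by simp
  qed
  ultimately show ?thesis unfolding mass_def by (simp add: sums_iff)
qed

lemma admissible_zero: "admissible (\<lambda>_. 0)" and mass_zero: "mass (\<lambda>_. 0) = 0"
  and momentum_zero: "momentum (\<lambda>_. 0) = 0"
proof -
  have "chord_lip 0 (\<lambda>_. 0)" by (simp add: chord_lip_def)
  then show "admissible (\<lambda>_. 0)"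
    by (simp add: admissible_def W14_4_chord_lip positive_spectrum_def fourier_coeff_def)
  show "mass (\<lambda>_. 0) = 0" by (simp add: mass_def fourier_coeff_def)
  show "momentum (\<lambda>_. 0) = 0" by (simp add: momentum_def)
qed

text \<open>Put all the mass at frequency \<open>1\<close>. An excess \<open>2\<pi>d\<close> of momentum is then created at a high frequency \<open>k\<close>
  by moving there the amount \<open>d/(k - 1)\<close> of mass, which is available once \<open>k\<close> is large.\<close>

lemma constraints_feasible:
  assumes M: "M > 0" and PM: "2*pi * M \<le> P"
  shows "\<exists>u. admissible u \<and> mass u = M \<and> momentum u = P"
proof -
  define d where "d = P / (2*pi) - M"
  have d: "0 \<le> d" using PM by (simp add: d_def field_simps)
  obtain m :: nat where m: "d / M + 1 < real m" using reals_Archimedean2 by blast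
  moreover have "0 \<le> d / M" using d M by simp
  ultimately have m1: "1 \<le> m" by linarith
  have "d / M \<le> real m" using m by simp
  then have dm: "d / real m \<le> M" using M m1 by (simp add: field_simps)
  define k where "k = Suc m"
  define b where "b = sqrt (d * real k / real m)"
  define a where "a = sqrt (M - d / real m)"
  have b2: "b ^ 2 = d * real k / real m" using d by (simp add: b_def)
  have a2: "a ^ 2 = M - d / real m" using dm by (simp add: a_def)
  define v where "v x = 0 + complex_of_real a * mode (int 1) x" for x
  define u where "u x = v x + complex_of_real b * mode (int k) x" for x
  have v: "admissible v" "mass v = a^2" "momentum v = 2*pi * a^2"
    unfolding v_def [abs_def]
    using admissible_add_mode [OF admissible_zero, of 1 "of_real a"]
      mass_add_mode [OF admissibleD(1) [OF admissible_zero], of 1 "of_real a"]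
      momentum_add_mode [OF admissibleD(1) [OF admissible_zero], of "of_real a" "int 1"]
    by (simp_all add: mass_zero momentum_zero fourier_coeff_def)
  have "fourier_coeff v (int k) = 0"
    unfolding v_def [abs_def] fourier_coeff_add_mode [OF admissibleD(4) [OF admissible_zero]]
    using m1 by (simp add: k_def fourier_coeff_def)
  then have u: "admissible u" "mass u = a^2 + b^2 / real k" "momentum u = 2*pi * (a^2 + b^2)"
    unfolding u_def [abs_def]
    using admissible_add_mode [OF v(1), of k "of_real b"]
      mass_add_mode [OF admissibleD(1) [OF v(1)], of k "of_real b"]
      momentum_add_mode [OF admissibleD(1) [OF v(1)], of "of_real b" "int k"] v(2,3)
    by (simp_all add: k_def distrib_left)
  have "a^2 + b^2 / real k = M" unfolding a2 b2 by (simp add: k_def)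
  moreover have "a^2 + b^2 = M + d"
    unfolding a2 b2 using m1 by (simp add: k_def field_simps)
  ultimately have "mass u = M" "momentum u = P" using u by (simp_all add: d_def distrib_left)
  then show ?thesis using u(1) by blast
qed

text \<open>The Poincare inequality on a fine partition absorbs the quartic term of the energy into half of
  the Gagliardo integral; the cell integrals are bounded in terms of the momentum.\<close>

lemma energy_coercive:
  assumes \<sigma>: "0 \<le> \<sigma>" "\<sigma> \<le> 1"
  obtains C where "\<And>u. W14_4 u \<Longrightarrow> momentum u = P \<Longrightarrow> gagliardo u \<le> 8 * pi^2 * energy \<sigma> u + C"
    and "\<And>u. W14_4 u \<Longrightarrow> momentum u = P \<Longrightarrow> (\<integral>x. norm (u x) ^ 4 \<partial>circ) \<le> gagliardo u + C"
proof -
  \<comment> \<open>Makes \<open>16 \<pi> d \<le> 1/4\<close>, so that the quartic term takes at most half of the Gagliardo integral, and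
    \<open>4 d \<le> 1\<close>.\<close>
  obtain N :: nat where N: "128 * pi^2 + 8 * pi < real N" using reals_Archimedean2 by blast
  moreover have "0 < 128 * pi^2 + 8 * pi" by (simp add: add_pos_pos)
  ultimately have N0: "N > 0" by (intro Nat.gr0I) auto
  define d where "d = 2*pi / real N"
  have d: "0 < d" using N0 by (simp add: d_def)
  have N1: "128 * pi^2 \<le> real N" "8 * pi \<le> real N"
    using N pi_gt_zero zero_le_power2 [of pi] by linarith+
  have d1: "4 * d \<le> 1" using N1(2) N0 by (simp add: d_def field_simps)
  have d2: "16 * d * pi \<le> 1 / 4"
    using N1(1) N0 by (simp add: d_def field_simps power2_eq_square)
  define K where "K = 8 / d^3 * (real N * (2*pi + P) ^ 4)"
  have I4: "(\<integral>x. norm (u x) ^ 4 \<partial>circ) \<le> 4 * d * gagliardo u + K" if u: "W14_4 u" and P: "momentum u = P" for u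
  proof -
    have "norm (cell_integral N j u) \<le> 2*pi + P" for j
    proof -
      have "norm (cell_integral N j u) \<le> (\<integral>x. norm (u x) \<partial>circ)"
        by (rule norm_cell_integral_le [OF W14_4_integrable [OF u]])
      also have "\<dots> \<le> (\<integral>x. 1 + norm (u x) ^ 2 \<partial>circ)"
      proof (rule integral_mono)
        show "norm (u x) \<le> 1 + norm (u x) ^ 2" for x
          using zero_le_power2 [of "norm (u x) - 1/2"] by (simp add: power2_eq_square algebra_simps)
      qed (use W14_4_integrable [OF u] W14_4_integrable_power [OF u, of 2] in auto)
      also have "\<dots> = 2*pi + P"
        using W14_4_integrable_power [OF u, of 2] P momentum_eq [OF W14_4D(2) [OF u]] by simp
      finally show ?thesis .
    qed
    then have "(\<Sum>j<N. norm (cell_integral N j u) ^ 4) \<le> (\<Sum>j<N. (2*pi + P) ^ 4)"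
      by (intro sum_mono power_mono) auto
    also have "\<dots> = real N * (2*pi + P) ^ 4" by simp
    finally have "8 / d^3 * (\<Sum>j<N. norm (cell_integral N j u) ^ 4) \<le> K"
      unfolding K_def using d by (intro mult_left_mono) auto
    from order_trans [OF poincare [OF u N0, folded d_def] add_left_mono [OF this]] show ?thesis .
  qed
  have K0: "0 \<le> K" using d by (simp add: K_def)
  show ?thesis
  proof (rule that [of "K + 16 * pi * K"])
    fix u assume u: "W14_4 u" "momentum u = P"
    let ?I = "\<integral>x. norm (u x) ^ 4 \<partial>circ" and ?W = "gagliardo u"
    have W0: "0 \<le> ?W" by (rule gagliardo_nonneg)
    have I0: "0 \<le> ?I" by (rule integral_nonneg_AE) simp
    have "4 * d * ?W \<le> 1 * ?W" by (intro mult_right_mono d1 W0)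
    moreover have "0 \<le> 16 * pi * K" using K0 by simp
    ultimately show "?I \<le> ?W + (K + 16 * pi * K)" using I4 [OF u] by linarith
    have "8 * pi^2 * energy \<sigma> u = 2 * ?W - 16 * pi * (\<sigma> * ?I)"
      unfolding energy_eq [OF W14_4D(2) [OF u(1)]] by (simp add: field_simps power2_eq_square)
    moreover have "16 * pi * (\<sigma> * ?I) \<le> 16 * pi * (4 * d * ?W + K)"
    proof (rule mult_left_mono)
      have "\<sigma> * ?I \<le> 1 * ?I" by (intro mult_right_mono \<sigma> I0)
      then show "\<sigma> * ?I \<le> 4 * d * ?W + K" using I4 [OF u] by linarith
    qed simp
    moreover have "16 * pi * (4 * d * ?W + K) = 4 * (16 * d * pi * ?W) + 16 * pi * K"
      by (simp add: algebra_simps)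
    moreover have "16 * d * pi * ?W \<le> 1 / 4 * ?W" by (intro mult_right_mono d2 W0)
    ultimately show "?W \<le> 8 * pi^2 * energy \<sigma> u + (K + 16 * pi * K)" using K0 by linarith
  qed
qed

text \<open>The direct method: both constraints and the quartic term pass to the limit along a subsequence of a
  minimizing sequence, and the Gagliardo integral can only drop.\<close>

theorem minimizer_exists:
  assumes \<sigma>: "0 \<le> \<sigma>" "\<sigma> \<le> 1" and M: "M > 0" and PM: "2*pi * M \<le> P"
  shows "\<exists>\<Phi>. minimizer \<sigma> M P \<Phi>"
proof -
  define A where "A u \<longleftrightarrow> admissible u \<and> mass u = M \<and> momentum u = P" for u
  obtain C where C: "\<And>u. W14_4 u \<Longrightarrow> momentum u = P \<Longrightarrow> gagliardo u \<le> 8 * pi^2 * energy \<sigma> u + C"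
    and C4: "\<And>u. W14_4 u \<Longrightarrow> momentum u = P \<Longrightarrow> (\<integral>x. norm (u x) ^ 4 \<partial>circ) \<le> gagliardo u + C"
    using energy_coercive [OF \<sigma>] by metis
  define m where "m = Inf (energy \<sigma> ` Collect A)"
  have ne: "energy \<sigma> ` Collect A \<noteq> {}" using constraints_feasible [OF M PM] by (auto simp: A_def)
  have bdd: "bdd_below (energy \<sigma> ` Collect A)"
  proof (rule bdd_belowI2)
    fix u assume "u \<in> Collect A"
    then have "gagliardo u \<le> 8 * pi^2 * energy \<sigma> u + C" by (intro C) (auto simp: A_def admissible_def)
    then have "- C \<le> 8 * pi^2 * energy \<sigma> u" using gagliardo_nonneg [of u] by linarith
    then show "- C / (8 * pi^2) \<le> energy \<sigma> u" by (simp add: field_simps)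
  qed
  have "\<exists>u. A u \<and> energy \<sigma> u < m + 1 / real (Suc n)" for n
    using cInf_lessD [OF ne, of "m + 1 / real (Suc n)"] by (auto simp: m_def)
  then obtain u where u: "\<And>n. A (u n)" "\<And>n. energy \<sigma> (u n) < m + 1 / real (Suc n)" by metis
  have le: "m \<le> energy \<sigma> v" if "A v" for v
    unfolding m_def by (rule cInf_lower [OF _ bdd]) (use that in auto)
  have E_lim: "(\<lambda>n. energy \<sigma> (u n)) \<longlonglongrightarrow> m"
  proof (rule tendsto_sandwich [where f = "\<lambda>_. m" and h = "\<lambda>n. m + 1 / real (Suc n)"])
    have "(\<lambda>n. 1 / real (Suc n)) \<longlonglongrightarrow> 0" using LIMSEQ_inverse_real_of_nat by (simp add: inverse_eq_divide)
    then have "(\<lambda>n. m + 1 / real (Suc n)) \<longlonglongrightarrow> m + 0" by (intro tendsto_intros)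
    then show "(\<lambda>n. m + 1 / real (Suc n)) \<longlonglongrightarrow> m" by simp
    show "eventually (\<lambda>n. m \<le> energy \<sigma> (u n)) sequentially"
      by (intro always_eventually allI le u(1))
    show "eventually (\<lambda>n. energy \<sigma> (u n) \<le> m + 1 / real (Suc n)) sequentially"
      using u(2) by (intro always_eventually allI less_imp_le)
  qed (rule tendsto_const)
  have uW: "W14_4 (u n)" "admissible (u n)" "mass (u n) = M" "momentum (u n) = P" for n
    using u(1) [of n] by (auto simp: A_def admissible_def)
  define G where "G = 8 * pi^2 * (m + 1) + C"
  have G: "gagliardo (u n) \<le> G" for n
  proof -
    have "1 / real (Suc n) \<le> 1" by simp
    then have "energy \<sigma> (u n) \<le> m + 1" using u(2) [of n] by linarith
    then have "8 * pi^2 * energy \<sigma> (u n) \<le> 8 * pi^2 * (m + 1)" by (intro mult_left_mono) auto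
    then show ?thesis unfolding G_def using C [OF uW(1,4), of n] by linarith
  qed
  have B: "(\<integral>x. norm (u n x) ^ 4 \<partial>circ) \<le> G + C" for n
    using C4 [OF uW(1,4), of n] G [of n] by linarith
  obtain r \<Phi> where r: "strict_mono (r :: nat \<Rightarrow> nat)" and \<Phi>: "W14_4 \<Phi>"
    and conv: "(\<lambda>n. \<integral>x. norm (u (r n) x - \<Phi> x) ^ 4 \<partial>circ) \<longlonglongrightarrow> 0"
    and lsc: "\<And>C. eventually (\<lambda>n. gagliardo (u (r n)) \<le> C) sequentially \<Longrightarrow> gagliardo \<Phi> \<le> C"
    by (rule W14_4_compact [OF uW(1) G B]) (rule that, assumption+)
  have "W14_4 (u (r n))" "(\<integral>x. norm (u (r n) x) ^ 4 \<partial>circ) \<le> G + C" for n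
    using uW(1) B by auto
  note cv = this(1) \<Phi> this(2) conv
  have "fourier_coeff \<Phi> k = 0" if "k \<le> 0" for k
  proof -
    have "(\<lambda>n. fourier_coeff (u (r n)) k) \<longlonglongrightarrow> fourier_coeff \<Phi> k"
      by (rule conv_fourier_coeff [OF cv])
    moreover have "fourier_coeff (u (r n)) k = 0" for n
      using uW(2) [of "r n"] that by (simp add: admissible_def positive_spectrum_iff)
    ultimately show ?thesis by (simp add: LIMSEQ_const_iff)
  qed
  then have adm: "admissible \<Phi>" using \<Phi> by (simp add: admissible_def positive_spectrum_iff)
  have "(\<lambda>n. mass (u (r n))) \<longlonglongrightarrow> mass \<Phi>" by (rule conv_mass [OF cv])
  then have mass: "mass \<Phi> = M" by (simp add: uW LIMSEQ_const_iff)
  have "(\<lambda>n. \<integral>x. norm (u (r n) x) ^ 2 \<partial>circ) \<longlonglongrightarrow> (\<integral>x. norm (\<Phi> x) ^ 2 \<partial>circ)"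
    by (rule conv_L2 [OF cv])
  then have mom: "momentum \<Phi> = P"
    using uW(4) by (simp add: momentum_eq W14_4D(2) \<Phi> uW(1) LIMSEQ_const_iff)
  have E: "energy \<sigma> \<Phi> \<le> m"
  proof -
    let ?I = "\<integral>x. norm (\<Phi> x) ^ 4 \<partial>circ"
    define \<Gamma> where "\<Gamma> = 4 * pi^2 * (m + 2 * \<sigma> / pi * ?I)"
    have gag: "gagliardo v = 4 * pi^2 * (energy \<sigma> v + 2 * \<sigma> / pi * (\<integral>x. norm (v x) ^ 4 \<partial>circ))" if "W14_4 v" for v
      unfolding energy_eq [OF W14_4D(2) [OF that]] by simp
    have "(\<lambda>n. energy \<sigma> (u (r n))) \<longlonglongrightarrow> m" using LIMSEQ_subseq_LIMSEQ [OF E_lim r] by (simp add: o_def)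
    then have "(\<lambda>n. gagliardo (u (r n))) \<longlonglongrightarrow> \<Gamma>"
      unfolding gag [OF uW(1)] \<Gamma>_def by (intro tendsto_intros conv_L4 [OF cv])
    note lim = this
    have "gagliardo \<Phi> \<le> \<Gamma> + e" if "0 < e" for e
    proof (rule lsc)
      have "eventually (\<lambda>n. gagliardo (u (r n)) < \<Gamma> + e) sequentially"
        using that by (intro order_tendstoD(2) [OF lim]) simp
      then show "eventually (\<lambda>n. gagliardo (u (r n)) \<le> \<Gamma> + e) sequentially"
        by eventually_elim simp
    qed
    then have "gagliardo \<Phi> \<le> \<Gamma>" by (rule field_le_epsilon)
    then have "4 * pi^2 * energy \<sigma> \<Phi> \<le> 4 * pi^2 * m"
      unfolding gag [OF \<Phi>] \<Gamma>_def by (simp add: distrib_left)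
    then show ?thesis by simp
  qed
  have "minimizer \<sigma> M P \<Phi>"
    unfolding minimizer_def is_arg_min_def
    using adm mass mom order_trans [OF E le] unfolding A_def by (auto simp: not_less)
  then show ?thesis by blast
qed

section \<open>First variation of the energy\<close>

text \<open>The weak cubic term tested directly against \<open>g\<close>, without the projector. Its real part is, up to the
  factor \<open>8/\<pi>\<close>, the first variation of the energy in the direction \<open>g\<close>.\<close>

definition form :: "real \<Rightarrow> (real \<Rightarrow> complex) \<Rightarrow> (real \<Rightarrow> complex) \<Rightarrow> complex" where
  "form \<sigma> u g = (\<integral>p. cubic_kernel u (fst p) (snd p) * cnj (g (fst p) - g (snd p)) \<partial>circ2) / of_real (8*pi)
     - (\<integral>x. of_real (\<sigma> * norm (u x) ^ 2) * u x * cnj (g x) \<partial>circ)"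

lemma cubic_kernel_measurable [measurable]:
  assumes [measurable]: "u \<in> borel_measurable borel"
  shows "(\<lambda>p. cubic_kernel u (fst p) (snd p)) \<in> borel_measurable (borel \<Otimes>\<^sub>M borel)"
  unfolding cubic_kernel_def by measurable

lemma P_plus_measurable [measurable]: "P_plus f \<in> borel_measurable borel"
  unfolding P_plus_mode_series by measurable

lemma cubic_pairing_form:
  assumes [measurable]: "u \<in> borel_measurable borel"
  shows "cubic_pairing \<sigma> u \<phi> = form \<sigma> u (P_plus \<phi>)"
proof -
  have 1: "(\<lambda>(x, y). cubic_kernel u x y * cnj (P_plus \<phi> x - P_plus \<phi> y)) =
      (\<lambda>p. cubic_kernel u (fst p) (snd p) * cnj (P_plus \<phi> (fst p) - P_plus \<phi> (snd p)))"
    by auto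
  show ?thesis
    unfolding cubic_pairing_def form_def 1
    by (subst LINT_circ2, measurable, subst LINT_circ, measurable)
qed

text \<open>Since \<open>|g x - g y|\<^sup>2\<close> is at most \<open>1 - cos (x - y)\<close> up to a constant, the kernel is integrable
  against differences of Lipschitz functions.\<close>

lemma integrable_form:
  assumes u: "W14_4 u" and g: "chord_lip L g"
  shows "integrable circ2 (\<lambda>p. cubic_kernel u (fst p) (snd p) * cnj (g (fst p) - g (snd p)))"
    and "integrable circ (\<lambda>x. of_real (\<sigma> * norm (u x) ^ 2) * u x * cnj (g x))"
proof -
  note [measurable] = W14_4D(2) [OF u] chord_lip_measurable [OF g]
  show "integrable circ2 (\<lambda>p. cubic_kernel u (fst p) (snd p) * cnj (g (fst p) - g (snd p)))"
  proof (rule Bochner_Integration.integrable_bound)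
    show "integrable circ2 (\<lambda>p. gag u p + 2 * L^2 * (1 + norm (u (fst p) - u (snd p)) ^ 4))"
      using W14_4D(4) [OF u] integrable_diff_pow4 [OF u] by simp
    show "(\<lambda>p. cubic_kernel u (fst p) (snd p) * cnj (g (fst p) - g (snd p))) \<in> borel_measurable circ2"
      by measurable
    have "norm (cubic_kernel u x y * cnj (g x - g y)) \<le> gag u (x, y) + 2 * L^2 * (1 + norm (u x - u y) ^ 4)" for x y
    proof -
      define q a c where "q = 1 - cos (x - y)" and "a = norm (u x - u y)" and "c = norm (g x - g y)"
      have q0: "0 \<le> q" unfolding q_def by (rule one_minus_cos_bounds)
      have c2: "c^2 \<le> 2 * L^2 * q" unfolding c_def q_def by (rule chord_lip_sq [OF g])
      have e: "norm (cubic_kernel u x y * cnj (g x - g y)) = a^2 / q * a * c"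
        unfolding cubic_kernel_def norm_mult norm_of_real complex_mod_cnj q_def [symmetric] a_def [symmetric] c_def [symmetric]
        using q0 by simp
      show ?thesis
      \<comment> \<open>On the diagonal both quotients are \<open>0\<close>.\<close>
      proof (cases "q = 0")
        case True
        then show ?thesis unfolding e using gag_nonneg [of u "(x, y)"] by (simp add: add_nonneg_nonneg)
      next
        case False
        have a2: "a^2 \<le> 1 + a^4" by (rule power_le_1_plus_power4) (auto simp: a_def)
        have "a^2 * (2 * a * c) \<le> a^2 * (a^2 + c^2)"
          using zero_le_power2 [of "a - c"] by (intro mult_left_mono) (auto simp: power2_eq_square algebra_simps)
        also have "\<dots> \<le> a^2 * (a^2 + 2 * L^2 * q)" using c2 by (intro mult_left_mono) auto
        finally have "2 * (a^2 * a * c) \<le> a^4 + q * (2 * L^2 * a^2)"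
          by (simp add: power2_eq_square power4_eq_xxxx algebra_simps)
        then have "2 * (a^2 * a * c) / q \<le> (a^4 + q * (2 * L^2 * a^2)) / q"
          using q0 by (rule divide_right_mono)
        then have "2 * (a^2 / q * a * c) \<le> a^4 / q + 2 * L^2 * a^2"
          using False by (simp add: add_divide_distrib)
        note young = this
        have "0 \<le> a^2 / q * a * c" using q0 by (simp add: a_def c_def)
        moreover have "x \<le> 2 * x" if "0 \<le> x" for x :: real using that by simp
        ultimately have "a^2 / q * a * c \<le> 2 * (a^2 / q * a * c)" by blast
        also note young
        also have "a^4 / q + 2 * L^2 * a^2 \<le> a^4 / q + 2 * L^2 * (1 + a^4)"
          using a2 by (intro add_left_mono mult_left_mono) auto
        finally show ?thesis unfolding e by (simp add: gag_def a_def q_def)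
      qed
    qed
    then show "AE p in circ2. norm (cubic_kernel u (fst p) (snd p) * cnj (g (fst p) - g (snd p)))
        \<le> norm (gag u p + 2 * L^2 * (1 + norm (u (fst p) - u (snd p)) ^ 4))"
      by (auto intro!: AE_I2 order_trans [OF _ abs_ge_self])
  qed
  show "integrable circ (\<lambda>x. of_real (\<sigma> * norm (u x) ^ 2) * u x * cnj (g x))"
  proof (rule Bochner_Integration.integrable_bound)
    show "integrable circ (\<lambda>x. \<bar>\<sigma>\<bar> * L * norm (u x) ^ 3)" using W14_4_integrable_power [OF u, of 3] by simp
    show "(\<lambda>x. of_real (\<sigma> * norm (u x) ^ 2) * u x * cnj (g x)) \<in> borel_measurable circ" by measurable
    have "norm (of_real (\<sigma> * norm (u x) ^ 2) * u x * cnj (g x)) \<le> \<bar>\<sigma>\<bar> * L * norm (u x) ^ 3" for x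
    proof -
      have "norm (of_real (\<sigma> * norm (u x) ^ 2) * u x * cnj (g x)) = \<bar>\<sigma>\<bar> * norm (u x) ^ 3 * norm (g x)"
        by (simp add: norm_mult abs_mult power3_eq_cube power2_eq_square norm_power)
      also have "\<dots> \<le> \<bar>\<sigma>\<bar> * norm (u x) ^ 3 * L" by (intro mult_left_mono chord_lipD(1) [OF g]) auto
      finally show ?thesis by (simp add: mult_ac)
    qed
    then show "AE x in circ. norm (of_real (\<sigma> * norm (u x) ^ 2) * u x * cnj (g x)) \<le> norm (\<bar>\<sigma>\<bar> * L * norm (u x) ^ 3)"
      by (auto intro!: AE_I2 order_trans [OF _ abs_ge_self])
  qed
qed

lemma form_lincomb:
  assumes u: "W14_4 u" and g: "chord_lip L g" and h: "chord_lip K h"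
  shows "form \<sigma> u (\<lambda>x. g x + c * h x) = form \<sigma> u g + cnj c * form \<sigma> u h"
proof -
  note i = integrable_form [OF u g] and j = integrable_form [OF u h]
  have 1: "(\<integral>p. cubic_kernel u (fst p) (snd p) * cnj (g (fst p) + c * h (fst p) - (g (snd p) + c * h (snd p))) \<partial>circ2)
    = (\<integral>p. cubic_kernel u (fst p) (snd p) * cnj (g (fst p) - g (snd p)) +
        cnj c * (cubic_kernel u (fst p) (snd p) * cnj (h (fst p) - h (snd p))) \<partial>circ2)"
    by (intro Bochner_Integration.integral_cong refl) (simp add: algebra_simps)
  have 2: "(\<integral>x. of_real (\<sigma> * norm (u x) ^ 2) * u x * cnj (g x + c * h x) \<partial>circ)
    = (\<integral>x. of_real (\<sigma> * norm (u x) ^ 2) * u x * cnj (g x) + cnj c * (of_real (\<sigma> * norm (u x) ^ 2) * u x * cnj (h x)) \<partial>circ)"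
    by (intro Bochner_Integration.integral_cong refl) (simp add: algebra_simps)
  show ?thesis
    unfolding form_def 1 2
      Bochner_Integration.integral_add [OF i(1) integrable_mult_right [OF j(1)]]
      Bochner_Integration.integral_add [OF i(2) integrable_mult_right [OF j(2)]]
      integral_mult_right_zero
    by (simp add: algebra_simps add_divide_distrib)
qed

lemma form_cmult:
  assumes u: "W14_4 u" and h: "chord_lip K h"
  shows "form \<sigma> u (\<lambda>x. c * h x) = cnj c * form \<sigma> u h"
proof -
  have "chord_lip 0 (\<lambda>_. 0)" by (simp add: chord_lip_def)
  from form_lincomb [OF u this h, of \<sigma> c] show ?thesis by (simp add: form_def)
qed

text \<open>With \<open>A = |a|\<^sup>2\<close>, \<open>B = |b|\<^sup>2\<close> and \<open>R = Re (a cnj b)\<close> the remainder is \<open>4R\<^sup>2 + B\<^sup>2 + 2AB + 4RB\<close>, and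
  \<open>R\<^sup>2 \<le> AB\<close>.\<close>

lemma pow4_expansion:
  fixes a b :: complex
  shows "\<bar>norm (a + b) ^ 4 - norm a ^ 4 - 4 * (norm a ^ 2 * Re (a * cnj b))\<bar>
    \<le> 8 * norm a ^ 2 * norm b ^ 2 + 3 * norm b ^ 4"
proof -
  define A B R where "A = norm a ^ 2" and "B = norm b ^ 2" and "R = Re (a * cnj b)"
  have AB: "0 \<le> A" "0 \<le> B" by (simp_all add: A_def B_def)
  have "\<bar>R\<bar> \<le> norm (a * cnj b)" unfolding R_def by (rule abs_Re_le_cmod)
  then have R: "\<bar>R\<bar> \<le> norm a * norm b" by (simp add: norm_mult)
  have "R^2 \<le> (norm a * norm b)^2" using R by (intro abs_le_square_iff [THEN iffD1]) simp
  then have R2: "R^2 \<le> A * B" by (simp add: A_def B_def power_mult_distrib)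
  have "2 * \<bar>R\<bar> \<le> A + B"
    using R zero_le_power2 [of "norm a - norm b"] by (simp add: A_def B_def power2_eq_square algebra_simps)
  then have "\<bar>R\<bar> * B * 2 \<le> (A + B) * B" using AB(2) mult_right_mono by fastforce
  then have RB: "\<bar>4 * (R * B)\<bar> \<le> 2 * (A * B) + 2 * B^2"
    using AB by (simp add: abs_mult power2_eq_square algebra_simps)
  have "norm (a + b) ^ 4 = (norm (a + b) ^ 2) ^ 2" by (simp flip: power_mult)
  also have "\<dots> = (A + 2 * R + B)^2" unfolding norm_add_sq A_def B_def R_def ..
  finally have "norm (a + b) ^ 4 - A^2 - 4 * (A * R) = 4 * R^2 + B^2 + 2 * (A * B) + 4 * (R * B)"
    by (simp add: power2_eq_square algebra_simps)
  moreover have "0 \<le> R^2" "0 \<le> B^2" "0 \<le> A * B" using AB by auto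
  ultimately have "\<bar>norm (a + b) ^ 4 - A^2 - 4 * (A * R)\<bar> \<le> 8 * (A * B) + 3 * B^2"
    using R2 RB by linarith
  moreover have "A^2 = norm a ^ 4" "B^2 = norm b ^ 4" by (simp_all add: A_def B_def flip: power_mult)
  ultimately show ?thesis by (simp add: A_def B_def R_def mult.assoc)
qed

lemma integrable_diff_sq:
  assumes u: "W14_4 u"
  shows "integrable circ2 (\<lambda>p. norm (u (fst p) - u (snd p)) ^ 2)"
proof (rule Bochner_Integration.integrable_bound)
  note [measurable] = W14_4D(2) [OF u]
  show "integrable circ2 (\<lambda>p. 1 + norm (u (fst p) - u (snd p)) ^ 4)" using integrable_diff_pow4 [OF u] by simp
  show "(\<lambda>p. norm (u (fst p) - u (snd p)) ^ 2) \<in> borel_measurable circ2" by measurable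
  show "AE p in circ2. norm (norm (u (fst p) - u (snd p)) ^ 2) \<le> norm (1 + norm (u (fst p) - u (snd p)) ^ 4)"
    using power_le_1_plus_power4 [of _ 2] by (auto intro!: AE_I2 order_trans [OF _ abs_ge_self])
qed

text \<open>The remainder is quadratic in the Lipschitz constant of the increment, with a constant that
  depends on \<open>u\<close> alone.\<close>

lemma energy_expansion:
  assumes u: "W14_4 u"
  obtains C where "0 \<le> C" "\<And>L h. chord_lip L h \<Longrightarrow>
    \<bar>energy \<sigma> (\<lambda>x. u x + h x) - energy \<sigma> u - 8 / pi * Re (form \<sigma> u h)\<bar> \<le> C * (L^2 + L^4)"
proof -
  note [measurable] = W14_4D(2) [OF u]
  define S2 where "S2 = (\<integral>p. norm (u (fst p) - u (snd p)) ^ 2 \<partial>circ2)"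
  define I2 where "I2 = (\<integral>x. norm (u x) ^ 2 \<partial>circ)"
  define m2 where "m2 = measure circ2 (space circ2)"
  define C where "C = (16 * S2 + 24 * m2) / (4 * pi^2) + 2 * \<bar>\<sigma>\<bar> / pi * (8 * I2 + 6 * pi)"
  have nn: "0 \<le> S2" "0 \<le> I2" "0 \<le> m2"
    unfolding S2_def I2_def m2_def by (auto intro!: integral_nonneg_AE)
  have C0: "0 \<le> C" unfolding C_def using nn by (intro add_nonneg_nonneg mult_nonneg_nonneg divide_nonneg_nonneg) auto
  have main: "\<bar>energy \<sigma> (\<lambda>x. u x + h x) - energy \<sigma> u - 8 / pi * Re (form \<sigma> u h)\<bar> \<le> C * (L^2 + L^4)"
    if h: "chord_lip L h" for L h
  proof -
    note [measurable] = chord_lip_measurable [OF h]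
    define v where "v x = u x + h x" for x
    have v: "W14_4 v" unfolding v_def [abs_def] by (rule W14_4_add(1) [OF u W14_4_chord_lip [OF h]])
    define k where "k p = cubic_kernel u (fst p) (snd p) * cnj (h (fst p) - h (snd p))" for p
    define c where "c x = of_real (\<sigma> * norm (u x) ^ 2) * u x * cnj (h x)" for x
    have ik: "integrable circ2 k" and ic: "integrable circ c"
      unfolding k_def [abs_def] c_def [abs_def] by (rule integrable_form [OF u h])+
    have ikR: "integrable circ2 (\<lambda>p. Re (k p))" and icR: "integrable circ (\<lambda>x. Re (c x))"
      using integrable_Re ik ic by auto
    define R2 where "R2 p = gag v p - gag u p - 4 * Re (k p)" for p
    define R1 where "R1 x = \<sigma> * (norm (v x) ^ 4 - norm (u x) ^ 4) - 4 * Re (c x)" for x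
    note gv = W14_4D(4) [OF v] and gu = W14_4D(4) [OF u] and v4 = W14_4D(3) [OF v] and u4 = W14_4D(3) [OF u]
    have iR2: "integrable circ2 R2" unfolding R2_def [abs_def] using gv gu ikR by simp
    have iR1: "integrable circ R1" unfolding R1_def [abs_def] using v4 u4 icR by simp
    have I2': "integral\<^sup>L circ2 R2 = gagliardo v - gagliardo u - 4 * (\<integral>p. Re (k p) \<partial>circ2)"
      unfolding R2_def gagliardo_def using gv gu ikR by simp
    have I1': "integral\<^sup>L circ R1 = \<sigma> * ((\<integral>x. norm (v x) ^ 4 \<partial>circ) - (\<integral>x. norm (u x) ^ 4 \<partial>circ)) - 4 * (\<integral>x. Re (c x) \<partial>circ)"
      unfolding R1_def using v4 u4 icR by simp
    have "Re (form \<sigma> u h) = (\<integral>p. Re (k p) \<partial>circ2) / (8*pi) - (\<integral>x. Re (c x) \<partial>circ)"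
    proof -
      have "form \<sigma> u h = integral\<^sup>L circ2 k / of_real (8*pi) - integral\<^sup>L circ c"
        by (simp only: form_def k_def [abs_def] c_def [abs_def])
      then show ?thesis unfolding integral_Re [OF ik] integral_Re [OF ic] by (simp only: Re_divide_of_real minus_complex.sel)
    qed
    then have "8 / pi * Re (form \<sigma> u h) = (\<integral>p. Re (k p) \<partial>circ2) / pi^2 - 8 / pi * (\<integral>x. Re (c x) \<partial>circ)"
      by (simp add: right_diff_distrib power2_eq_square)
    then have eq: "energy \<sigma> v - energy \<sigma> u - 8 / pi * Re (form \<sigma> u h)
        = integral\<^sup>L circ2 R2 / (4 * pi^2) - 2 / pi * integral\<^sup>L circ R1"
      unfolding energy_eq [OF W14_4D(2) [OF v]] energy_eq [OF W14_4D(2) [OF u]] I2' I1'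
      by (simp add: diff_divide_distrib right_diff_distrib)
    have R2_le: "norm (R2 p) \<le> 16 * L^2 * norm (u (fst p) - u (snd p)) ^ 2 + 24 * L^4" for p
    proof -
      obtain x y where p: "p = (x, y)" by (cases p)
      define q a b where "q = 1 - cos (x - y)" and "a = u x - u y" and "b = h x - h y"
      have q: "0 \<le> q" "q \<le> 2" unfolding q_def by (rule one_minus_cos_bounds)+
      have b2: "norm b ^ 2 \<le> 2 * L^2 * q" unfolding b_def q_def by (rule chord_lip_sq [OF h])
      have "v x - v y = a + b" by (simp add: v_def a_def b_def)
      moreover have "Re (k p) = norm a ^ 2 / q * Re (a * cnj b)"
        unfolding k_def p cubic_kernel_def fst_conv snd_conv a_def [symmetric] b_def [symmetric] q_def [symmetric]
        by (simp only: mult.assoc) (simp add: Re_divide_of_real)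
      ultimately have R2: "R2 p = (norm (a + b) ^ 4 - norm a ^ 4 - 4 * (norm a ^ 2 * Re (a * cnj b))) / q"
        unfolding R2_def gag_def p fst_conv snd_conv a_def [symmetric] q_def [symmetric]
        by (simp add: diff_divide_distrib)
      show ?thesis
      proof (cases "q = 0")
        case True
        then show ?thesis by (simp add: R2)
      next
        case False
        have "norm b ^ 4 = (norm b ^ 2)^2" by (simp flip: power_mult)
        also have "\<dots> \<le> (2 * L^2 * q)^2" by (intro power_mono b2) simp
        also have "\<dots> = 4 * L^4 * q * q" by (simp add: power2_eq_square power4_eq_xxxx)
        also have "\<dots> \<le> 4 * L^4 * q * 2" using q by (intro mult_left_mono) auto
        finally have b4: "norm b ^ 4 \<le> 8 * L^4 * q" by simp
        have "\<bar>norm (a + b) ^ 4 - norm a ^ 4 - 4 * (norm a ^ 2 * Re (a * cnj b))\<bar>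
            \<le> 8 * norm a ^ 2 * norm b ^ 2 + 3 * norm b ^ 4" by (rule pow4_expansion)
        also have "\<dots> \<le> 8 * norm a ^ 2 * (2 * L^2 * q) + 3 * (8 * L^4 * q)"
          by (intro add_mono mult_left_mono b2 b4) auto
        also have "\<dots> = (16 * L^2 * norm a ^ 2 + 24 * L^4) * q" by (simp add: algebra_simps)
        finally have "\<bar>norm (a + b) ^ 4 - norm a ^ 4 - 4 * (norm a ^ 2 * Re (a * cnj b))\<bar> / q \<le> 16 * L^2 * norm a ^ 2 + 24 * L^4"
          using q(1) False by (simp add: pos_divide_le_eq)
        then show ?thesis unfolding R2 using q(1) by (simp add: p a_def)
      qed
    qed
    have R1_le: "norm (R1 x) \<le> \<bar>\<sigma>\<bar> * (8 * L^2 * norm (u x) ^ 2 + 3 * L^4)" for x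
    proof -
      have "Re (c x) = \<sigma> * (norm (u x) ^ 2 * Re (u x * cnj (h x)))"
        unfolding c_def by (simp only: mult.assoc) (simp add: algebra_simps)
      then have "R1 x = \<sigma> * (norm (u x + h x) ^ 4 - norm (u x) ^ 4 - 4 * (norm (u x) ^ 2 * Re (u x * cnj (h x))))"
        by (simp add: R1_def v_def algebra_simps)
      then have "norm (R1 x) = \<bar>\<sigma>\<bar> * \<bar>norm (u x + h x) ^ 4 - norm (u x) ^ 4 - 4 * (norm (u x) ^ 2 * Re (u x * cnj (h x)))\<bar>"
        by (simp add: abs_mult)
      also have "\<dots> \<le> \<bar>\<sigma>\<bar> * (8 * norm (u x) ^ 2 * norm (h x) ^ 2 + 3 * norm (h x) ^ 4)"
        by (intro mult_left_mono pow4_expansion) auto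
      also have "\<dots> \<le> \<bar>\<sigma>\<bar> * (8 * norm (u x) ^ 2 * L ^ 2 + 3 * L ^ 4)"
        by (intro mult_left_mono add_mono power_mono chord_lipD(1) [OF h]) auto
      finally show ?thesis by (simp add: mult_ac)
    qed
    have "norm (integral\<^sup>L circ2 R2) \<le> (\<integral>p. 16 * L^2 * norm (u (fst p) - u (snd p)) ^ 2 + 24 * L^4 \<partial>circ2)"
      using integrable_diff_sq [OF u]
      by (intro Bochner_Integration.integral_norm_bound_integral iR2 R2_le) auto
    also have "\<dots> = 16 * L^2 * S2 + 24 * L^4 * m2"
      using integrable_diff_sq [OF u] by (simp add: S2_def m2_def)
    also have "\<dots> \<le> (16 * S2 + 24 * m2) * (L^2 + L^4)"
      using nn by (simp add: algebra_simps)
    finally have B2: "\<bar>integral\<^sup>L circ2 R2\<bar> \<le> (16 * S2 + 24 * m2) * (L^2 + L^4)" by simp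
    have "norm (integral\<^sup>L circ R1) \<le> (\<integral>x. \<bar>\<sigma>\<bar> * (8 * L^2 * norm (u x) ^ 2 + 3 * L^4) \<partial>circ)"
      using W14_4_integrable_power [OF u, of 2]
      by (intro Bochner_Integration.integral_norm_bound_integral iR1 R1_le) auto
    also have "\<dots> = \<bar>\<sigma>\<bar> * (8 * L^2 * I2 + 6 * pi * L^4)"
      using W14_4_integrable_power [OF u, of 2] by (simp add: I2_def)
    also have "\<dots> \<le> \<bar>\<sigma>\<bar> * ((8 * I2 + 6 * pi) * (L^2 + L^4))"
      using nn by (intro mult_left_mono) (auto simp: algebra_simps)
    finally have B1: "\<bar>integral\<^sup>L circ R1\<bar> \<le> \<bar>\<sigma>\<bar> * ((8 * I2 + 6 * pi) * (L^2 + L^4))" by simp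
    have "\<bar>energy \<sigma> v - energy \<sigma> u - 8 / pi * Re (form \<sigma> u h)\<bar>
        \<le> \<bar>integral\<^sup>L circ2 R2\<bar> / (4 * pi^2) + 2 / pi * \<bar>integral\<^sup>L circ R1\<bar>"
      unfolding eq by (rule order_trans [OF abs_triangle_ineq4]) (simp add: abs_mult)
    also have "\<dots> \<le> (16 * S2 + 24 * m2) * (L^2 + L^4) / (4 * pi^2) + 2 / pi * (\<bar>\<sigma>\<bar> * ((8 * I2 + 6 * pi) * (L^2 + L^4)))"
      by (intro add_mono divide_right_mono mult_left_mono B1 B2) auto
    also have "\<dots> = C * (L^2 + L^4)" by (simp add: C_def algebra_simps add_divide_distrib)
    finally show ?thesis by (simp add: v_def [abs_def])
  qed
  show ?thesis by (rule that [OF C0 main])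
qed

lemma has_vector_derivative_of_quadratic:
  fixes F :: "real \<Rightarrow> 'a::real_normed_vector"
  assumes "\<And>h. \<bar>h\<bar> \<le> 1 \<Longrightarrow> norm (F (t + h) - F t - h *\<^sub>R D) \<le> C * h^2"
  shows "(F has_vector_derivative D) (at t)"
  unfolding has_vector_derivative_def has_derivative_at
proof
  show "bounded_linear (\<lambda>h. h *\<^sub>R D)" by (rule bounded_linear_scaleR_left)
  show "(\<lambda>h. norm (F (t + h) - F t - h *\<^sub>R D) / norm h) \<midarrow>0\<rightarrow> 0"
  proof (rule Lim_null_comparison)
    have "((\<lambda>h. C * \<bar>h\<bar>) \<longlongrightarrow> C * \<bar>0\<bar>) (at (0::real))" by (intro tendsto_intros)
    then show "((\<lambda>h. C * \<bar>h\<bar>) \<longlongrightarrow> 0) (at (0::real))" by simp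
    show "eventually (\<lambda>h. norm (norm (F (t + h) - F t - h *\<^sub>R D) / norm h) \<le> C * \<bar>h\<bar>) (at 0)"
      unfolding eventually_at
    proof (intro exI [of _ 1] conjI ballI impI)
      fix h :: real assume h: "h \<noteq> 0 \<and> dist h 0 < 1"
      then have "norm (F (t + h) - F t - h *\<^sub>R D) / \<bar>h\<bar> \<le> C * h^2 / \<bar>h\<bar>"
        using assms [of h] by (intro divide_right_mono) auto
      moreover have "C * h^2 / \<bar>h\<bar> = C * \<bar>h\<bar>" using h by (simp add: power2_eq_square abs_if)
      ultimately show "norm (norm (F (t + h) - F t - h *\<^sub>R D) / norm h) \<le> C * \<bar>h\<bar>" by simp
    qed simp
  qed
qed

lemma energy_derivative:
  assumes u: "W14_4 u" and h: "chord_lip L h"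
  shows "((\<lambda>\<epsilon>. energy \<sigma> (\<lambda>x. u x + of_real \<epsilon> * h x)) has_real_derivative 8 / pi * Re (form \<sigma> u h)) (at 0)"
proof -
  obtain C where C: "0 \<le> C" "\<And>L h. chord_lip L h \<Longrightarrow>
    \<bar>energy \<sigma> (\<lambda>x. u x + h x) - energy \<sigma> u - 8 / pi * Re (form \<sigma> u h)\<bar> \<le> C * (L^2 + L^4)"
    using energy_expansion [OF u] by metis
  show ?thesis
    unfolding has_real_derivative_iff_has_vector_derivative
  proof (rule has_vector_derivative_of_quadratic [where C = "C * (L^2 + L^4)"])
    fix \<epsilon> :: real assume \<epsilon>: "\<bar>\<epsilon>\<bar> \<le> 1"
    have \<epsilon>2: "\<epsilon>^2 \<le> 1" using \<epsilon> by (simp add: abs_square_le_1)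
    have "form \<sigma> u (\<lambda>x. of_real \<epsilon> * h x) = of_real \<epsilon> * form \<sigma> u h"
      using form_cmult [OF u h, of \<sigma> "of_real \<epsilon>"] by simp
    then have "\<bar>energy \<sigma> (\<lambda>x. u x + of_real \<epsilon> * h x) - energy \<sigma> u - \<epsilon> * (8 / pi * Re (form \<sigma> u h))\<bar>
        \<le> C * ((\<bar>\<epsilon>\<bar> * L)^2 + (\<bar>\<epsilon>\<bar> * L)^4)"
      using C(2) [OF chord_lip_cmult [OF h, of "of_real \<epsilon>"]] by (simp add: mult_ac)
    also have "(\<bar>\<epsilon>\<bar> * L)^2 + (\<bar>\<epsilon>\<bar> * L)^4 = \<epsilon>^2 * (L^2 + \<epsilon>^2 * L^4)"
      by (simp add: power_mult_distrib power2_eq_square power4_eq_xxxx algebra_simps)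
    also have "C * (\<epsilon>^2 * (L^2 + \<epsilon>^2 * L^4)) \<le> C * (\<epsilon>^2 * (L^2 + 1 * L^4))"
      using C(1) \<epsilon>2 by (intro mult_left_mono add_left_mono mult_right_mono) auto
    finally show "norm (energy \<sigma> (\<lambda>x. u x + of_real (0 + \<epsilon>) * h x) - energy \<sigma> (\<lambda>x. u x + of_real 0 * h x)
        - \<epsilon> *\<^sub>R (8 / pi * Re (form \<sigma> u h))) \<le> C * (L^2 + L^4) * \<epsilon>^2"
      by (simp add: mult_ac)
  qed
qed

subsection \<open>Mass and momentum\<close>

text \<open>The sesquilinear forms whose diagonals are \<open>mass\<close> and \<open>momentum\<close>.\<close>

definition mass_pairing :: "(real \<Rightarrow> complex) \<Rightarrow> (real \<Rightarrow> complex) \<Rightarrow> complex" where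
  "mass_pairing u h = (\<Sum>n. pos_coeff u n * cnj (pos_coeff h n) / of_real (real (Suc n)))"

definition momentum_pairing :: "(real \<Rightarrow> complex) \<Rightarrow> (real \<Rightarrow> complex) \<Rightarrow> complex" where
  "momentum_pairing u h = (\<integral>x. u x * cnj (h x) \<partial>circ)"

lemma mass_pairing_summable:
  assumes u: "W14_4 u" and h: "W14_4 h"
  shows "summable (\<lambda>n. pos_coeff u n * cnj (pos_coeff h n) / of_real (real (Suc n)))"
proof (rule summable_norm_cancel, rule summable_comparison_test')
  show "summable (\<lambda>n. norm (pos_coeff u n) ^ 2 / real (Suc n) + norm (pos_coeff h n) ^ 2 / real (Suc n))"
    by (intro summable_add mass_summable(1) u h)
  show "norm (norm (pos_coeff u n * cnj (pos_coeff h n) / of_real (real (Suc n))))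
      \<le> norm (pos_coeff u n) ^ 2 / real (Suc n) + norm (pos_coeff h n) ^ 2 / real (Suc n)" for n
  proof -
    let ?a = "norm (pos_coeff u n)" and ?b = "norm (pos_coeff h n)"
    have "0 \<le> ?a * ?b" by simp
    moreover have "2 * (?a * ?b) \<le> ?a^2 + ?b^2"
      using zero_le_power2 [of "?a - ?b"] by (simp add: power2_eq_square algebra_simps)
    ultimately have "?a * ?b \<le> ?a^2 + ?b^2" by linarith
    from divide_right_mono [OF this, of "real (Suc n)"] show ?thesis
      by (simp add: norm_mult norm_divide add_divide_distrib del: of_nat_Suc)
  qed
qed

lemma mass_expansion:
  assumes u: "W14_4 u" and h: "W14_4 h"
  shows "mass (\<lambda>x. u x + of_real \<epsilon> * h x) = mass u + 2 * \<epsilon> * Re (mass_pairing u h) + \<epsilon>^2 * mass h"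
proof -
  have c: "pos_coeff (\<lambda>x. u x + of_real \<epsilon> * h x) n = pos_coeff u n + of_real \<epsilon> * pos_coeff h n" for n
    by (rule fourier_coeff_lincomb [OF W14_4_integrable [OF u] W14_4_integrable [OF h]])
  have e: "norm (pos_coeff u n + of_real \<epsilon> * pos_coeff h n) ^ 2 / real (Suc n)
    = norm (pos_coeff u n) ^ 2 / real (Suc n) + 2 * \<epsilon> * Re (pos_coeff u n * cnj (pos_coeff h n) / of_real (real (Suc n)))
      + \<epsilon>^2 * (norm (pos_coeff h n) ^ 2 / real (Suc n))" for n
  proof -
    define z where "z = pos_coeff u n * cnj (pos_coeff h n)"
    have r: "Re (pos_coeff u n * cnj (of_real \<epsilon> * pos_coeff h n)) = \<epsilon> * Re z"
      by (simp add: z_def algebra_simps)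
    show ?thesis
      unfolding norm_add_sq r Re_divide_of_real z_def [symmetric]
      by (simp add: norm_mult power_mult_distrib add_divide_distrib del: of_nat_Suc)
  qed
  have "(\<lambda>n. norm (pos_coeff u n) ^ 2 / real (Suc n) + 2 * \<epsilon> * Re (pos_coeff u n * cnj (pos_coeff h n) / of_real (real (Suc n)))
      + \<epsilon>^2 * (norm (pos_coeff h n) ^ 2 / real (Suc n))) sums (mass u + 2 * \<epsilon> * Re (mass_pairing u h) + \<epsilon>^2 * mass h)"
    unfolding mass_def mass_pairing_def
    by (intro sums_add sums_mult sums_Re summable_sums mass_summable(1) mass_pairing_summable u h)
  then show ?thesis by (simp only: mass_def [of "\<lambda>x. u x + of_real \<epsilon> * h x"] c e sums_iff)
qed

lemma integrable_mult_cnj: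
  assumes u: "W14_4 u" and h: "W14_4 h"
  shows "integrable circ (\<lambda>x. u x * cnj (h x))"
proof (rule Bochner_Integration.integrable_bound)
  note [measurable] = W14_4D(2) [OF u] W14_4D(2) [OF h]
  show "integrable circ (\<lambda>x. norm (u x) ^ 2 + norm (h x) ^ 2)"
    using W14_4_integrable_power [OF u, of 2] W14_4_integrable_power [OF h, of 2] by simp
  show "(\<lambda>x. u x * cnj (h x)) \<in> borel_measurable circ" by measurable
  have "norm (u x * cnj (h x)) \<le> norm (u x) ^ 2 + norm (h x) ^ 2" for x
  proof -
    have "0 \<le> norm (u x) * norm (h x)" by simp
    moreover have "2 * (norm (u x) * norm (h x)) \<le> norm (u x) ^ 2 + norm (h x) ^ 2"
      using zero_le_power2 [of "norm (u x) - norm (h x)"] by (simp add: power2_eq_square algebra_simps)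
    ultimately show ?thesis unfolding norm_mult complex_mod_cnj by linarith
  qed
  then show "AE x in circ. norm (u x * cnj (h x)) \<le> norm (norm (u x) ^ 2 + norm (h x) ^ 2)"
    by (auto intro!: AE_I2 order_trans [OF _ abs_ge_self])
qed

lemma momentum_expansion:
  assumes u: "W14_4 u" and h: "W14_4 h"
  shows "momentum (\<lambda>x. u x + of_real \<epsilon> * h x) = momentum u + 2 * \<epsilon> * Re (momentum_pairing u h) + \<epsilon>^2 * momentum h"
proof -
  note [measurable] = W14_4D(2) [OF u] W14_4D(2) [OF h]
  note i = W14_4_integrable_power [OF u, of 2] W14_4_integrable_power [OF h, of 2]
  define z where "z x = u x * cnj (h x)" for x
  have iz: "integrable circ z" unfolding z_def [abs_def] by (rule integrable_mult_cnj [OF u h])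
  have j: "integrable circ (\<lambda>x. Re (z x))" by (rule integrable_Re [OF iz])
  have e: "norm (u x + of_real \<epsilon> * h x) ^ 2 = norm (u x) ^ 2 + 2 * \<epsilon> * Re (z x) + \<epsilon>^2 * norm (h x) ^ 2" for x
  proof -
    have r: "Re (u x * cnj (of_real \<epsilon> * h x)) = \<epsilon> * Re (z x)" by (simp add: z_def algebra_simps)
    show ?thesis unfolding norm_add_sq r by (simp add: norm_mult power_mult_distrib)
  qed
  have "momentum (\<lambda>x. u x + of_real \<epsilon> * h x) = (\<integral>x. norm (u x) ^ 2 + 2 * \<epsilon> * Re (z x) + \<epsilon>^2 * norm (h x) ^ 2 \<partial>circ)"
    unfolding e [symmetric] by (rule momentum_eq) measurable
  also have "\<dots> = (\<integral>x. norm (u x) ^ 2 \<partial>circ) + 2 * \<epsilon> * (\<integral>x. Re (z x) \<partial>circ) + \<epsilon>^2 * (\<integral>x. norm (h x) ^ 2 \<partial>circ)"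
    using i j by simp
  also have "(\<integral>x. Re (z x) \<partial>circ) = Re (momentum_pairing u h)"
    by (subst integral_Re [OF iz]) (simp only: momentum_pairing_def z_def [abs_def])
  finally show ?thesis by (simp add: momentum_eq)
qed

section \<open>The Euler-Lagrange equation\<close>

lemma Lambda_inv_summable:
  assumes u: "W14_4 u"
  shows "summable (\<lambda>n. norm (pos_coeff u n / of_real (2*pi * real (Suc n))))"
proof (rule summable_comparison_test')
  show "summable (\<lambda>n. norm (pos_coeff u n) ^ 2 + 1 / real (Suc n) ^ 2)"
    using inverse_squares_sums [THEN sums_summable]
    by (intro summable_add pos_coeff_sq_summable(1) [OF u]) simp
  show "norm (norm (pos_coeff u n / of_real (2*pi * real (Suc n)))) \<le> norm (pos_coeff u n) ^ 2 + 1 / real (Suc n) ^ 2" for n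
  proof -
    define a b where "a = norm (pos_coeff u n)" and "b = 1 / real (Suc n)"
    have ab: "0 \<le> a" "0 \<le> b" by (auto simp: a_def b_def)
    have "0 \<le> a * b" using ab by simp
    moreover have "2 * (a * b) \<le> a^2 + b^2"
      using zero_le_power2 [of "a - b"] by (simp add: power2_eq_square algebra_simps)
    ultimately have le: "a * b \<le> a^2 + b^2" by linarith
    have "norm (pos_coeff u n / of_real (2*pi * real (Suc n))) = a * b / (2*pi)"
      by (simp add: norm_divide norm_mult a_def b_def del: of_nat_Suc)
    also have "\<dots> \<le> a * b / 1" using ab pi_gt3 by (intro divide_left_mono) auto
    finally show ?thesis using le by (simp add: a_def b_def power_divide del: of_nat_Suc)
  qed
qed

lemma Lambda_inv_pairing:
  assumes u: "W14_4 u" and f: "smooth_periodic f"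
  shows "integrable circ (\<lambda>x. Lambda_inv u x * cnj (f x))"
    and "(\<integral>x. Lambda_inv u x * cnj (f x) \<partial>circ) = mass_pairing u f"
proof -
  note s = Lambda_inv_summable [OF u]
  have i: "integrable circ (Lambda_inv u)"
    unfolding Lambda_inv_mode_series by (rule integrable_mode_series [OF s])
  note [measurable] = smooth_periodic_measurable [OF f]
  obtain B where "\<And>x. norm (f x) \<le> B" using smooth_periodic_bounded [OF f] by blast
  then show "integrable circ (\<lambda>x. Lambda_inv u x * cnj (f x))"
    by (intro integrable_mult_bounded [OF i, where B = B]) auto
  have "positive_spectrum (Lambda_inv u)"
    unfolding positive_spectrum_iff Lambda_inv_mode_series fourier_coeff_mode_series [OF s] by auto
  from pairing_smooth [OF i this f]
  have "(\<lambda>n. of_real (2*pi) * (pos_coeff u n / of_real (2*pi * real (Suc n))) * cnj (pos_coeff f n)) sums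
      (\<integral>x. Lambda_inv u x * cnj (f x) \<partial>circ)"
    unfolding Lambda_inv_mode_series fourier_coeff_mode_series [OF s] by simp
  moreover have "of_real (2*pi) * (pos_coeff u n / of_real (2*pi * real (Suc n))) * cnj (pos_coeff f n) =
      pos_coeff u n * cnj (pos_coeff f n) / of_real (real (Suc n))" for n
    by (simp add: field_simps del: of_nat_Suc)
  ultimately show "(\<integral>x. Lambda_inv u x * cnj (f x) \<partial>circ) = mass_pairing u f"
    unfolding mass_pairing_def by (simp only: sums_iff)
qed

text \<open>The gap between the two sides of the Euler-Lagrange equation, tested against \<open>h\<close>.\<close>

definition defect :: "real \<Rightarrow> (real \<Rightarrow> complex) \<Rightarrow> complex \<Rightarrow> complex \<Rightarrow> (real \<Rightarrow> complex) \<Rightarrow> complex" where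
  "defect \<sigma> \<Phi> l \<mu> h = of_real (4 / pi) * form \<sigma> \<Phi> h - l * mass_pairing \<Phi> h - \<mu> * momentum_pairing \<Phi> h"

lemma smooth_W14_4: "smooth_periodic h \<Longrightarrow> W14_4 h"
  by (metis smooth_periodic_chord_lip W14_4_chord_lip)

lemma lagrange_multipliers_iff:
  assumes \<Phi>: "W14_4 \<Phi>"
  shows "lagrange_multipliers \<sigma> \<Phi> l \<mu> \<longleftrightarrow>
    (\<forall>h. smooth_periodic h \<and> positive_spectrum h \<longrightarrow> Re (defect \<sigma> \<Phi> (of_real l) (of_real \<mu>) h) = 0)"
proof -
  have d: "((\<lambda>\<epsilon>::real. let v = (\<lambda>x. \<Phi> x + of_real \<epsilon> * h x) in energy \<sigma> v - l * mass v - \<mu> * momentum v)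
      has_real_derivative 2 * Re (defect \<sigma> \<Phi> (of_real l) (of_real \<mu>) h)) (at 0)"
    if h: "smooth_periodic h" for h
  proof -
    obtain L where L: "chord_lip L h" using smooth_periodic_chord_lip [OF h] by blast
    have m: "((\<lambda>\<epsilon>. mass (\<lambda>x. \<Phi> x + of_real \<epsilon> * h x)) has_real_derivative 2 * Re (mass_pairing \<Phi> h)) (at 0)"
      unfolding mass_expansion [OF \<Phi> smooth_W14_4 [OF h]] by (auto intro!: derivative_eq_intros)
    have p: "((\<lambda>\<epsilon>. momentum (\<lambda>x. \<Phi> x + of_real \<epsilon> * h x)) has_real_derivative 2 * Re (momentum_pairing \<Phi> h)) (at 0)"
      unfolding momentum_expansion [OF \<Phi> smooth_W14_4 [OF h]] by (auto intro!: derivative_eq_intros)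
    have "((\<lambda>\<epsilon>. energy \<sigma> (\<lambda>x. \<Phi> x + of_real \<epsilon> * h x) - l * mass (\<lambda>x. \<Phi> x + of_real \<epsilon> * h x)
        - \<mu> * momentum (\<lambda>x. \<Phi> x + of_real \<epsilon> * h x)) has_real_derivative
        8 / pi * Re (form \<sigma> \<Phi> h) - l * (2 * Re (mass_pairing \<Phi> h)) - \<mu> * (2 * Re (momentum_pairing \<Phi> h))) (at 0)"
      by (intro DERIV_diff DERIV_cmult energy_derivative [OF \<Phi> L] m p)
    moreover have "8 / pi * Re (form \<sigma> \<Phi> h) - l * (2 * Re (mass_pairing \<Phi> h)) - \<mu> * (2 * Re (momentum_pairing \<Phi> h)) =
        2 * Re (defect \<sigma> \<Phi> (of_real l) (of_real \<mu>) h)"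
    proof -
      have "Re (of_real c * z) = c * Re z" for c z by simp
      then show ?thesis unfolding defect_def minus_complex.sel by (simp only: right_diff_distrib)
    qed
    ultimately show ?thesis by (simp add: Let_def)
  qed
  show ?thesis
    unfolding lagrange_multipliers_def using DERIV_unique [OF d] d by fastforce
qed

lemma defect_P_plus:
  assumes \<Phi>: "admissible \<Phi>" and f: "smooth_periodic f"
  shows "mass_pairing \<Phi> (P_plus f) = mass_pairing \<Phi> f" "momentum_pairing \<Phi> (P_plus f) = momentum_pairing \<Phi> f"
  using pairing_P_plus [OF admissibleD(4,2) [OF \<Phi>] f]
  unfolding mass_pairing_def momentum_pairing_def fourier_coeff_P_plus [OF f] by simp_all

lemma weak_right_side:
  assumes \<Phi>: "admissible \<Phi>" and f: "smooth_periodic f"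
  shows "(LINT x:period|lborel. (l * Lambda_inv \<Phi> x + \<mu> * \<Phi> x) * cnj (f x)) =
    l * mass_pairing \<Phi> f + \<mu> * momentum_pairing \<Phi> f"
proof -
  note [measurable] = smooth_periodic_measurable [OF f] admissibleD(3) [OF \<Phi>]
  have [measurable]: "Lambda_inv \<Phi> \<in> borel_measurable borel" unfolding Lambda_inv_mode_series by measurable
  have "(LINT x:period|lborel. (l * Lambda_inv \<Phi> x + \<mu> * \<Phi> x) * cnj (f x)) =
      (\<integral>x. l * (Lambda_inv \<Phi> x * cnj (f x)) + \<mu> * (\<Phi> x * cnj (f x)) \<partial>circ)"
    by (subst LINT_circ) (auto simp: algebra_simps)
  also have "\<dots> = l * (\<integral>x. Lambda_inv \<Phi> x * cnj (f x) \<partial>circ) + \<mu> * (\<integral>x. \<Phi> x * cnj (f x) \<partial>circ)"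
    using Lambda_inv_pairing(1) [OF admissibleD(1) [OF \<Phi>] f] integrable_mult_cnj [OF admissibleD(1) [OF \<Phi>] smooth_W14_4 [OF f]]
    by (subst Bochner_Integration.integral_add) auto
  finally show ?thesis
    unfolding Lambda_inv_pairing(2) [OF admissibleD(1) [OF \<Phi>] f] momentum_pairing_def .
qed

text \<open>Testing against all smooth functions or only against those with positive spectrum is the same:
  both sides see only the projection of the test function.\<close>

lemma euler_lagrange_iff:
  assumes \<Phi>: "admissible \<Phi>"
  shows "euler_lagrange \<sigma> \<Phi> l \<mu> \<longleftrightarrow>
    (\<forall>h. smooth_periodic h \<and> positive_spectrum h \<longrightarrow> defect \<sigma> \<Phi> l \<mu> h = 0)"
proof -
  have e: "of_real (4 / pi) * cubic_pairing \<sigma> \<Phi> \<phi> =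
      (LINT x:period|lborel. (l * Lambda_inv \<Phi> x + \<mu> * \<Phi> x) * cnj (\<phi> x)) \<longleftrightarrow> defect \<sigma> \<Phi> l \<mu> (P_plus \<phi>) = 0"
    if "smooth_periodic \<phi>" for \<phi>
    unfolding weak_right_side [OF \<Phi> that] cubic_pairing_form [OF admissibleD(3) [OF \<Phi>]] defect_def
      defect_P_plus [OF \<Phi> that]
    by (simp only: diff_diff_eq right_minus_eq)
  show ?thesis
    unfolding euler_lagrange_def
    using e P_plus_eq_self smooth_P_plus P_plus_positive by (metis (no_types, lifting))
qed

text \<open>The defect is conjugate linear in \<open>h\<close>, so its real part vanishes for \<open>h\<close> and \<open>\<i>h\<close> only if it
  vanishes.\<close>

lemma defect_cmult:
  assumes \<Phi>: "W14_4 \<Phi>" and h: "smooth_periodic h"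
  shows "defect \<sigma> \<Phi> l \<mu> (\<lambda>x. c * h x) = cnj c * defect \<sigma> \<Phi> l \<mu> h"
proof -
  obtain L where L: "chord_lip L h" using smooth_periodic_chord_lip [OF h] by blast
  have 1: "pos_coeff (\<lambda>x. c * h x) n = c * pos_coeff h n" for n
    by (rule fourier_coeff_cmult)
  have 2: "mass_pairing \<Phi> (\<lambda>x. c * h x) = cnj c * mass_pairing \<Phi> h"
    unfolding mass_pairing_def 1
    using suminf_mult [OF mass_pairing_summable [OF \<Phi> smooth_W14_4 [OF h]], of "cnj c"] by (simp add: mult_ac)
  have "momentum_pairing \<Phi> (\<lambda>x. c * h x) = (\<integral>x. cnj c * (\<Phi> x * cnj (h x)) \<partial>circ)"
    unfolding momentum_pairing_def by (simp add: mult_ac)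
  then have 3: "momentum_pairing \<Phi> (\<lambda>x. c * h x) = cnj c * momentum_pairing \<Phi> h"
    by (simp add: momentum_pairing_def)
  show ?thesis unfolding defect_def 2 3 form_cmult [OF \<Phi> L] by (simp add: algebra_simps)
qed

lemma positive_spectrum_cmult: "positive_spectrum h \<Longrightarrow> positive_spectrum (\<lambda>x. c * h x)"
  by (simp add: positive_spectrum_iff fourier_coeff_cmult)

lemma smooth_periodic_cmult: "smooth_periodic h \<Longrightarrow> smooth_periodic (\<lambda>x. c * h x)"
  using smooth_periodic_lincomb [of "\<lambda>x. 0 * cis (real 0 * x)" h c] smooth_periodic_cis [of 0 0] by simp

lemma lagrange_iff_euler:
  assumes \<Phi>: "admissible \<Phi>"
  shows "lagrange_multipliers \<sigma> \<Phi> l \<mu> \<longleftrightarrow> euler_lagrange \<sigma> \<Phi> (of_real l) (of_real \<mu>)"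
proof
  assume "lagrange_multipliers \<sigma> \<Phi> l \<mu>"
  then have R: "Re (defect \<sigma> \<Phi> (of_real l) (of_real \<mu>) h) = 0" if "smooth_periodic h" "positive_spectrum h" for h
    using that by (simp add: lagrange_multipliers_iff [OF admissibleD(1) [OF \<Phi>]])
  have "defect \<sigma> \<Phi> (of_real l) (of_real \<mu>) h = 0" if h: "smooth_periodic h" "positive_spectrum h" for h
  proof (rule complex_eqI)
    have "Re (defect \<sigma> \<Phi> (of_real l) (of_real \<mu>) (\<lambda>x. \<i> * h x)) = 0"
      by (intro R smooth_periodic_cmult positive_spectrum_cmult h)
    then show "Im (defect \<sigma> \<Phi> (of_real l) (of_real \<mu>) h) = Im 0"
      unfolding defect_cmult [OF admissibleD(1) [OF \<Phi>] h(1)] by simp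
  qed (use R h in simp)
  then show "euler_lagrange \<sigma> \<Phi> (of_real l) (of_real \<mu>)" by (simp add: euler_lagrange_iff [OF \<Phi>])
next
  assume "euler_lagrange \<sigma> \<Phi> (of_real l) (of_real \<mu>)"
  then show "lagrange_multipliers \<sigma> \<Phi> l \<mu>"
    by (simp add: euler_lagrange_iff [OF \<Phi>] lagrange_multipliers_iff [OF admissibleD(1) [OF \<Phi>]])
qed

section \<open>Minimizers have Lagrange multipliers\<close>

text \<open>The modulus of a nonzero coefficient can be corrected to any nearby value at a cost
  proportional to the change of its square.\<close>

lemma adjust_modulus:
  fixes b :: complex
  assumes "b \<noteq> 0" "\<bar>\<delta>\<bar> \<le> norm b ^ 2"
  obtains s where "norm (b + s) ^ 2 = norm b ^ 2 + \<delta>" "norm s \<le> \<bar>\<delta>\<bar> / norm b"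
proof -
  define x where "x = \<delta> / norm b ^ 2"
  have b: "0 < norm b" using assms(1) by simp
  have x: "\<bar>x\<bar> \<le> 1" using assms by (simp add: x_def abs_divide divide_le_eq)
  define r where "r = sqrt (1 + x)"
  have r: "0 \<le> r" "r^2 = 1 + x" using x by (auto simp: r_def)
  have "\<bar>r - 1\<bar> * 1 \<le> \<bar>r - 1\<bar> * (r + 1)" using r by (intro mult_left_mono) auto
  also have "\<dots> = \<bar>(r - 1) * (r + 1)\<bar>" using r by (simp add: abs_mult)
  also have "(r - 1) * (r + 1) = x" using r(2) by (simp add: power2_eq_square algebra_simps)
  finally have rx: "\<bar>r - 1\<bar> \<le> \<bar>x\<bar>" by simp
  show ?thesis
  proof (rule that [of "of_real (r - 1) * b"])
    have "b + of_real (r - 1) * b = of_real r * b" by (simp add: algebra_simps)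
    then have "norm (b + of_real (r - 1) * b) ^ 2 = r^2 * norm b ^ 2"
      by (simp add: norm_mult power_mult_distrib)
    also have "\<dots> = norm b ^ 2 + \<delta>" using b unfolding r(2) by (simp add: x_def field_simps)
    finally show "norm (b + of_real (r - 1) * b) ^ 2 = norm b ^ 2 + \<delta>" .
    have "norm (of_real (r - 1) * b) = \<bar>r - 1\<bar> * norm b" by (simp only: norm_mult norm_of_real)
    also have "\<dots> \<le> \<bar>x\<bar> * norm b" by (intro mult_right_mono rx) simp
    also have "\<dots> = \<bar>\<delta>\<bar> / norm b" using b by (simp add: x_def abs_divide power2_eq_square)
    finally show "norm (of_real (r - 1) * b) \<le> \<bar>\<delta>\<bar> / norm b" .
  qed
qed

text \<open>Changing \<open>|a\<^sub>j|\<^sup>2\<close> and \<open>|a\<^sub>k|\<^sup>2\<close> changes the momentum (divided by \<open>2\<pi>\<close>) and the mass by independent amounts,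
  because the two frequencies differ. The solution is displayed explicitly, since the multipliers are
  read off from it.\<close>

lemma solve_two_frequencies:
  fixes X Y :: real
  assumes "j \<ge> 1" "k \<ge> 1" "j \<noteq> k"
  defines "\<rho> \<equiv> 1 / real j - 1 / real k"
  shows "\<rho> \<noteq> 0" and "(Y - X / real k) / \<rho> + (X - (Y - X / real k) / \<rho>) = X"
    and "(Y - X / real k) / \<rho> / real j + (X - (Y - X / real k) / \<rho>) / real k = Y"
proof -
  show \<rho>: "\<rho> \<noteq> 0" using assms(1-3) by (simp add: \<rho>_def)
  show "(Y - X / real k) / \<rho> + (X - (Y - X / real k) / \<rho>) = X" by simp
  define t where "t = (Y - X / real k) / \<rho>"
  have "t / real j + (X - t) / real k = t * \<rho> + X / real k"
    by (simp add: \<rho>_def algebra_simps diff_divide_distrib)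
  also have "t * \<rho> = Y - X / real k" using \<rho> by (simp add: t_def)
  finally show "(Y - X / real k) / \<rho> / real j + (X - (Y - X / real k) / \<rho>) / real k = Y" by (simp add: t_def)
qed

lemma zero_of_quadratic_lower_bound:
  fixes D :: real
  assumes "0 < e" and bound: "\<And>\<epsilon>. \<bar>\<epsilon>\<bar> \<le> e \<Longrightarrow> 0 \<le> \<epsilon> * D + C * \<epsilon>^2"
  shows "D = 0"
proof (rule ccontr)
  assume D: "D \<noteq> 0"
  define r where "r = min e (\<bar>D\<bar> / (2 * (\<bar>C\<bar> + 1)))"
  have r: "0 < r" "r \<le> e" "r \<le> \<bar>D\<bar> / (2 * (\<bar>C\<bar> + 1))" using assms(1) D by (auto simp: r_def)
  have "0 \<le> (- sgn D * r) * D + C * (- sgn D * r)^2"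
    using r by (intro bound) (auto simp: abs_mult)
  also have "(- sgn D * r) * D = - (r * \<bar>D\<bar>)" by (simp add: abs_sgn mult_ac)
  also have "(- sgn D * r)^2 = r^2" using D by (simp add: power2_eq_square sgn_if)
  finally have "r * \<bar>D\<bar> \<le> r * (C * r)" by (simp add: power2_eq_square mult_ac)
  then have "\<bar>D\<bar> \<le> C * r" using r(1) by simp
  also have "\<dots> \<le> (\<bar>C\<bar> + 1) * r" using r(1) by (intro mult_right_mono) auto
  also have "\<dots> \<le> (\<bar>C\<bar> + 1) * (\<bar>D\<bar> / (2 * (\<bar>C\<bar> + 1)))" using r(3) by (intro mult_left_mono) auto
  also have "\<dots> = \<bar>D\<bar> / 2" by (simp add: field_simps)
  finally show False using D by simp
qed

lemma chord_lip_scaled_mode: "chord_lip (norm s * (1 + real k)) (\<lambda>x. s * mode (int k) x)"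
  by (rule chord_lip_cmult [OF chord_lip_mode])

text \<open>If two modes of a minimizer are active, an increment \<open>h\<close> tangent to both constraints can be
  completed by a second-order change of those two coefficients to an exactly admissible variation.\<close>

lemma tangent_variation:
  assumes min: "minimizer \<sigma> M P \<Phi>"
    and jk: "j \<ge> 1" "k \<ge> 1" "j \<noteq> k" "fourier_coeff \<Phi> (int j) \<noteq> 0" "fourier_coeff \<Phi> (int k) \<noteq> 0"
    and h: "smooth_periodic h" "positive_spectrum h"
    and tangent: "Re (mass_pairing \<Phi> h) = 0" "Re (momentum_pairing \<Phi> h) = 0"
  shows "Re (form \<sigma> \<Phi> h) = 0"
proof -
  have adm: "admissible \<Phi>" and M: "mass \<Phi> = M" and P: "momentum \<Phi> = P"
    and least: "\<And>\<Psi>. admissible \<Psi> \<Longrightarrow> mass \<Psi> = M \<Longrightarrow> momentum \<Psi> = P \<Longrightarrow> energy \<sigma> \<Phi> \<le> energy \<sigma> \<Psi>"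
    using min by (auto simp: minimizer_def is_arg_min_def not_less)
  note \<Phi> = admissibleD(1) [OF adm]
  have hW: "W14_4 h" by (rule smooth_W14_4 [OF h(1)])
  obtain L where L: "chord_lip L h" using smooth_periodic_chord_lip [OF h(1)] by blast
  obtain C where C: "0 \<le> C" "\<And>L h. chord_lip L h \<Longrightarrow>
    \<bar>energy \<sigma> (\<lambda>x. \<Phi> x + h x) - energy \<sigma> \<Phi> - 8 / pi * Re (form \<sigma> \<Phi> h)\<bar> \<le> C * (L^2 + L^4)"
    using energy_expansion [OF \<Phi>] by metis
  define aj ak hj hk where "aj = fourier_coeff \<Phi> (int j)" and "ak = fourier_coeff \<Phi> (int k)"
    and "hj = fourier_coeff h (int j)" and "hk = fourier_coeff h (int k)"
  define X Y where "X = - momentum h / (2*pi)" and "Y = - mass h"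
  define \<alpha> where "\<alpha> = (Y - X / real k) / (1 / real j - 1 / real k)"
  define \<beta> where "\<beta> = X - \<alpha>"
  have \<alpha>\<beta>: "\<alpha> + \<beta> = X" "\<alpha> / real j + \<beta> / real k = Y"
    using solve_two_frequencies(2,3) [OF jk(1-3), where X = X and Y = Y] by (simp_all add: \<alpha>_def \<beta>_def)
  define tj tk where "tj = 2 * \<bar>\<alpha>\<bar> / norm aj" and "tk = 2 * \<bar>\<beta>\<bar> / norm ak"
  have ajk: "0 < norm aj" "0 < norm ak" using jk(4,5) by (auto simp: aj_def ak_def)
  define L1 where "L1 = L + tj * (1 + real j) + tk * (1 + real k)"
  have L1: "0 \<le> L1" using chord_lipD(3) [OF L] ajk by (simp add: L1_def tj_def tk_def)
  define Fj Fk where "Fj = norm (form \<sigma> \<Phi> (mode (int j)))" and "Fk = norm (form \<sigma> \<Phi> (mode (int k)))"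
  have small: "\<exists>e>0. \<forall>\<epsilon>. \<bar>\<epsilon>\<bar> \<le> e \<longrightarrow> \<bar>\<epsilon>\<bar> * norm hc \<le> norm a / 2 \<and> \<bar>\<gamma> * \<epsilon>^2\<bar> \<le> (norm a / 2)^2"
    if a: "0 < norm a" for a hc :: complex and \<gamma> :: real
  proof -
    have "((\<lambda>\<epsilon>. \<bar>\<epsilon>\<bar> * norm hc) \<longlongrightarrow> \<bar>0\<bar> * norm hc) (at (0::real))" by (intro tendsto_intros)
    then have 1: "eventually (\<lambda>\<epsilon>. \<bar>\<epsilon>\<bar> * norm hc < norm a / 2) (at (0::real))"
      using a by (intro order_tendstoD(2)) auto
    have "((\<lambda>\<epsilon>. \<bar>\<gamma> * \<epsilon>^2\<bar>) \<longlongrightarrow> \<bar>\<gamma> * 0^2\<bar>) (at (0::real))" by (intro tendsto_intros)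
    then have 2: "eventually (\<lambda>\<epsilon>. \<bar>\<gamma> * \<epsilon>^2\<bar> < (norm a / 2)^2) (at (0::real))"
      using a by (intro order_tendstoD(2)) auto
    obtain d where d: "0 < d" "\<And>\<epsilon>. \<epsilon> \<noteq> 0 \<Longrightarrow> \<bar>\<epsilon>\<bar> < d \<Longrightarrow> \<bar>\<epsilon>\<bar> * norm hc < norm a / 2 \<and> \<bar>\<gamma> * \<epsilon>^2\<bar> < (norm a / 2)^2"
      using eventually_conj [OF 1 2] by (auto simp: eventually_at dist_real_def)
    have "\<bar>\<epsilon>\<bar> * norm hc \<le> norm a / 2 \<and> \<bar>\<gamma> * \<epsilon>^2\<bar> \<le> (norm a / 2)^2" if "\<bar>\<epsilon>\<bar> \<le> d / 2" for \<epsilon>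
      using d(2) [of \<epsilon>] that d(1) a by (cases "\<epsilon> = 0") auto
    then show ?thesis using d(1) by (intro exI [of _ "d / 2"]) auto
  qed
  obtain ej where ej: "0 < ej" "\<And>\<epsilon>. \<bar>\<epsilon>\<bar> \<le> ej \<Longrightarrow> \<bar>\<epsilon>\<bar> * norm hj \<le> norm aj / 2 \<and> \<bar>\<alpha> * \<epsilon>^2\<bar> \<le> (norm aj / 2)^2"
    using small [OF ajk(1), of hj \<alpha>] by blast
  obtain ek where ek: "0 < ek" "\<And>\<epsilon>. \<bar>\<epsilon>\<bar> \<le> ek \<Longrightarrow> \<bar>\<epsilon>\<bar> * norm hk \<le> norm ak / 2 \<and> \<bar>\<beta> * \<epsilon>^2\<bar> \<le> (norm ak / 2)^2"
    using small [OF ajk(2), of hk \<beta>] by blast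
  define e where "e = min 1 (min ej ek)"
  have e: "0 < e" using ej(1) ek(1) by (simp add: e_def)
  have correct: "\<exists>s. norm (a + of_real \<epsilon> * hc + s) ^ 2 = norm (a + of_real \<epsilon> * hc) ^ 2 + \<gamma> * \<epsilon>^2 \<and> norm s \<le> 2 * \<bar>\<gamma>\<bar> / norm a * \<epsilon>^2"
    if a: "0 < norm a" and s: "\<bar>\<epsilon>\<bar> * norm hc \<le> norm a / 2 \<and> \<bar>\<gamma> * \<epsilon>^2\<bar> \<le> (norm a / 2)^2" for a hc :: complex and \<gamma> \<epsilon> :: real
  proof -
    define b where "b = a + of_real \<epsilon> * hc"
    have "norm a \<le> norm b + norm (of_real \<epsilon> * hc)"
      using norm_triangle_ineq4 [of b "of_real \<epsilon> * hc"] by (simp add: b_def)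
    then have b: "norm a / 2 \<le> norm b" using s by (simp add: norm_mult)
    then have "(norm a / 2)^2 \<le> norm b ^ 2" by (intro power_mono) auto
    then have "\<bar>\<gamma> * \<epsilon>^2\<bar> \<le> norm b ^ 2" using s by linarith
    moreover have "b \<noteq> 0" using b a by auto
    ultimately obtain s where s': "norm (b + s) ^ 2 = norm b ^ 2 + \<gamma> * \<epsilon>^2" "norm s \<le> \<bar>\<gamma> * \<epsilon>^2\<bar> / norm b"
      by (metis adjust_modulus)
    note s'(2)
    also have "\<bar>\<gamma> * \<epsilon>^2\<bar> / norm b \<le> \<bar>\<gamma> * \<epsilon>^2\<bar> / (norm a / 2)"
      using b a by (intro divide_left_mono) (auto intro!: mult_pos_pos less_le_trans [OF _ b])
    also have "\<dots> = 2 * \<bar>\<gamma>\<bar> / norm a * \<epsilon>^2" by (simp add: abs_mult)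
    finally show ?thesis using s'(1) b_def by blast
  qed
  have key: "0 \<le> \<epsilon> * (8 / pi * Re (form \<sigma> \<Phi> h)) + (8 / pi * (tj * Fj + tk * Fk) + C * (L1^2 + L1^4)) * \<epsilon>^2"
    if \<epsilon>: "\<bar>\<epsilon>\<bar> \<le> e" for \<epsilon>
  proof -
    have \<epsilon>': "\<bar>\<epsilon>\<bar> \<le> 1" "\<bar>\<epsilon>\<bar> \<le> ej" "\<bar>\<epsilon>\<bar> \<le> ek" using \<epsilon> by (auto simp: e_def)
    have \<epsilon>2: "\<epsilon>^2 \<le> 1" "\<epsilon>^2 \<le> \<bar>\<epsilon>\<bar>"
    proof -
      have "\<bar>\<epsilon>\<bar> * \<bar>\<epsilon>\<bar> \<le> 1 * \<bar>\<epsilon>\<bar>" using \<epsilon>' by (intro mult_right_mono) auto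
      then show "\<epsilon>^2 \<le> \<bar>\<epsilon>\<bar>" by (simp add: power2_eq_square abs_mult_self_eq)
      then show "\<epsilon>^2 \<le> 1" using \<epsilon>' by linarith
    qed
    obtain s where s: "norm (aj + of_real \<epsilon> * hj + s) ^ 2 = norm (aj + of_real \<epsilon> * hj) ^ 2 + \<alpha> * \<epsilon>^2" "norm s \<le> tj * \<epsilon>^2"
      using correct [OF ajk(1) ej(2) [OF \<epsilon>'(2)]] unfolding tj_def by blast
    obtain t where t: "norm (ak + of_real \<epsilon> * hk + t) ^ 2 = norm (ak + of_real \<epsilon> * hk) ^ 2 + \<beta> * \<epsilon>^2" "norm t \<le> tk * \<epsilon>^2"
      using correct [OF ajk(2) ek(2) [OF \<epsilon>'(3)]] unfolding tk_def by blast
    define v where "v x = \<Phi> x + of_real \<epsilon> * h x" for x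
    define v1 where "v1 x = v x + s * mode (int j) x" for x
    define w where "w x = v1 x + t * mode (int k) x" for x
    have fv: "fourier_coeff v i = fourier_coeff \<Phi> i + of_real \<epsilon> * fourier_coeff h i" for i
      unfolding v_def [abs_def] by (rule fourier_coeff_lincomb [OF admissibleD(4) [OF adm] integrable_smooth [OF h(1)]])
    have v: "admissible v"
      unfolding admissible_def positive_spectrum_iff fv
      using W14_4_add(1) [OF \<Phi> W14_4_cmult(1) [OF hW, of "of_real \<epsilon>"]] adm h(2)
      by (auto simp: v_def [abs_def] admissible_def positive_spectrum_iff)
    have vmass: "mass v = M + \<epsilon>^2 * mass h" and vmom: "momentum v = P + \<epsilon>^2 * momentum h"
      unfolding v_def [abs_def] mass_expansion [OF \<Phi> hW] momentum_expansion [OF \<Phi> hW] tangent M P by simp_all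
    have v1: "admissible v1" "mass v1 = mass v + \<alpha> * \<epsilon>^2 / real j" "momentum v1 = momentum v + 2*pi * (\<alpha> * \<epsilon>^2)"
      unfolding v1_def [abs_def]
        mass_add_mode [OF admissibleD(1) [OF v] jk(1)] momentum_add_mode [OF admissibleD(1) [OF v]]
        fv aj_def [symmetric] hj_def [symmetric] s(1)
      using admissible_add_mode [OF v jk(1), of s] by simp_all
    have fv1: "fourier_coeff v1 (int k) = ak + of_real \<epsilon> * hk"
      unfolding v1_def [abs_def] fourier_coeff_add_mode [OF admissibleD(4) [OF v]] fv
      using jk(3) by (simp add: ak_def hk_def)
    have w: "admissible w" "mass w = mass v1 + \<beta> * \<epsilon>^2 / real k" "momentum w = momentum v1 + 2*pi * (\<beta> * \<epsilon>^2)"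
      unfolding w_def [abs_def]
        mass_add_mode [OF admissibleD(1) [OF v1(1)] jk(2)] momentum_add_mode [OF admissibleD(1) [OF v1(1)]]
        fv1 t(1)
      using admissible_add_mode [OF v1(1) jk(2), of t] by simp_all
    have "mass w = M + \<epsilon>^2 * (mass h + (\<alpha> / real j + \<beta> / real k))"
      unfolding w(2) v1(2) vmass by (simp add: algebra_simps)
    then have wM: "mass w = M" unfolding \<alpha>\<beta> Y_def by simp
    have "momentum w = P + \<epsilon>^2 * (momentum h + 2*pi * (\<alpha> + \<beta>))"
      unfolding w(3) v1(3) vmom by (simp add: algebra_simps)
    then have wP: "momentum w = P" unfolding \<alpha>\<beta> X_def by simp
    define g where "g x = (of_real \<epsilon> * h x + s * mode (int j) x) + t * mode (int k) x" for x
    have wg: "w = (\<lambda>x. \<Phi> x + g x)" by (auto simp: w_def v1_def v_def g_def)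
    have g1: "chord_lip (\<bar>\<epsilon>\<bar> * L + norm s * (1 + real j)) (\<lambda>x. of_real \<epsilon> * h x + s * mode (int j) x)"
      using chord_lip_add [OF chord_lip_cmult [OF L, of "of_real \<epsilon>"] chord_lip_scaled_mode [of s j]] by simp
    have "chord_lip (\<bar>\<epsilon>\<bar> * L + norm s * (1 + real j) + norm t * (1 + real k)) g"
      unfolding g_def [abs_def] by (rule chord_lip_add [OF g1 chord_lip_scaled_mode])
    moreover have "\<bar>\<epsilon>\<bar> * L + norm s * (1 + real j) + norm t * (1 + real k) \<le> \<bar>\<epsilon>\<bar> * L1"
    proof -
      have tt: "0 \<le> tj" "0 \<le> tk" by (auto simp: tj_def tk_def)
      have "norm s \<le> tj * \<bar>\<epsilon>\<bar>" by (rule order_trans [OF s(2)]) (intro mult_left_mono \<epsilon>2 tt)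
      then have "norm s * (1 + real j) \<le> tj * \<bar>\<epsilon>\<bar> * (1 + real j)" by (intro mult_right_mono) auto
      moreover have "norm t \<le> tk * \<bar>\<epsilon>\<bar>" by (rule order_trans [OF t(2)]) (intro mult_left_mono \<epsilon>2 tt)
      then have "norm t * (1 + real k) \<le> tk * \<bar>\<epsilon>\<bar> * (1 + real k)" by (intro mult_right_mono) auto
      ultimately show ?thesis unfolding L1_def by (simp add: algebra_simps)
    qed
    ultimately have g: "chord_lip (\<bar>\<epsilon>\<bar> * L1) g" by (rule chord_lip_mono)
    have "form \<sigma> \<Phi> g = form \<sigma> \<Phi> (\<lambda>x. of_real \<epsilon> * h x + s * mode (int j) x) + cnj t * form \<sigma> \<Phi> (mode (int k))"
      unfolding g_def by (rule form_lincomb [OF \<Phi> g1 chord_lip_mode])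
    also have "form \<sigma> \<Phi> (\<lambda>x. of_real \<epsilon> * h x + s * mode (int j) x) = of_real \<epsilon> * form \<sigma> \<Phi> h + cnj s * form \<sigma> \<Phi> (mode (int j))"
      using form_lincomb [OF \<Phi> chord_lip_cmult [OF L, of "of_real \<epsilon>"] chord_lip_mode, of \<sigma> s j] form_cmult [OF \<Phi> L, of \<sigma> "of_real \<epsilon>"] by simp
    finally have fg: "form \<sigma> \<Phi> g = of_real \<epsilon> * form \<sigma> \<Phi> h + cnj s * form \<sigma> \<Phi> (mode (int j)) + cnj t * form \<sigma> \<Phi> (mode (int k))" .
    have "Re (cnj s * form \<sigma> \<Phi> (mode (int j))) \<le> norm s * Fj"
      using complex_Re_le_cmod [of "cnj s * form \<sigma> \<Phi> (mode (int j))"] by (simp add: norm_mult Fj_def)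
    also have "\<dots> \<le> tj * \<epsilon>^2 * Fj" by (intro mult_right_mono s(2)) (simp add: Fj_def)
    finally have Rj: "Re (cnj s * form \<sigma> \<Phi> (mode (int j))) \<le> tj * \<epsilon>^2 * Fj" .
    have "Re (cnj t * form \<sigma> \<Phi> (mode (int k))) \<le> norm t * Fk"
      using complex_Re_le_cmod [of "cnj t * form \<sigma> \<Phi> (mode (int k))"] by (simp add: norm_mult Fk_def)
    also have "\<dots> \<le> tk * \<epsilon>^2 * Fk" by (intro mult_right_mono t(2)) (simp add: Fk_def)
    finally have Rk: "Re (cnj t * form \<sigma> \<Phi> (mode (int k))) \<le> tk * \<epsilon>^2 * Fk" .
    have "Re (form \<sigma> \<Phi> g) = \<epsilon> * Re (form \<sigma> \<Phi> h) + Re (cnj s * form \<sigma> \<Phi> (mode (int j))) + Re (cnj t * form \<sigma> \<Phi> (mode (int k)))"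
      unfolding fg plus_complex.sel by simp
    also have "\<dots> \<le> \<epsilon> * Re (form \<sigma> \<Phi> h) + tj * \<epsilon>^2 * Fj + tk * \<epsilon>^2 * Fk" using Rj Rk by (intro add_mono order_refl)
    finally have "8 / pi * Re (form \<sigma> \<Phi> g) \<le> 8 / pi * (\<epsilon> * Re (form \<sigma> \<Phi> h) + tj * \<epsilon>^2 * Fj + tk * \<epsilon>^2 * Fk)"
      by (intro mult_left_mono) auto
    moreover have "energy \<sigma> \<Phi> \<le> energy \<sigma> (\<lambda>x. \<Phi> x + g x)" using least [OF w(1) wM wP] by (simp add: wg)
    moreover have "\<bar>energy \<sigma> (\<lambda>x. \<Phi> x + g x) - energy \<sigma> \<Phi> - 8 / pi * Re (form \<sigma> \<Phi> g)\<bar> \<le> C * ((\<bar>\<epsilon>\<bar> * L1)^2 + (\<bar>\<epsilon>\<bar> * L1)^4)"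
      by (rule C(2) [OF g])
    moreover have "C * ((\<bar>\<epsilon>\<bar> * L1)^2 + (\<bar>\<epsilon>\<bar> * L1)^4) \<le> C * (L1^2 + L1^4) * \<epsilon>^2"
    proof -
      have "(\<bar>\<epsilon>\<bar> * L1)^2 + (\<bar>\<epsilon>\<bar> * L1)^4 = \<epsilon>^2 * (L1^2 + \<epsilon>^2 * L1^4)"
        by (simp add: power_mult_distrib power2_eq_square power4_eq_xxxx algebra_simps)
      also have "\<dots> \<le> \<epsilon>^2 * (L1^2 + 1 * L1^4)" using \<epsilon>2(1) by (intro mult_left_mono add_left_mono mult_right_mono) auto
      finally show ?thesis using C(1) by (simp add: mult_left_mono mult_ac)
    qed
    ultimately have "0 \<le> 8 / pi * (\<epsilon> * Re (form \<sigma> \<Phi> h) + tj * \<epsilon>^2 * Fj + tk * \<epsilon>^2 * Fk) + C * (L1^2 + L1^4) * \<epsilon>^2"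
      by linarith
    also have "\<dots> = \<epsilon> * (8 / pi * Re (form \<sigma> \<Phi> h)) + (8 / pi * (tj * Fj + tk * Fk) + C * (L1^2 + L1^4)) * \<epsilon>^2"
      by (simp add: distrib_left distrib_right add_divide_distrib mult_ac)
    finally show ?thesis .
  qed
  have "8 / pi * Re (form \<sigma> \<Phi> h) = 0" by (rule zero_of_quadratic_lower_bound [OF e key])
  then show ?thesis by simp
qed

lemma mass_pairing_lincomb:
  assumes u: "W14_4 u" and g: "W14_4 g" and h: "W14_4 h"
  shows "mass_pairing u (\<lambda>x. g x + c * h x) = mass_pairing u g + cnj c * mass_pairing u h"
proof -
  have e: "pos_coeff u n * cnj (pos_coeff (\<lambda>x. g x + c * h x) n) / of_real (real (Suc n)) =
      pos_coeff u n * cnj (pos_coeff g n) / of_real (real (Suc n)) +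
      cnj c * (pos_coeff u n * cnj (pos_coeff h n) / of_real (real (Suc n)))" for n
    unfolding fourier_coeff_lincomb [OF W14_4_integrable [OF g] W14_4_integrable [OF h]]
    by (simp add: algebra_simps add_divide_distrib del: of_nat_Suc)
  have "(\<lambda>n. pos_coeff u n * cnj (pos_coeff (\<lambda>x. g x + c * h x) n) / of_real (real (Suc n))) sums
      (mass_pairing u g + cnj c * mass_pairing u h)"
    unfolding e mass_pairing_def
    by (intro sums_add sums_mult summable_sums mass_pairing_summable u g h)
  then show ?thesis unfolding mass_pairing_def [of u "\<lambda>x. g x + c * h x"] by (rule sums_unique [symmetric])
qed

lemma momentum_pairing_lincomb:
  assumes u: "W14_4 u" and g: "W14_4 g" and h: "W14_4 h"
  shows "momentum_pairing u (\<lambda>x. g x + c * h x) = momentum_pairing u g + cnj c * momentum_pairing u h"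
proof -
  have "momentum_pairing u (\<lambda>x. g x + c * h x) = (\<integral>x. u x * cnj (g x) + cnj c * (u x * cnj (h x)) \<partial>circ)"
    unfolding momentum_pairing_def by (simp add: algebra_simps)
  then show ?thesis
    unfolding momentum_pairing_def
      Bochner_Integration.integral_add [OF integrable_mult_cnj [OF u g] integrable_mult_right [OF integrable_mult_cnj [OF u h]]]
    by simp
qed

lemma mass_pairing_mode:
  assumes "k \<ge> 1"
  shows "mass_pairing u (mode (int k)) = fourier_coeff u (int k) / of_nat k"
proof -
  have "pos_coeff u n * cnj (pos_coeff (mode (int k)) n) / of_real (real (Suc n)) =
      (if n = k - 1 then pos_coeff u n / of_real (real (Suc n)) else 0)" for n
    unfolding fourier_coeff_mode using assms by (auto simp del: of_nat_Suc)
  then have "mass_pairing u (mode (int k)) = (\<Sum>n. if n = k - 1 then pos_coeff u n / of_real (real (Suc n)) else 0)"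
    by (simp only: mass_pairing_def)
  also have "\<dots> = pos_coeff u (k - 1) / of_real (real (Suc (k - 1)))"
    by (rule sums_unique [symmetric], rule sums_single)
  finally show ?thesis using assms by simp
qed

lemma momentum_pairing_mode: "integrable circ u \<Longrightarrow> momentum_pairing u (mode k) = of_real (2*pi) * fourier_coeff u k"
  unfolding momentum_pairing_def by (rule fourier_coeff_eq)

lemma smooth_mode: "smooth_periodic (mode (int k))"
  using smooth_periodic_cis [of 1 k] by simp

lemma smooth_add_mode:
  "smooth_periodic h \<Longrightarrow> smooth_periodic (\<lambda>x. h x + c * mode (int k) x)"
  by (rule smooth_periodic_lincomb [OF _ smooth_mode])

lemma positive_add_mode:
  assumes "smooth_periodic h" "positive_spectrum h" "k \<ge> 1"
  shows "positive_spectrum (\<lambda>x. h x + c * mode (int k) x)"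
  unfolding positive_spectrum_iff fourier_coeff_add_mode [OF integrable_smooth [OF assms(1)]]
  using assms(2,3) by (auto simp: positive_spectrum_iff)

text \<open>With two active modes, every increment splits into a tangent one and a real combination of
  the two modes; the first variation on the latter is a combination of the first variations of mass
  and momentum.\<close>

lemma two_mode_multipliers:
  assumes min: "minimizer \<sigma> M P \<Phi>"
    and jk: "j \<ge> 1" "k \<ge> 1" "j \<noteq> k" "fourier_coeff \<Phi> (int j) \<noteq> 0" "fourier_coeff \<Phi> (int k) \<noteq> 0"
  shows "\<exists>l \<mu>. lagrange_multipliers \<sigma> \<Phi> l \<mu>"
proof -
  have adm: "admissible \<Phi>" using min by (auto simp: minimizer_def is_arg_min_def)
  note \<Phi> = admissibleD(1) [OF adm]
  define aj ak where "aj = fourier_coeff \<Phi> (int j)" and "ak = fourier_coeff \<Phi> (int k)"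
  have ajk: "0 < norm aj" "0 < norm ak" using jk(4,5) by (auto simp: aj_def ak_def)
  define \<rho> where "\<rho> = 1 / real j - 1 / real k"
  have \<rho>: "\<rho> \<noteq> 0" using solve_two_frequencies(1) [OF jk(1-3)] by (simp add: \<rho>_def)
  define \<tau>j where "\<tau>j = Re (cnj aj * form \<sigma> \<Phi> (mode (int j))) / norm aj ^ 2"
  define \<tau>k where "\<tau>k = Re (cnj ak * form \<sigma> \<Phi> (mode (int k))) / norm ak ^ 2"
  define \<kappa> where "\<kappa> = (\<tau>j - \<tau>k) / \<rho>"
  define l where "l = 4 / pi * \<kappa>"
  define \<mu> where "\<mu> = 4 / pi * (\<tau>k - \<kappa> / real k) / (2*pi)"
  have "Re (defect \<sigma> \<Phi> (of_real l) (of_real \<mu>) h) = 0" if h: "smooth_periodic h" "positive_spectrum h" for h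
  proof -
    define B A where "B = Re (mass_pairing \<Phi> h)" and "A = Re (momentum_pairing \<Phi> h) / (2*pi)"
    define X where "X = (B - A / real k) / \<rho>"
    define Y where "Y = A - X"
    have XY: "X + Y = A" "X / real j + Y / real k = B"
      using solve_two_frequencies(2,3) [OF jk(1-3), where X = A and Y = B] by (simp_all add: X_def Y_def \<rho>_def)
    define p q where "p = X / norm aj ^ 2" and "q = Y / norm ak ^ 2"
    define g where "g x = h x + (- (of_real p * aj)) * mode (int j) x" for x
    define h' where "h' x = g x + (- (of_real q * ak)) * mode (int k) x" for x
    have g: "smooth_periodic g" "positive_spectrum g"
      unfolding g_def [abs_def] by (intro smooth_add_mode positive_add_mode h jk)+
    have h': "smooth_periodic h'" "positive_spectrum h'"
      unfolding h'_def [abs_def] by (intro smooth_add_mode positive_add_mode g jk)+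
    obtain L where L: "chord_lip L h" using smooth_periodic_chord_lip [OF h(1)] by blast
    obtain K where K: "chord_lip K g" using smooth_periodic_chord_lip [OF g(1)] by blast
    note W = smooth_W14_4 [OF h(1)] smooth_W14_4 [OF g(1)] smooth_W14_4 [OF smooth_mode]
    have pa: "Re (cnj (- (of_real p * aj)) * aj) = - X" "Re (cnj (- (of_real q * ak)) * ak) = - Y"
    proof -
      have "cnj aj * aj = of_real (norm aj ^ 2)" "cnj ak * ak = of_real (norm ak ^ 2)"
        using complex_norm_square [of aj] complex_norm_square [of ak] by (simp_all add: mult.commute)
      then have "cnj (- (of_real p * aj)) * aj = of_real (- (p * norm aj ^ 2))"
        "cnj (- (of_real q * ak)) * ak = of_real (- (q * norm ak ^ 2))"
        by (simp_all add: mult.assoc)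
      then show "Re (cnj (- (of_real p * aj)) * aj) = - X" "Re (cnj (- (of_real q * ak)) * ak) = - Y"
        using ajk by (simp_all only: Re_complex_of_real) (simp_all add: p_def q_def)
    qed
    have m: "mass_pairing \<Phi> h' = mass_pairing \<Phi> h + cnj (- (of_real p * aj)) * aj / of_real (real j)
        + cnj (- (of_real q * ak)) * ak / of_real (real k)"
    proof -
      have "mass_pairing \<Phi> h' = mass_pairing \<Phi> g + cnj (- (of_real q * ak)) * mass_pairing \<Phi> (mode (int k))"
        unfolding h'_def [abs_def] by (rule mass_pairing_lincomb [OF \<Phi> W(2,3)])
      moreover have "mass_pairing \<Phi> g = mass_pairing \<Phi> h + cnj (- (of_real p * aj)) * mass_pairing \<Phi> (mode (int j))"
        unfolding g_def [abs_def] by (rule mass_pairing_lincomb [OF \<Phi> W(1,3)])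
      ultimately show ?thesis
        unfolding mass_pairing_mode [OF jk(1)] mass_pairing_mode [OF jk(2)] aj_def ak_def by simp
    qed
    have "Re (mass_pairing \<Phi> h') = B - X / real j - Y / real k"
      unfolding m plus_complex.sel Re_divide_of_real pa B_def by simp
    then have t1: "Re (mass_pairing \<Phi> h') = 0" using XY(2) by simp
    have m: "momentum_pairing \<Phi> h' = momentum_pairing \<Phi> h + of_real (2*pi) * (cnj (- (of_real p * aj)) * aj)
        + of_real (2*pi) * (cnj (- (of_real q * ak)) * ak)"
    proof -
      have "momentum_pairing \<Phi> h' = momentum_pairing \<Phi> g + cnj (- (of_real q * ak)) * momentum_pairing \<Phi> (mode (int k))"
        unfolding h'_def [abs_def] by (rule momentum_pairing_lincomb [OF \<Phi> W(2,3)])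
      moreover have "momentum_pairing \<Phi> g = momentum_pairing \<Phi> h + cnj (- (of_real p * aj)) * momentum_pairing \<Phi> (mode (int j))"
        unfolding g_def [abs_def] by (rule momentum_pairing_lincomb [OF \<Phi> W(1,3)])
      ultimately show ?thesis
        unfolding momentum_pairing_mode [OF admissibleD(4) [OF adm]] aj_def ak_def by (simp add: mult_ac)
    qed
    have Re_mult: "Re (of_real c * z) = c * Re z" for c z by simp
    have "Re (momentum_pairing \<Phi> h') = 2*pi * A - 2*pi * X - 2*pi * Y"
      unfolding m plus_complex.sel Re_mult pa A_def by simp
    then have t2: "Re (momentum_pairing \<Phi> h') = 0" using XY(1) by (simp flip: right_diff_distrib)
    have "Re (form \<sigma> \<Phi> h') = 0" by (rule tangent_variation [OF min jk h' t1 t2])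
    moreover have "form \<sigma> \<Phi> h' = form \<sigma> \<Phi> h + of_real (- p) * (cnj aj * form \<sigma> \<Phi> (mode (int j)))
        + of_real (- q) * (cnj ak * form \<sigma> \<Phi> (mode (int k)))"
    proof -
      have "form \<sigma> \<Phi> h' = form \<sigma> \<Phi> g + cnj (- (of_real q * ak)) * form \<sigma> \<Phi> (mode (int k))"
        unfolding h'_def [abs_def] by (rule form_lincomb [OF \<Phi> K chord_lip_mode])
      moreover have "form \<sigma> \<Phi> g = form \<sigma> \<Phi> h + cnj (- (of_real p * aj)) * form \<sigma> \<Phi> (mode (int j))"
        unfolding g_def [abs_def] by (rule form_lincomb [OF \<Phi> L chord_lip_mode])
      ultimately show ?thesis by (simp add: mult.assoc)
    qed
    ultimately have "Re (form \<sigma> \<Phi> h) = p * (norm aj ^ 2 * \<tau>j) + q * (norm ak ^ 2 * \<tau>k)"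
      using ajk unfolding \<tau>j_def \<tau>k_def by (simp only: plus_complex.sel Re_mult) simp
    also have "\<dots> = X * \<tau>j + Y * \<tau>k" using ajk by (simp add: p_def q_def)
    also have "\<dots> = X * (\<tau>j - \<tau>k) + A * \<tau>k" by (simp add: Y_def algebra_simps)
    also have "\<tau>j - \<tau>k = \<rho> * \<kappa>" using \<rho> by (simp add: \<kappa>_def)
    also have "X * (\<rho> * \<kappa>) = X * \<rho> * \<kappa>" by simp
    also have "X * \<rho> = B - A / real k" using \<rho> by (simp add: X_def)
    finally have F: "Re (form \<sigma> \<Phi> h) = (B - A / real k) * \<kappa> + A * \<tau>k" .
    have "Re (defect \<sigma> \<Phi> (of_real l) (of_real \<mu>) h) = 4 / pi * Re (form \<sigma> \<Phi> h) - l * B - \<mu> * (2*pi * A)"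
      unfolding defect_def minus_complex.sel Re_mult B_def A_def by simp
    also have "\<dots> = 0"
      unfolding F l_def \<mu>_def by (simp add: algebra_simps add_divide_distrib diff_divide_distrib)
    finally show ?thesis .
  qed
  then show ?thesis by (auto simp: lagrange_multipliers_iff [OF \<Phi>])
qed

subsection \<open>A single mode\<close>

lemma cubic_kernel_mode_bounded:
  assumes "\<Phi> = (\<lambda>x. a * mode (int k) x)"
  shows "norm (cubic_kernel \<Phi> x y) \<le> 4 * (norm a * (1 + real k)) ^ 3"
proof -
  let ?L = "norm a * (1 + real k)"
  have \<Phi>: "chord_lip ?L \<Phi>" unfolding assms by (rule chord_lip_scaled_mode)
  have L0: "0 \<le> ?L" by simp
  define q where "q = 1 - cos (x - y)"
  have q: "0 \<le> q" unfolding q_def by (rule one_minus_cos_bounds)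
  have n: "norm (cubic_kernel \<Phi> x y) = norm (\<Phi> x - \<Phi> y) ^ 2 / q * norm (\<Phi> x - \<Phi> y)"
    unfolding cubic_kernel_def norm_mult norm_of_real q_def [symmetric] using q by simp
  have "norm (\<Phi> x - \<Phi> y) ^ 2 / q \<le> 2 * ?L^2"
  proof -
    have "q = 0 \<or> 0 < q" using q by linarith
    then show ?thesis
      using chord_lip_sq [OF \<Phi>, of x y, folded q_def] by (auto simp: pos_divide_le_eq)
  qed
  moreover have "norm (\<Phi> x - \<Phi> y) \<le> norm (\<Phi> x) + norm (\<Phi> y)" by (rule norm_triangle_ineq4)
  then have "norm (\<Phi> x - \<Phi> y) \<le> 2 * ?L" using chord_lipD(1) [OF \<Phi>, of x] chord_lipD(1) [OF \<Phi>, of y] by linarith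
  ultimately have "norm (cubic_kernel \<Phi> x y) \<le> (2 * ?L^2) * (2 * ?L)"
    unfolding n using q by (intro mult_mono) auto
  also have "\<dots> = 4 * ?L ^ 3" by (simp add: power2_eq_square power3_eq_cube)
  finally show ?thesis .
qed

text \<open>By translation invariance the cubic term of a pure mode is a multiple of that mode.\<close>

lemma cubic_bracket_mode:
  assumes \<Phi>_def: "\<Phi> = (\<lambda>x. a * mode (int k) x)"
  shows "cubic_bracket \<sigma> \<Phi> x = mode (int k) x * cubic_bracket \<sigma> \<Phi> 0"
proof -
  have \<Phi>: "chord_lip (norm a * (1 + real k)) \<Phi>" unfolding \<Phi>_def by (rule chord_lip_scaled_mode)
  note [measurable] = chord_lip_measurable [OF \<Phi>]
  have per: "periodic_2pi \<Phi>" by (rule chord_lip_periodic [OF \<Phi>])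
  have Kper: "periodic_2pi (\<lambda>y. cubic_kernel \<Phi> 0 y)"
    using per cos_periodic [of "- (y::real)" for y] by (simp add: periodic_2pi_def cubic_kernel_def)
  have Km [measurable]: "(\<lambda>y. cubic_kernel \<Phi> z y) \<in> borel_measurable borel" for z
    unfolding cubic_kernel_def by measurable
  have shift: "\<Phi> y = mode (int k) x * \<Phi> (y - x)" for y
  proof -
    have "mode (int k) x * mode (int k) (y - x) = mode (int k) y" by (simp add: cis_mult algebra_simps)
    then show ?thesis unfolding \<Phi>_def by (metis mult.left_commute)
  qed
  have K: "cubic_kernel \<Phi> x y = mode (int k) x * cubic_kernel \<Phi> 0 (y + (- x))" for y
  proof -
    have d: "\<Phi> x - \<Phi> y = mode (int k) x * (\<Phi> 0 - \<Phi> (y - x))"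
      using shift [of x] shift [of y] by (simp add: right_diff_distrib)
    have "cos (x - y) = cos (0 - (y + - x))" by simp
    then show ?thesis unfolding cubic_kernel_def d norm_mult by simp
  qed
  have "(LINT y:period|lborel. cubic_kernel \<Phi> x y) = (\<integral>y. cubic_kernel \<Phi> x y \<partial>circ)"
    by (rule LINT_circ) measurable
  also have "\<dots> = mode (int k) x * (\<integral>y. cubic_kernel \<Phi> 0 (y + (- x)) \<partial>circ)"
    unfolding K by (rule integral_mult_right_zero)
  also have "(\<integral>y. cubic_kernel \<Phi> 0 (y + (- x)) \<partial>circ) = (\<integral>y. cubic_kernel \<Phi> 0 y \<partial>circ)"
    by (rule integral_circ_shift(2) [OF Km Kper])
  also have "\<dots> = (LINT y:period|lborel. cubic_kernel \<Phi> 0 y)"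
    by (rule LINT_circ [symmetric]) measurable
  finally have I: "(LINT y:period|lborel. cubic_kernel \<Phi> x y) = mode (int k) x * (LINT y:period|lborel. cubic_kernel \<Phi> 0 y)" .
  have "norm (\<Phi> x) = norm (\<Phi> 0)" by (simp add: \<Phi>_def norm_mult)
  moreover have "\<Phi> x = mode (int k) x * \<Phi> 0" using shift [of x] by simp
  ultimately show ?thesis unfolding cubic_bracket_def I by (simp add: algebra_simps)
qed

lemma form_self_real:
  assumes u: "chord_lip L u"
  shows "form \<sigma> u u \<in> \<real>"
proof -
  have e: "z * cnj z = of_real (norm z ^ 2)" for z :: complex
    using complex_norm_square [of z] by simp
  have 1: "cubic_kernel u x y * cnj (u x - u y) = of_real (norm (u x - u y) ^ 2 / (1 - cos (x - y)) * norm (u x - u y) ^ 2)" for x y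
    unfolding cubic_kernel_def mult.assoc e of_real_mult ..
  have 2: "of_real (\<sigma> * norm (u x) ^ 2) * u x * cnj (u x) = of_real (\<sigma> * norm (u x) ^ 2 * norm (u x) ^ 2)" for x
    unfolding mult.assoc e by simp
  show ?thesis unfolding form_def 1 2 integral_complex_of_real by (intro Reals_diff Reals_divide) simp_all
qed

lemma form_cong_AE:
  assumes [measurable]: "u \<in> borel_measurable borel" "v \<in> borel_measurable borel" "g \<in> borel_measurable borel"
    and ae: "AE x in circ. u x = v x"
  shows "form \<sigma> u g = form \<sigma> v g"
proof -
  have "(\<integral>p. cubic_kernel u (fst p) (snd p) * cnj (g (fst p) - g (snd p)) \<partial>circ2) =
      (\<integral>p. cubic_kernel v (fst p) (snd p) * cnj (g (fst p) - g (snd p)) \<partial>circ2)"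
  proof (rule integral_cong_AE)
    show "AE p in circ2. cubic_kernel u (fst p) (snd p) * cnj (g (fst p) - g (snd p)) =
        cubic_kernel v (fst p) (snd p) * cnj (g (fst p) - g (snd p))"
      using AE_circ2_both [OF ae] by eventually_elim (simp add: cubic_kernel_def)
  qed measurable
  moreover have "(\<integral>x. of_real (\<sigma> * norm (u x) ^ 2) * u x * cnj (g x) \<partial>circ) =
      (\<integral>x. of_real (\<sigma> * norm (v x) ^ 2) * v x * cnj (g x) \<partial>circ)"
  proof (rule integral_cong_AE)
    show "AE x in circ. of_real (\<sigma> * norm (u x) ^ 2) * u x * cnj (g x) = of_real (\<sigma> * norm (v x) ^ 2) * v x * cnj (g x)"
      using ae by eventually_elim simp
  qed measurable
  ultimately show ?thesis by (simp add: form_def)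
qed

text \<open>A pure mode is critical because its cubic term is a multiple of itself; the multiple is real because
  the form is real on the diagonal. By completeness the profile is that mode almost everywhere.\<close>

lemma single_mode_multipliers:
  assumes adm: "admissible \<Phi>" and k: "k \<ge> 1" and a: "fourier_coeff \<Phi> (int k) \<noteq> 0"
    and only: "\<And>j. j \<ge> 1 \<Longrightarrow> j \<noteq> k \<Longrightarrow> fourier_coeff \<Phi> (int j) = 0"
  shows "\<exists>\<mu>. lagrange_multipliers \<sigma> \<Phi> 0 \<mu>"
proof -
  note [measurable] = admissibleD(3) [OF adm]
  define a where "a = fourier_coeff \<Phi> (int k)"
  define \<Psi> where "\<Psi> = (\<lambda>x. a * mode (int k) x)"
  have \<Psi>: "chord_lip (norm a * (1 + real k)) \<Psi>" unfolding \<Psi>_def by (rule chord_lip_scaled_mode)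
  note [measurable] = chord_lip_measurable [OF \<Psi>]
  have \<Psi>W: "W14_4 \<Psi>" by (rule W14_4_chord_lip [OF \<Psi>])
  define d where "d x = \<Phi> x + (- a) * mode (int k) x" for x
  have "fourier_coeff d i = 0" for i
  proof -
    have f: "fourier_coeff d i = fourier_coeff \<Phi> i + (if int k = i then - a else 0)"
      unfolding d_def [abs_def] by (rule fourier_coeff_add_mode [OF admissibleD(4) [OF adm]])
    show ?thesis
    proof (cases "i \<ge> 1")
      case True
      then obtain j where "i = int j" "j \<ge> 1" by (metis int_nat_eq nat_int_comparison(3) of_nat_1 zero_le_one order_trans)
      then show ?thesis unfolding f using only [of j] by (auto simp: a_def)
    next
      case False
      then show ?thesis unfolding f using admissibleD(2) [OF adm] k by (auto simp: positive_spectrum_iff)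
    qed
  qed
  then have "AE x in circ. d x = 0"
    unfolding d_def [abs_def] by (intro fourier_complete W14_4_add_mode admissibleD(1) [OF adm])
  then have ae: "AE x in circ. \<Phi> x = \<Psi> x" by eventually_elim (simp add: d_def \<Psi>_def)
  define c where "c = cubic_bracket \<sigma> \<Psi> 0"
  have form_h: "form \<sigma> \<Psi> h = (c / a) * momentum_pairing \<Psi> h" if h: "smooth_periodic h" "positive_spectrum h" for h
  proof -
    obtain B where B: "\<And>x. norm (h x) \<le> B" using smooth_periodic_bounded [OF h(1)] by blast
    note [measurable] = smooth_periodic_measurable [OF h(1)]
    have "set_integrable lborel (period \<times> period) (\<lambda>(x, y). cubic_kernel \<Psi> x y)"
    proof -
      have e: "(\<lambda>(x, y). cubic_kernel \<Psi> x y) = (\<lambda>p. cubic_kernel \<Psi> (fst p) (snd p))" by auto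
      have "integrable circ2 (\<lambda>p. cubic_kernel \<Psi> (fst p) (snd p))"
        by (rule circ2.integrable_const_bound [of _ "4 * (norm a * (1 + real k)) ^ 3"])
          (auto intro!: AE_I2 cubic_kernel_mode_bounded [OF \<Psi>_def])
      then show ?thesis unfolding e by (subst set_integrable_circ2) auto
    qed
    then have "cubic_pairing \<sigma> \<Psi> h = (LINT x:period|lborel. cubic_bracket \<sigma> \<Psi> x * cnj (P_plus h x))"
      by (rule cubic_pairing_eq [OF \<Psi>W, where B = B]) (use B h in \<open>simp_all add: P_plus_eq_self\<close>)
    also have "\<dots> = (LINT x:period|lborel. (c / a) * (\<Psi> x * cnj (h x)))"
    proof -
      have "cubic_bracket \<sigma> \<Psi> x * cnj (h x) = (c / a) * (\<Psi> x * cnj (h x))" for x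
      proof -
        have "cubic_bracket \<sigma> \<Psi> x = mode (int k) x * c"
          unfolding c_def by (rule cubic_bracket_mode [OF \<Psi>_def])
        moreover have "(c / a) * (\<Psi> x * cnj (h x)) = (mode (int k) x * c) * cnj (h x)"
          using a by (simp add: \<Psi>_def a_def)
        ultimately show ?thesis by simp
      qed
      then show ?thesis unfolding P_plus_eq_self [OF h] by (simp only:)
    qed
    also have "\<dots> = (c / a) * momentum_pairing \<Psi> h"
      unfolding momentum_pairing_def by (subst LINT_circ) auto
    finally show ?thesis unfolding cubic_pairing_form [OF chord_lip_measurable [OF \<Psi>]] P_plus_eq_self [OF h] .
  qed
  have \<Psi>s: "smooth_periodic \<Psi>" "positive_spectrum \<Psi>"
    unfolding \<Psi>_def positive_spectrum_iff fourier_coeff_cmult fourier_coeff_mode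
    using k smooth_periodic_cis [of a k] by auto
  have real: "c / a \<in> \<real>"
  proof -
    have "momentum_pairing \<Psi> \<Psi> = of_real (2*pi) * (a * cnj a)"
    proof -
      have "\<Psi> x * cnj (\<Psi> x) = a * cnj a" for x by (simp add: \<Psi>_def mult_ac cis_cnj cis_mult)
      then show ?thesis by (simp add: momentum_pairing_def scaleR_conv_of_real)
    qed
    also have "a * cnj a = of_real (norm a ^ 2)" using complex_norm_square [of a] by simp
    finally have "form \<sigma> \<Psi> \<Psi> = (c / a) * of_real (2*pi * norm a ^ 2)" using form_h [OF \<Psi>s] by simp
    then have "c / a = form \<sigma> \<Psi> \<Psi> / of_real (2*pi * norm a ^ 2)"
      using a by (simp add: a_def)
    then show ?thesis using form_self_real [OF \<Psi>] by (simp only: Reals_divide Reals_of_real)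
  qed
  define \<mu> where "\<mu> = 4 / pi * Re (c / a)"
  have ca: "c / a = of_real (Re (c / a))" using real by (metis of_real_Re)
  have "defect \<sigma> \<Phi> (of_real 0) (of_real \<mu>) h = 0" if h: "smooth_periodic h" "positive_spectrum h" for h
  proof -
    note [measurable] = smooth_periodic_measurable [OF h(1)]
    have "form \<sigma> \<Phi> h = form \<sigma> \<Psi> h" by (rule form_cong_AE [OF _ _ _ ae]) measurable
    moreover have "momentum_pairing \<Phi> h = momentum_pairing \<Psi> h"
      unfolding momentum_pairing_def
    proof (rule integral_cong_AE)
      show "AE x in circ. \<Phi> x * cnj (h x) = \<Psi> x * cnj (h x)" using ae by eventually_elim simp
    qed measurable
    ultimately have "defect \<sigma> \<Phi> (of_real 0) (of_real \<mu>) h =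
        of_real (4 / pi) * ((c / a) * momentum_pairing \<Psi> h) - of_real \<mu> * momentum_pairing \<Psi> h"
      unfolding defect_def form_h [OF h] by simp
    also have "\<dots> = (of_real (4 / pi) * (c / a) - of_real \<mu>) * momentum_pairing \<Psi> h"
      by (simp add: left_diff_distrib)
    also have "of_real (4 / pi) * (c / a) = of_real \<mu>"
      by (subst ca) (simp add: \<mu>_def)
    finally show ?thesis by simp
  qed
  then have "lagrange_multipliers \<sigma> \<Phi> 0 \<mu>"
    unfolding lagrange_multipliers_iff [OF admissibleD(1) [OF adm]] by simp
  then show ?thesis by blast
qed

text \<open>The gradients of mass and momentum are linearly independent unless a single mode is active; in that
  case the constraint qualification fails, but the equation holds by symmetry.\<close>

theorem minimizer_multipliers:
  assumes min: "minimizer \<sigma> M P \<Phi>" and M: "M > 0"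
  shows "\<exists>l \<mu>. lagrange_multipliers \<sigma> \<Phi> l \<mu>"
proof -
  have adm: "admissible \<Phi>" and mass: "mass \<Phi> = M" using min by (auto simp: minimizer_def is_arg_min_def)
  obtain n where n: "pos_coeff \<Phi> n \<noteq> 0"
  proof (rule ccontr)
    assume "\<not> thesis"
    then have "pos_coeff \<Phi> n = 0" for n using that by blast
    then have "mass \<Phi> = 0" by (simp add: mass_def)
    then show False using mass M by simp
  qed
  show ?thesis
  proof (cases "\<exists>k\<ge>1. k \<noteq> Suc n \<and> fourier_coeff \<Phi> (int k) \<noteq> 0")
    case True
    then obtain k where "k \<ge> 1" "k \<noteq> Suc n" "fourier_coeff \<Phi> (int k) \<noteq> 0" by blast
    then show ?thesis using two_mode_multipliers [OF min, of "Suc n" k] n by auto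
  next
    case False
    then show ?thesis using single_mode_multipliers [OF adm _ n] by fastforce
  qed
qed

section \<open>Travelling waves\<close>

text \<open>The translation falls on the smooth test function, the profile itself being only in \<open>W14_4\<close>.\<close>

lemma momentum_pairing_derivative:
  assumes u: "integrable circ u" and f: "smooth_periodic f"
  shows "((\<lambda>s. momentum_pairing u (\<lambda>x. f (x + V * s))) has_vector_derivative
    of_real V * momentum_pairing u (\<lambda>x. vderiv f (x + V * t))) (at t)"
proof -
  note f' = smooth_periodic_D(3) [OF f]
  note [measurable] = smooth_periodic_measurable [OF f] smooth_periodic_measurable [OF f']
  have [measurable]: "u \<in> borel_measurable borel" using u by blast
  obtain B where B: "\<And>x. norm (vderiv (vderiv f) x) \<le> B"
    using smooth_periodic_bounded [OF smooth_periodic_D(3) [OF f']] by blast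
  obtain B0 where B0: "\<And>x. norm (f x) \<le> B0" using smooth_periodic_bounded [OF f] by blast
  obtain B1 where B1: "\<And>x. norm (vderiv f x) \<le> B1" using smooth_periodic_bounded [OF f'] by blast
  have taylor: "norm (f (x + h) - f x - h *\<^sub>R vderiv f x) \<le> B * h^2" for x h
  proof -
    define S where "S = closed_segment x (x + h)"
    define k where "k y = f y - y *\<^sub>R vderiv f x" for y
    have "norm (k (x + h) - k x) \<le> (B * \<bar>h\<bar>) * norm ((x + h) - x)"
    proof (rule differentiable_bound [of S k "\<lambda>y d. d *\<^sub>R (vderiv f y - vderiv f x)"])
      fix y assume y: "y \<in> S"
      have "((\<lambda>y. y *\<^sub>R vderiv f x) has_vector_derivative vderiv f x) (at y)"
        unfolding has_vector_derivative_def
        by (rule bounded_linear_imp_has_derivative [OF bounded_linear_scaleR_left])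
      from has_vector_derivative_diff [OF smooth_periodic_D(2) [OF f] this]
      have "(k has_vector_derivative (vderiv f y - vderiv f x)) (at y within S)"
        unfolding k_def [abs_def] by (rule has_vector_derivative_at_within)
      then show "(k has_derivative (\<lambda>d. d *\<^sub>R (vderiv f y - vderiv f x))) (at y within S)"
        by (simp add: has_vector_derivative_def)
      have yx: "\<bar>y - x\<bar> \<le> \<bar>h\<bar>"
        using y by (auto simp: S_def closed_segment_eq_real_ivl split: if_splits)
      have "norm (vderiv f y - vderiv f x) \<le> B * \<bar>y - x\<bar>"
        by (rule bounded_vderiv_lipschitz [OF smooth_periodic_D(2) [OF f'] B])
      also have "\<dots> \<le> B * \<bar>h\<bar>" using yx order_trans [OF norm_ge_zero B] by (intro mult_left_mono) auto
      finally show "onorm (\<lambda>d. d *\<^sub>R (vderiv f y - vderiv f x)) \<le> B * \<bar>h\<bar>"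
        by (intro onorm_le) (simp add: mult.commute mult_left_mono)
    qed (auto simp: S_def)
    then show ?thesis by (simp add: k_def algebra_simps power2_eq_square abs_mult_self_eq)
  qed
  let ?I = "\<integral>x. norm (u x) \<partial>circ"
  show ?thesis
  proof (rule has_vector_derivative_of_quadratic [where C = "?I * (B * V^2)"])
    fix h :: real
    have i0: "integrable circ (\<lambda>x. u x * cnj (f (x + V * s)))" for s
      by (rule integrable_mult_bounded [OF u, where B = B0]) (auto simp: B0)
    have i1: "integrable circ (\<lambda>x. u x * cnj (vderiv f (x + V * s)))" for s
      by (rule integrable_mult_bounded [OF u, where B = B1]) (auto simp: B1)
    define R where "R x = f ((x + V * t) + V * h) - f (x + V * t) - (V * h) *\<^sub>R vderiv f (x + V * t)" for x
    have e: "u x * cnj (R x) = u x * cnj (f (x + V * (t + h))) - u x * cnj (f (x + V * t)) - of_real (V * h) * (u x * cnj (vderiv f (x + V * t)))" for x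
      by (simp add: R_def algebra_simps scaleR_conv_of_real)
    have a: "(\<integral>x. u x * cnj (R x) \<partial>circ) = momentum_pairing u (\<lambda>x. f (x + V * (t + h))) - momentum_pairing u (\<lambda>x. f (x + V * t))
        - of_real (V * h) * momentum_pairing u (\<lambda>x. vderiv f (x + V * t))"
      unfolding e momentum_pairing_def
        Bochner_Integration.integral_diff [OF Bochner_Integration.integrable_diff [OF i0 i0] integrable_mult_right [OF i1]]
        Bochner_Integration.integral_diff [OF i0 i0] integral_mult_right_zero ..
    have "norm (\<integral>x. u x * cnj (R x) \<partial>circ) \<le> (\<integral>x. norm (u x) * (B * (V * h)^2) \<partial>circ)"
    proof (rule Bochner_Integration.integral_norm_bound_integral)
      show "integrable circ (\<lambda>x. u x * cnj (R x))"
        unfolding e by (intro Bochner_Integration.integrable_diff integrable_mult_right i0 i1)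
      show "norm (u x * cnj (R x)) \<le> norm (u x) * (B * (V * h)^2)" for x
        unfolding norm_mult complex_mod_cnj R_def by (intro mult_left_mono taylor) auto
    qed (use u in simp)
    also have "\<dots> = ?I * (B * V^2) * h^2"
      by (simp add: power_mult_distrib)
    also have "(\<integral>x. u x * cnj (R x) \<partial>circ) = momentum_pairing u (\<lambda>x. f (x + V * (t + h))) - momentum_pairing u (\<lambda>x. f (x + V * t))
        - h *\<^sub>R (of_real V * momentum_pairing u (\<lambda>x. vderiv f (x + V * t)))"
      unfolding a by (simp add: scaleR_conv_of_real mult_ac)
    finally show "norm (momentum_pairing u (\<lambda>x. f (x + V * (t + h))) - momentum_pairing u (\<lambda>x. f (x + V * t))
        - h *\<^sub>R (of_real V * momentum_pairing u (\<lambda>x. vderiv f (x + V * t)))) \<le> ?I * (B * V^2) * h^2" .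
  qed
qed

subsection \<open>Translation and phase rotation\<close>

lemma periodic_shift: "periodic_2pi f \<Longrightarrow> periodic_2pi (\<lambda>x. f (x + a))"
  unfolding periodic_2pi_def by (metis add.assoc add.commute)

lemma fourier_coeff_shift:
  assumes [measurable]: "u \<in> borel_measurable borel" and per: "periodic_2pi u"
  shows "fourier_coeff (\<lambda>x. u (x + a)) k = mode k a * fourier_coeff u k"
proof -
  have e: "u (x + a) * cis (- (of_int k * x)) = mode k a * (u (x + a) * cis (- (of_int k * (x + a))))" for x
    by (simp add: cis_mult algebra_simps)
  have "periodic_2pi (\<lambda>x. u x * cis (- (of_int k * x)))" by (rule periodic_mult_mode [OF per])
  then have "(\<integral>x. u (x + a) * cis (- (of_int k * (x + a))) \<partial>circ) = (\<integral>x. u x * cis (- (of_int k * x)) \<partial>circ)"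
    by (intro integral_circ_shift(2)) measurable
  then show ?thesis
    unfolding fourier_coeff_circ [OF assms(1)] by (subst fourier_coeff_circ) (simp_all only: e integral_mult_right_zero, simp_all)
qed

lemma gag_shift: "gag (\<lambda>x. u (x + a)) p = gag u (fst p + a, snd p + a)"
  by (simp add: gag_def)

lemma W14_4_shift:
  assumes u: "W14_4 u" shows "W14_4 (\<lambda>x. u (x + a))"
proof -
  note [measurable] = W14_4D(2) [OF u]
  note per = W14_4D(1) [OF u]
  have "integrable circ (\<lambda>x. norm (u (x + a)) ^ 4)"
    using integral_circ_shift(1) [of "\<lambda>x. norm (u x) ^ 4" a] W14_4D(3) [OF u] per
    by (simp add: periodic_2pi_def)
  moreover have "integrable circ2 (gag (\<lambda>x. u (x + a)))"
  proof -
    have m: "(\<lambda>(x, y). gag u (x, y)) \<in> borel_measurable (borel \<Otimes>\<^sub>M borel)"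
      using gag_measurable [OF W14_4D(2) [OF u]] by simp
    have c: "cos (x + 2*pi - y) = cos (x - y)" "cos (x - (y + 2*pi)) = cos (x - y)" for x y :: real
      using cos_periodic [of "x - y"] cos_periodic [of "x - (y + 2*pi)"] by (simp_all add: algebra_simps)
    have "integrable circ2 (\<lambda>(x, y). gag u (x + a, y + a)) \<longleftrightarrow> integrable circ2 (\<lambda>(x, y). gag u (x, y))"
      by (rule integral_circ2_shift(1) [OF m]) (use per in \<open>simp_all add: periodic_2pi_def gag_def c\<close>)
    then show ?thesis using W14_4D(4) [OF u] by (simp add: gag_shift [abs_def] case_prod_unfold)
  qed
  ultimately show ?thesis using periodic_shift [OF per] by (simp add: W14_4_iff)
qed

lemma admissible_shift:
  assumes u: "admissible u" shows "admissible (\<lambda>x. b * u (x + a))"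
  using W14_4_cmult(1) [OF W14_4_shift [OF admissibleD(1) [OF u]], of b a] admissibleD(2) [OF u]
  by (simp add: admissible_def positive_spectrum_iff fourier_coeff_cmult
      fourier_coeff_shift [OF admissibleD(3) [OF u] W14_4D(1) [OF admissibleD(1) [OF u]]])

lemma P_plus_shift:
  assumes f: "smooth_periodic f"
  shows "P_plus (\<lambda>x. f (x + a)) = (\<lambda>x. P_plus f (x + a))"
proof
  fix x
  have "pos_coeff (\<lambda>x. f (x + a)) n * cis (real (Suc n) * x) = pos_coeff f n * cis (real (Suc n) * (x + a))" for n
    unfolding fourier_coeff_shift [OF smooth_periodic_measurable [OF f] smooth_periodic_D(1) [OF f]]
    by (simp add: cis_mult algebra_simps)
  then show "P_plus (\<lambda>x. f (x + a)) x = P_plus f (x + a)"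
    unfolding P_plus_mode_series mode_series_def by (simp only:)
qed

lemma form_shift:
  assumes [measurable]: "u \<in> borel_measurable borel" and per: "periodic_2pi u" and g: "chord_lip L g" and b: "norm b = 1"
  shows "form \<sigma> (\<lambda>x. b * u (x + a)) (\<lambda>x. g (x + a)) = b * form \<sigma> u g"
proof -
  note [measurable] = chord_lip_measurable [OF g]
  have gper: "periodic_2pi g" by (rule chord_lip_periodic [OF g])
  define F where "F x y = cubic_kernel u x y * cnj (g x - g y)" for x y
  have c: "cos (x + 2*pi - y) = cos (x - y)" "cos (x - (y + 2*pi)) = cos (x - y)" for x y :: real
    using cos_periodic [of "x - y"] cos_periodic [of "x - (y + 2*pi)"] by (simp_all add: algebra_simps)
  have m: "(\<lambda>(x, y). F x y) \<in> borel_measurable (borel \<Otimes>\<^sub>M borel)"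
    unfolding F_def case_prod_unfold by measurable
  have "(\<integral>(x, y). F (x + a) (y + a) \<partial>circ2) = (\<integral>(x, y). F x y \<partial>circ2)"
    by (rule integral_circ2_shift(2) [OF m])
      (use per gper in \<open>simp_all add: periodic_2pi_def F_def cubic_kernel_def c\<close>)
  then have 1: "(\<integral>p. F (fst p + a) (snd p + a) \<partial>circ2) = (\<integral>p. F (fst p) (snd p) \<partial>circ2)"
    by (simp add: case_prod_unfold)
  define G where "G x = of_real (\<sigma> * norm (u x) ^ 2) * u x * cnj (g x)" for x
  have 2: "(\<integral>x. G (x + a) \<partial>circ) = (\<integral>x. G x \<partial>circ)"
  proof (rule integral_circ_shift(2))
    show "G \<in> borel_measurable borel" unfolding G_def [abs_def] by measurable
    show "periodic_2pi G" using per gper by (simp add: periodic_2pi_def G_def)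
  qed
  have k: "cubic_kernel (\<lambda>x. b * u (x + a)) x y = b * cubic_kernel u (x + a) (y + a)" for x y
    unfolding cubic_kernel_def right_diff_distrib [symmetric] norm_mult b by simp
  have 3: "cubic_kernel (\<lambda>x. b * u (x + a)) x y * cnj (g (x + a) - g (y + a)) = b * F (x + a) (y + a)" for x y
    unfolding k F_def by simp
  have 4: "of_real (\<sigma> * norm (b * u (x + a)) ^ 2) * (b * u (x + a)) * cnj (g (x + a)) = b * G (x + a)" for x
    unfolding G_def norm_mult b by simp
  show ?thesis
    unfolding form_def 3 4 integral_mult_right_zero 1 2 unfolding F_def G_def
    by (simp add: right_diff_distrib)
qed

subsection \<open>The profile equation\<close>

lemma mass_pairing_vderiv:
  assumes \<Phi>: "admissible \<Phi>" and f: "smooth_periodic f"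
  shows "mass_pairing \<Phi> (vderiv f) = - \<i> * momentum_pairing \<Phi> f / of_real (2*pi)"
proof -
  have e: "pos_coeff \<Phi> n * cnj (pos_coeff (vderiv f) n) / of_real (real (Suc n)) =
      (- \<i> / of_real (2*pi)) * (of_real (2*pi) * pos_coeff \<Phi> n * cnj (pos_coeff f n))" for n
    unfolding fourier_coeff_vderiv [OF f] by (simp add: field_simps del: of_nat_Suc)
  have "(\<lambda>n. (- \<i> / of_real (2*pi)) * (of_real (2*pi) * pos_coeff \<Phi> n * cnj (pos_coeff f n))) sums
      ((- \<i> / of_real (2*pi)) * momentum_pairing \<Phi> f)"
    unfolding momentum_pairing_def by (rule sums_mult [OF pairing_smooth [OF admissibleD(4,2) [OF \<Phi>] f]])
  then show ?thesis unfolding mass_pairing_def e by (simp add: sums_iff)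
qed

text \<open>Only positive frequencies are tested, and on these differentiation is invertible.\<close>

lemma P_plus_antiderivative:
  assumes f: "smooth_periodic f"
  obtains g where "smooth_periodic g" "vderiv g = P_plus f"
proof -
  define c where "c n = pos_coeff f n / (\<i> * of_nat (Suc n))" for n
  have c': "\<i> * of_nat (Suc n) * c n = pos_coeff f n" for n by (simp add: c_def del: of_nat_Suc)
  note s = summable_fourier_coeff(1) [OF f]
  have s1: "summable (\<lambda>n. norm (of_nat (Suc n) * c n))"
    using s unfolding c' [symmetric] by (simp add: norm_mult del: of_nat_Suc)
  have s2: "summable (\<lambda>n. norm (c n))"
  proof (rule summable_comparison_test' [OF s])
    show "norm (norm (c n)) \<le> norm (pos_coeff f n)" for n
    proof -
      have "1 * norm (c n) \<le> real (Suc n) * norm (c n)" by (intro mult_right_mono) auto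
      then show ?thesis unfolding c' [symmetric] by (simp add: norm_mult del: of_nat_Suc)
    qed
  qed
  have d: "(mode_series c has_vector_derivative P_plus f x) (at x)" for x
    using mode_series_derivative [OF s2 s1] unfolding c' P_plus_mode_series .
  have "smooth_periodic (mode_series c)"
  proof (rule smooth_periodic_coinduct [where X = "\<lambda>g. g = mode_series c \<or> smooth_periodic g"])
    fix g assume "g = mode_series c \<or> smooth_periodic g"
    then show "periodic_2pi g \<and> (\<exists>g'. (g' = mode_series c \<or> smooth_periodic g') \<and> (\<forall>x. (g has_vector_derivative g' x) (at x)))"
    proof
      assume "g = mode_series c"
      then show ?thesis using d mode_series_periodic smooth_P_plus [OF f] by blast
    next
      assume g: "smooth_periodic g"
      then show ?thesis using smooth_periodic_D [OF g] by blast
    qed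
  qed simp
  moreover have "vderiv (mode_series c) = P_plus f" using d by (auto intro: vector_derivative_at)
  ultimately show ?thesis by (rule that)
qed

lemma profile_equation_iff:
  assumes \<Phi>: "admissible \<Phi>"
  shows "profile_equation \<sigma> \<Phi> c \<omega> \<longleftrightarrow> (\<forall>f. smooth_periodic f \<longrightarrow>
    - c * momentum_pairing \<Phi> f + \<omega> * mass_pairing \<Phi> f = form \<sigma> \<Phi> (P_plus f))"
proof -
  have "(LINT x:period|lborel. (- c * \<Phi> x + \<omega> * Lambda_inv \<Phi> x) * cnj (f x)) =
      - c * momentum_pairing \<Phi> f + \<omega> * mass_pairing \<Phi> f" if "smooth_periodic f" for f
    using weak_right_side [OF \<Phi> that, of \<omega> "- c"] by (simp add: add.commute)
  then show ?thesis
    unfolding profile_equation_def cubic_pairing_form [OF admissibleD(3) [OF \<Phi>]] by metis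
qed

lemma euler_iff_profile:
  assumes \<Phi>: "admissible \<Phi>" and c: "c = - of_real (pi/4) * \<mu>" and \<omega>: "\<omega> = of_real (pi/4) * l"
  shows "euler_lagrange \<sigma> \<Phi> l \<mu> \<longleftrightarrow> profile_equation \<sigma> \<Phi> c \<omega>"
proof -
  have e: "of_real (4 / pi) * z = l * m + \<mu> * p \<longleftrightarrow> - c * p + \<omega> * m = z" for z m p
    unfolding c \<omega> by (auto simp: field_simps)
  have "euler_lagrange \<sigma> \<Phi> l \<mu> \<longleftrightarrow> (\<forall>f. smooth_periodic f \<longrightarrow>
      of_real (4 / pi) * form \<sigma> \<Phi> (P_plus f) = l * mass_pairing \<Phi> f + \<mu> * momentum_pairing \<Phi> f)"
    unfolding euler_lagrange_def cubic_pairing_form [OF admissibleD(3) [OF \<Phi>]]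
    by (rule iff_allI, rule imp_cong [OF refl]) (simp only: weak_right_side [OF \<Phi>])
  then show ?thesis unfolding profile_equation_iff [OF \<Phi>] e .
qed

text \<open>The equation for the wave, tested against \<open>\<phi>\<close> at time \<open>t\<close>, is the profile equation tested
  against the derivative of \<open>\<phi>\<close> translated by \<open>V t\<close>.\<close>

lemma profile_iff_solution:
  assumes \<Phi>: "admissible \<Phi>" and \<kappa>: "\<kappa> \<noteq> 0"
  shows "profile_equation \<sigma> \<Phi> (of_real c) (of_real \<omega>) \<longleftrightarrow> filamentation_solution \<kappa> \<sigma> (profile_wave \<kappa> \<Phi> c \<omega>)"
proof -
  note [measurable] = admissibleD(3) [OF \<Phi>]
  note per = W14_4D(1) [OF admissibleD(1) [OF \<Phi>]]
  define V W where "V = \<kappa> * c" and "W = \<kappa> * \<omega> / (2*pi)"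
  define u where "u = profile_wave \<kappa> \<Phi> c \<omega>"
  have u: "u t = (\<lambda>x. cis (W * t) * \<Phi> (x + (- (V * t))))" for t
    by (rule ext) (simp add: u_def profile_wave_def travelling_wave_def V_def W_def mult.commute)
  have adm: "admissible (u t)" for t unfolding u by (rule admissible_shift [OF \<Phi>])
  have rhs: "cubic_pairing \<sigma> (u t) (vderiv f) = cis (W * t) * form \<sigma> \<Phi> (P_plus (\<lambda>x. vderiv f (x + V * t)))"
    if f: "smooth_periodic f" for f t
  proof -
    have f': "smooth_periodic (\<lambda>x. vderiv f (x + V * t))"
      by (rule smooth_periodic_shift(1) [OF smooth_periodic_D(3) [OF f]])
    obtain L where L: "chord_lip L (P_plus (\<lambda>x. vderiv f (x + V * t)))"
      using smooth_periodic_chord_lip [OF smooth_P_plus [OF f']] by blast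
    have "P_plus (vderiv f) = (\<lambda>x. P_plus (\<lambda>x. vderiv f (x + V * t)) (x + (- (V * t))))"
      unfolding P_plus_shift [OF smooth_periodic_D(3) [OF f]] by simp
    then have "cubic_pairing \<sigma> (u t) (vderiv f) =
        form \<sigma> (\<lambda>x. cis (W * t) * \<Phi> (x + (- (V * t)))) (\<lambda>x. P_plus (\<lambda>x. vderiv f (x + V * t)) (x + (- (V * t))))"
      unfolding cubic_pairing_form [OF admissibleD(3) [OF adm]] unfolding u by (simp only:)
    also have "\<dots> = cis (W * t) * form \<sigma> \<Phi> (P_plus (\<lambda>x. vderiv f (x + V * t)))"
      by (rule form_shift [OF _ per L]) auto
    finally show ?thesis .
  qed
  have lhs: "(LINT x:period|lborel. u s x * cnj (f x)) = cis (W * s) * momentum_pairing \<Phi> (\<lambda>x. f (x + V * s))"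
    if f: "smooth_periodic f" for f s
  proof -
    note [measurable] = smooth_periodic_measurable [OF f]
    define F where "F x = \<Phi> x * cnj (f (x + V * s))" for x
    have Fm: "F \<in> borel_measurable borel" unfolding F_def [abs_def] by measurable
    have Fper: "periodic_2pi F"
      using per periodic_shift [OF smooth_periodic_D(1) [OF f], of "V * s"] by (simp add: periodic_2pi_def F_def)
    have "(LINT x:period|lborel. u s x * cnj (f x)) = (\<integral>x. cis (W * s) * F (x + (- (V * s))) \<partial>circ)"
      unfolding u by (subst LINT_circ) (auto simp: F_def mult.assoc)
    also have "\<dots> = cis (W * s) * (\<integral>x. F (x + (- (V * s))) \<partial>circ)" by (rule integral_mult_right_zero)
    also have "(\<integral>x. F (x + (- (V * s))) \<partial>circ) = (\<integral>x. F x \<partial>circ)"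
      by (rule integral_circ_shift(2) [OF Fm Fper])
    finally show ?thesis by (simp add: momentum_pairing_def F_def)
  qed
  have deriv: "((\<lambda>s. LINT x:period|lborel. u s x * cnj (f x)) has_vector_derivative
      cis (W * t) * (\<i> * of_real W * momentum_pairing \<Phi> (\<lambda>x. f (x + V * t)) + of_real V * momentum_pairing \<Phi> (\<lambda>x. vderiv f (x + V * t)))) (at t)"
    if f: "smooth_periodic f" for f t
  proof -
    have "((\<lambda>z. exp (\<i> * of_real W * z)) has_field_derivative (\<i> * of_real W) * exp (\<i> * of_real W * of_real t)) (at (of_real t))"
      by (auto intro!: derivative_eq_intros)
    from has_vector_derivative_real_field [OF this]
    have "((\<lambda>s. cis (W * s)) has_vector_derivative (\<i> * of_real W) * cis (W * t)) (at t)"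
      by (simp add: cis_conv_exp mult.assoc)
    from has_vector_derivative_mult [OF this momentum_pairing_derivative [OF admissibleD(4) [OF \<Phi>] f, of V t]]
    show ?thesis unfolding lhs [OF f] by (simp add: algebra_simps)
  qed
  have sol: "filamentation_solution \<kappa> \<sigma> u \<longleftrightarrow> (\<forall>f. smooth_periodic f \<longrightarrow>
      \<i> * of_real W * momentum_pairing \<Phi> f + of_real V * momentum_pairing \<Phi> (vderiv f) = - of_real \<kappa> * form \<sigma> \<Phi> (P_plus (vderiv f)))"
    (is "_ \<longleftrightarrow> (\<forall>f. smooth_periodic f \<longrightarrow> ?E f)")
  proof
    assume S: "filamentation_solution \<kappa> \<sigma> u"
    show "\<forall>f. smooth_periodic f \<longrightarrow> ?E f"
    proof (intro allI impI)
      fix f assume f: "smooth_periodic f"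
      have "((\<lambda>s. LINT x:period|lborel. u s x * cnj (f x)) has_vector_derivative
          - of_real \<kappa> * cubic_pairing \<sigma> (u 0) (vderiv f)) (at 0)"
        using S f unfolding filamentation_solution_def by blast
      from vector_derivative_unique_at [OF this deriv [OF f]] show "?E f"
        unfolding rhs [OF f] by simp
    qed
  next
    assume E: "\<forall>f. smooth_periodic f \<longrightarrow> ?E f"
    show "filamentation_solution \<kappa> \<sigma> u"
      unfolding filamentation_solution_def
    proof (intro conjI allI impI adm)
      fix f t assume f: "smooth_periodic f"
      have "?E (\<lambda>x. f (x + V * t))" using E smooth_periodic_shift(1) [OF f] by blast
      then have "cis (W * t) * (\<i> * of_real W * momentum_pairing \<Phi> (\<lambda>x. f (x + V * t)) + of_real V * momentum_pairing \<Phi> (\<lambda>x. vderiv f (x + V * t)))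
          = - of_real \<kappa> * cubic_pairing \<sigma> (u t) (vderiv f)"
        unfolding smooth_periodic_shift(2) [OF f] rhs [OF f] by simp
      with deriv [OF f, of t] show "((\<lambda>s. LINT x:period|lborel. u s x * cnj (f x)) has_vector_derivative
          - of_real \<kappa> * cubic_pairing \<sigma> (u t) (vderiv f)) (at t)"
        by simp
    qed
  qed
  have test: "\<i> * of_real W * momentum_pairing \<Phi> f + of_real V * momentum_pairing \<Phi> (vderiv f) = - of_real \<kappa> * z \<longleftrightarrow>
      - of_real c * momentum_pairing \<Phi> (vderiv f) + of_real \<omega> * mass_pairing \<Phi> (vderiv f) = z" if f: "smooth_periodic f" for f z
  proof -
    have "\<i> * of_real W * momentum_pairing \<Phi> f + of_real V * momentum_pairing \<Phi> (vderiv f) =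
        - of_real \<kappa> * (- of_real c * momentum_pairing \<Phi> (vderiv f) + of_real \<omega> * mass_pairing \<Phi> (vderiv f))"
      unfolding mass_pairing_vderiv [OF \<Phi> f] by (simp add: V_def W_def algebra_simps)
    then show ?thesis using \<kappa> by simp
  qed
  have "profile_equation \<sigma> \<Phi> (of_real c) (of_real \<omega>) \<longleftrightarrow> filamentation_solution \<kappa> \<sigma> u"
    unfolding profile_equation_iff [OF \<Phi>] sol
  proof (intro iffI allI impI)
    fix f assume "\<forall>f. smooth_periodic f \<longrightarrow>
      - of_real c * momentum_pairing \<Phi> f + of_real \<omega> * mass_pairing \<Phi> f = form \<sigma> \<Phi> (P_plus f)" and f: "smooth_periodic f"
    then show "\<i> * of_real W * momentum_pairing \<Phi> f + of_real V * momentum_pairing \<Phi> (vderiv f) = - of_real \<kappa> * form \<sigma> \<Phi> (P_plus (vderiv f))"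
      using smooth_periodic_D(3) [OF f] by (simp only: test [OF f])
  next
    fix f assume S: "\<forall>f. smooth_periodic f \<longrightarrow> \<i> * of_real W * momentum_pairing \<Phi> f + of_real V * momentum_pairing \<Phi> (vderiv f) =
      - of_real \<kappa> * form \<sigma> \<Phi> (P_plus (vderiv f))" and f: "smooth_periodic f"
    obtain g where g: "smooth_periodic g" "vderiv g = P_plus f" using P_plus_antiderivative [OF f] .
    have "- of_real c * momentum_pairing \<Phi> (vderiv g) + of_real \<omega> * mass_pairing \<Phi> (vderiv g) = form \<sigma> \<Phi> (P_plus (vderiv g))"
      using S g(1) by (simp only: test [OF g(1), symmetric])
    then show "- of_real c * momentum_pairing \<Phi> f + of_real \<omega> * mass_pairing \<Phi> f = form \<sigma> \<Phi> (P_plus f)"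
      unfolding g(2) defect_P_plus [OF \<Phi> f] P_plus_eq_self [OF smooth_P_plus [OF f] P_plus_positive [OF f]] .
  qed
  then show ?thesis by (simp add: u_def)
qed

theorem mainTheorem4:
  fixes \<sigma> Mstar Pstar :: real
  assumes "\<sigma> \<in> {0, 1}"
    and "Mstar > 0" and "Pstar > 0"
    and feasible: "2*pi * Mstar \<le> Pstar"
  shows
    "(\<exists>\<Phi>. minimizer \<sigma> Mstar Pstar \<Phi>)
     \<and> (\<forall>\<Phi>. minimizer \<sigma> Mstar Pstar \<Phi> \<longrightarrow>
          (\<exists>l \<mu> c \<omega> :: real.
             lagrange_multipliers \<sigma> \<Phi> l \<mu>
             \<and> euler_lagrange \<sigma> \<Phi> (of_real l) (of_real \<mu>)
             \<and> c = - (pi/4) * \<mu> \<and> \<omega> = (pi/4) * l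
             \<and> profile_equation \<sigma> \<Phi> (of_real c) (of_real \<omega>)
             \<and> (\<forall>\<kappa>\<in>{1, 2*pi}. filamentation_solution \<kappa> \<sigma> (profile_wave \<kappa> \<Phi> c \<omega>))))
     \<and> (\<forall>\<Phi> (l::real) (\<mu>::real). admissible \<Phi> \<longrightarrow>
          (lagrange_multipliers \<sigma> \<Phi> l \<mu> \<longleftrightarrow> euler_lagrange \<sigma> \<Phi> (of_real l) (of_real \<mu>)))
     \<and> (\<forall>\<Phi> (l::complex) \<mu> c \<omega>. admissible \<Phi> \<longrightarrow>
          c = - of_real (pi/4) * \<mu> \<longrightarrow> \<omega> = of_real (pi/4) * l \<longrightarrow>
          (euler_lagrange \<sigma> \<Phi> l \<mu> \<longleftrightarrow> profile_equation \<sigma> \<Phi> c \<omega>))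
     \<and> (\<forall>\<Phi> (c::real) (\<omega>::real). \<forall>\<kappa>\<in>{1, 2*pi}. admissible \<Phi> \<longrightarrow>
          (profile_equation \<sigma> \<Phi> (of_real c) (of_real \<omega>) \<longleftrightarrow>
           filamentation_solution \<kappa> \<sigma> (profile_wave \<kappa> \<Phi> c \<omega>)))"
proof (intro conjI allI impI ballI)
  show "\<exists>\<Phi>. minimizer \<sigma> Mstar Pstar \<Phi>"
    by (rule minimizer_exists) (use assms in auto)
next
  fix \<Phi> assume min: "minimizer \<sigma> Mstar Pstar \<Phi>"
  then have adm: "admissible \<Phi>" by (auto simp: minimizer_def is_arg_min_def)
  obtain l \<mu> where lm: "lagrange_multipliers \<sigma> \<Phi> l \<mu>"
    using minimizer_multipliers [OF min assms(2)] by blast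
  define c \<omega> where "c = - (pi/4) * \<mu>" and "\<omega> = (pi/4) * l"
  have el: "euler_lagrange \<sigma> \<Phi> (of_real l) (of_real \<mu>)"
    using lm by (simp only: lagrange_iff_euler [OF adm])
  have pe: "profile_equation \<sigma> \<Phi> (of_real c) (of_real \<omega>)"
    using el by (rule euler_iff_profile [OF adm, THEN iffD1, rotated 2]) (simp_all add: c_def \<omega>_def)
  have "filamentation_solution \<kappa> \<sigma> (profile_wave \<kappa> \<Phi> c \<omega>)" if "\<kappa> \<in> {1, 2*pi}" for \<kappa>
    using pe that profile_iff_solution [OF adm, of \<kappa>] by auto
  with lm el pe show "\<exists>l \<mu> c \<omega> :: real. lagrange_multipliers \<sigma> \<Phi> l \<mu>
      \<and> euler_lagrange \<sigma> \<Phi> (of_real l) (of_real \<mu>) \<and> c = - (pi/4) * \<mu> \<and> \<omega> = (pi/4) * l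
      \<and> profile_equation \<sigma> \<Phi> (of_real c) (of_real \<omega>)
      \<and> (\<forall>\<kappa>\<in>{1, 2*pi}. filamentation_solution \<kappa> \<sigma> (profile_wave \<kappa> \<Phi> c \<omega>))"
    unfolding c_def \<omega>_def by blast
next
  fix \<Phi> and l \<mu> :: real assume "admissible \<Phi>"
  then show "lagrange_multipliers \<sigma> \<Phi> l \<mu> \<longleftrightarrow> euler_lagrange \<sigma> \<Phi> (of_real l) (of_real \<mu>)"
    by (rule lagrange_iff_euler)
next
  fix \<Phi> and l \<mu> c \<omega> :: complex
  assume "admissible \<Phi>" "c = - of_real (pi/4) * \<mu>" "\<omega> = of_real (pi/4) * l"
  then show "euler_lagrange \<sigma> \<Phi> l \<mu> \<longleftrightarrow> profile_equation \<sigma> \<Phi> c \<omega>"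
    by (rule euler_iff_profile)
next
  fix \<Phi> and c \<omega> \<kappa> :: real
  assume "\<kappa> \<in> {1, 2*pi}" "admissible \<Phi>"
  then show "profile_equation \<sigma> \<Phi> (of_real c) (of_real \<omega>) \<longleftrightarrow>
      filamentation_solution \<kappa> \<sigma> (profile_wave \<kappa> \<Phi> c \<omega>)"
    by (intro profile_iff_solution) auto
qed

end
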